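(* (In $\mathrm{BST}$.) Let $(M,\Delta)$ be a standard uniform space, where $\Delta$ is a standard family of pseudo-metrics on the standard set $M$ that endows $M$ with a Hausdorff uniform structure. Let $\kappa=\max\{|\Delta|,\aleph_0\}$, let $I$ be a standard infinite set, and let $w\in I$ be such that Idealization into $w$-standard sets over standard sets of cardinality $\le\kappa$ holds. Let $(\widehat{M},\widehat{\Delta})$ and $c:M\to\widehat{M}$ be constructed from $(M,\Delta)$ and $w$ as in the context. Then $(\widehat{M},\widehat{\Delta})$ is a complete Hausdorff uniform space, and $c$ embeds $(M,\Delta)$ into $(\widehat{M},\widehat{\Delta})$.
   Context: **Theory $\mathrm{BST}$ (Bounded Set Theory).** Language: $\in$ and a unary predicate $\mathrm{st}$ ("is standard"). Quantifiers $\forall^{\mathrm{st}},\exists^{\mathrm{st}}$ range over standard sets, $\forall^{\mathrm{st\,fin}}$ over standard finite sets. An $\in$-formula is one not mentioning $\mathrm{st}$. Axioms: - all axioms of $\mathrm{ZFC}$ (Separation and Replacement only for $\in$-formulas); - Boundedness: $\forall x\,\exists^{\mathrm{st}}y\,(x\in y)$; - Transfer: $\forall^{\mathrm{st}}x\,\phi(x)\rightarrow\forall x\,\phi(x)$ for $\in$-formulas $\phi$ with standard parameters; - Standardization: $\forall A\,\exists^{\mathrm{st}}S\,\forall^{\mathrm{st}}x\,(x\in S\leftrightarrow x\in A\wedge\phi(x))$ for any $\mathrm{st}$-$\in$-formula $\phi$ with arbitrary parameters; - Bounded Idealization: for every standard $A$ and every $\in$-formula $\phi$ with arbitrary parameters,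 $\forall^{\mathrm{st\,fin}}a\subseteq A\,\exists y\,\forall x\in a\,\phi(x,y)\leftrightarrow\exists y\,\forall^{\mathrm{st}}x\in A\,\phi(x,y)$. **Notation.** For standard $A$ and any $\mathrm{st}$-$\in$-formula $\phi$, ${}^{\mathrm{st}}\{x\in A\mid\phi(x)\}$ is the unique standard set $S$ with $\forall^{\mathrm{st}}x\,(x\in S\leftrightarrow x\in A\wedge\phi(x))$. A real $r$ is limited if $|r|<n$ for some standard $n\in\mathbb{N}$; $r\simeq s$ means $|r-s|<1/n$ for all standard $n\in\mathbb{N}\setminus\{0\}$. For limited $r\in\mathbb{R}$, $\mathrm{sh}(r)$ is the unique standard real $\simeq r$. **$w$-standard sets.** For $w\in I$ with $I$ standard, $x$ is $w$-standard, $\mathrm{st}_w(x)$, if $x=f(w)$ for some standard function $f$ with domain $I$. Quantifiers with superscript $\mathrm{st}_w$ range over $w$-standard sets. "Idealization into $w$-standard sets over standard sets of cardinality $\le\kappa$" is: for every $\in$-formula $\phi$ with $w$-standard parameters and every standard set $A$ of cardinality $\le\kappa$, $$\forall^{\mathrm{st\,fin}}a\subseteq A\;\exists y\;\forall x\in a\;\phi(x,y)\leftrightarrow\exists^{\mathrm{st}_w}y\;\forall^{\mathrm{st}}x\in A\;\phi(x,y).$$ **Construction.** A point $x\in M$ is finite if for all standard $d\in\Delta$, $d(x,p)$ is limited for some (equivalently, all) standard $p\in M$. Define standard sets $B={}^{\mathrm{st}}\{f\in M^I\mid f(w)\text{ is a finite point of }M\}$ and $E={}^{\mathrm{st}}\{\langle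 f,g\rangle\in B\times B\mid d(f(w),g(w))\simeq0\text{ for all standard }d\in\Delta\}$; $E$ is an equivalence relation on $B$, and $f_E$ denotes the class of $f$. Let $\widehat{M}=B/E$. For each standard $d\in\Delta$ let $D:B\times B\to\mathbb{R}$ be the standard function with $D(f,g)=\mathrm{sh}(d(f(w),g(w)))$ for all standard $f,g\in B$, and let $\widehat{D}(f_E,g_E)=D(f,g)$, a well-defined pseudo-metric on $\widehat{M}$. Let $\widehat{\Delta}={}^{\mathrm{st}}\{\widehat{D}\mid d\in\Delta,\ d\text{ standard}\}$, and extend the assignment $d\mapsto\widehat{D}$ (given for standard $d\in\Delta$) by Standardization to a standard map $\Delta\to\widehat{\Delta}$. Let $c(x)=(c_x)_E$, where $c_x$ is the constant function on $I$ with value $x$. "$c$ embeds $(M,\Delta)$ into $(\widehat{M},\widehat{\Delta})$" means that $c$ is injective and $\widehat{D}(c(x),c(y))=d(x,y)$ for all $x,y\in M$ and $d\in\Delta$ (with $\widehat{D}$ the pseudo-metric corresponding to $d$). *)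

theory Defs
  imports Main
begin

section \<open>Formulas and satisfaction\<close>

text \<open>
  BST is a first-order theory with axiom schemata, so its st-\<open>\<in>\<close>-formulas are represented as data
  (de Bruijn indices; an environment maps index \<open>k\<close> to the value of the \<open>k\<close>-th free variable).
  A statement ``in BST'' is rendered as a statement about an arbitrary structure
  \<open>('u, mem, st)\<close> satisfying the axioms; the type \<open>'u\<close> is the universe of all (internal) sets.
  In the definitions below, \<open>\<epsilon>\<close> is the membership of the structure, and HOL quantifiers over \<open>'u\<close>
  are the quantifiers of the theory.
\<close>

datatype fm =
    FMem nat nat
  | FEq nat nat
  | FSt nat
  | FNeg fm
  | FAnd fm fm
  | FAll fm

definition ext_env :: "'u \<Rightarrow> (nat \<Rightarrow> 'u) \<Rightarrow> nat \<Rightarrow> 'u"  (infixr \<open>##\<close> 65) where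
  "x ## e = case_nat x e"

primrec sat :: "('u \<Rightarrow> 'u \<Rightarrow> bool) \<Rightarrow> ('u \<Rightarrow> bool) \<Rightarrow> fm \<Rightarrow> (nat \<Rightarrow> 'u) \<Rightarrow> bool" where
  "sat mem st (FMem i j) e \<longleftrightarrow> mem (e i) (e j)"
| "sat mem st (FEq i j) e \<longleftrightarrow> e i = e j"
| "sat mem st (FSt i) e \<longleftrightarrow> st (e i)"
| "sat mem st (FNeg p) e \<longleftrightarrow> \<not> sat mem st p e"
| "sat mem st (FAnd p q) e \<longleftrightarrow> sat mem st p e \<and> sat mem st q e"
| "sat mem st (FAll p) e \<longleftrightarrow> (\<forall>x. sat mem st p (x ## e))"

text \<open>The \<open>\<in>\<close>-formulas.\<close>

primrec st_free :: "fm \<Rightarrow> bool" where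
  "st_free (FMem i j) \<longleftrightarrow> True"
| "st_free (FEq i j) \<longleftrightarrow> True"
| "st_free (FSt i) \<longleftrightarrow> False"
| "st_free (FNeg p) \<longleftrightarrow> st_free p"
| "st_free (FAnd p q) \<longleftrightarrow> st_free p \<and> st_free q"
| "st_free (FAll p) \<longleftrightarrow> st_free p"


section \<open>Set-theoretic notions of the structure\<close>

text \<open>The operations, the order and the constants of a field, as sets of the structure.\<close>

record 'u field_str =
  f_set :: 'u
  f_add :: 'u
  f_mul :: 'u
  f_le :: 'u
  f_zero :: 'u
  f_one :: 'u

context
  fixes mem :: "'u \<Rightarrow> 'u \<Rightarrow> bool"  (infix \<open>\<epsilon>\<close> 50)
    and st :: "'u \<Rightarrow> bool"
    and R :: "'u field_str"
begin

definition subset_of :: "'u \<Rightarrow> 'u \<Rightarrow> bool" where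
  "subset_of a b \<longleftrightarrow> (\<forall>x. x \<epsilon> a \<longrightarrow> x \<epsilon> b)"

text \<open>The set \<open>{x | P x}\<close>, meaningful only if this class is a set of the structure.\<close>

definition set_of :: "('u \<Rightarrow> bool) \<Rightarrow> 'u" where
  "set_of P = (THE s. \<forall>x. x \<epsilon> s \<longleftrightarrow> P x)"

definition empty_set :: "'u" where
  "empty_set = set_of (\<lambda>x. False)"

definition unord_pair :: "'u \<Rightarrow> 'u \<Rightarrow> 'u" where
  "unord_pair a b = set_of (\<lambda>x. x = a \<or> x = b)"

definition ord_pair :: "'u \<Rightarrow> 'u \<Rightarrow> 'u" where
  "ord_pair a b = unord_pair (unord_pair a a) (unord_pair a b)"

definition inter_set :: "'u \<Rightarrow> 'u \<Rightarrow> 'u" where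
  "inter_set a b = set_of (\<lambda>x. x \<epsilon> a \<and> x \<epsilon> b)"

definition cprod :: "'u \<Rightarrow> 'u \<Rightarrow> 'u" where
  "cprod A B = set_of (\<lambda>p. \<exists>a b. a \<epsilon> A \<and> b \<epsilon> B \<and> p = ord_pair a b)"

definition is_fun :: "'u \<Rightarrow> 'u \<Rightarrow> 'u \<Rightarrow> bool" where
  "is_fun f A B \<longleftrightarrow> subset_of f (cprod A B) \<and> (\<forall>x. x \<epsilon> A \<longrightarrow> (\<exists>!y. ord_pair x y \<epsilon> f))"

definition app :: "'u \<Rightarrow> 'u \<Rightarrow> 'u" where
  "app f x = (THE y. ord_pair x y \<epsilon> f)"

definition app2 :: "'u \<Rightarrow> 'u \<Rightarrow> 'u \<Rightarrow> 'u" where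
  "app2 f x y = app f (ord_pair x y)"

definition is_inj :: "'u \<Rightarrow> 'u \<Rightarrow> 'u \<Rightarrow> bool" where
  "is_inj f A B \<longleftrightarrow>
     is_fun f A B \<and> (\<forall>x y. x \<epsilon> A \<and> y \<epsilon> A \<and> app f x = app f y \<longrightarrow> x = y)"

definition is_bij :: "'u \<Rightarrow> 'u \<Rightarrow> 'u \<Rightarrow> bool" where
  "is_bij f A B \<longleftrightarrow> is_inj f A B \<and> (\<forall>y. y \<epsilon> B \<longrightarrow> (\<exists>x. x \<epsilon> A \<and> app f x = y))"

text \<open>The set of all functions from \<open>A\<close> to \<open>B\<close>, written \<open>B\<^sup>A\<close> in set theory.\<close>

definition funs :: "'u \<Rightarrow> 'u \<Rightarrow> 'u" where
  "funs A B = set_of (\<lambda>f. is_fun f A B)"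

definition is_inductive :: "'u \<Rightarrow> bool" where
  "is_inductive J \<longleftrightarrow>
     (\<exists>z. z \<epsilon> J \<and> (\<forall>x. \<not> x \<epsilon> z)) \<and>
     (\<forall>n. n \<epsilon> J \<longrightarrow> (\<exists>s. s \<epsilon> J \<and> (\<forall>x. x \<epsilon> s \<longleftrightarrow> x \<epsilon> n \<or> x = n)))"

definition omega :: "'u" where
  "omega = set_of (\<lambda>n. \<forall>J. is_inductive J \<longrightarrow> n \<epsilon> J)"

text \<open>Finite in the sense of the structure, so possibly with nonstandardly many elements.\<close>

definition is_finite :: "'u \<Rightarrow> bool" where
  "is_finite A \<longleftrightarrow> (\<exists>n f. n \<epsilon> omega \<and> is_bij f A n)"

definition is_transitive :: "'u \<Rightarrow> bool" where
  "is_transitive a \<longleftrightarrow> (\<forall>x. x \<epsilon> a \<longrightarrow> subset_of x a)"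

text \<open>Adequate as a definition of ordinals in the presence of Foundation.\<close>

definition is_ordinal :: "'u \<Rightarrow> bool" where
  "is_ordinal a \<longleftrightarrow> is_transitive a \<and> (\<forall>x. x \<epsilon> a \<longrightarrow> is_transitive x)"

text \<open>\<open>k = |A|\<close>, as an initial ordinal.\<close>

definition is_card_of :: "'u \<Rightarrow> 'u \<Rightarrow> bool" where
  "is_card_of A k \<longleftrightarrow>
     is_ordinal k \<and> (\<exists>f. is_bij f A k) \<and> (\<forall>j. j \<epsilon> k \<longrightarrow> \<not> (\<exists>f. is_bij f A j))"

definition ord_max :: "'u \<Rightarrow> 'u \<Rightarrow> 'u" where
  "ord_max a b = (if subset_of a b then b else a)"

text \<open>\<open>|A| \<le> k\<close> for a cardinal \<open>k\<close>.\<close>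

definition card_le :: "'u \<Rightarrow> 'u \<Rightarrow> bool" where
  "card_le A k \<longleftrightarrow> (\<exists>f. is_inj f A k)"


subsection \<open>Real numbers\<close>

definition radd :: "'u \<Rightarrow> 'u \<Rightarrow> 'u" where
  "radd x y = app2 (f_add R) x y"

definition rmul :: "'u \<Rightarrow> 'u \<Rightarrow> 'u" where
  "rmul x y = app2 (f_mul R) x y"

definition rle :: "'u \<Rightarrow> 'u \<Rightarrow> bool" where
  "rle x y \<longleftrightarrow> ord_pair x y \<epsilon> f_le R"

definition rless :: "'u \<Rightarrow> 'u \<Rightarrow> bool" where
  "rless x y \<longleftrightarrow> rle x y \<and> x \<noteq> y"

definition is_real :: "'u \<Rightarrow> bool" where
  "is_real x \<longleftrightarrow> x \<epsilon> f_set R"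

text \<open>
  The reals are any Dedekind complete ordered field of the structure; completeness is with respect
  to the subsets that are elements of the structure. By ZFC such a field exists and is unique up to
  isomorphism.
\<close>

definition complete_ordered_field :: bool where
  "complete_ordered_field \<longleftrightarrow>
     is_fun (f_add R) (cprod (f_set R) (f_set R)) (f_set R) \<and>
     is_fun (f_mul R) (cprod (f_set R) (f_set R)) (f_set R) \<and>
     subset_of (f_le R) (cprod (f_set R) (f_set R)) \<and>
     is_real (f_zero R) \<and> is_real (f_one R) \<and> f_zero R \<noteq> f_one R \<and>
     (\<forall>x y z. is_real x \<and> is_real y \<and> is_real z \<longrightarrow>
        radd (radd x y) z = radd x (radd y z) \<and> radd x y = radd y x \<and>
        rmul (rmul x y) z = rmul x (rmul y z) \<and> rmul x y = rmul y x \<and>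
        rmul x (radd y z) = radd (rmul x y) (rmul x z)) \<and>
     (\<forall>x. is_real x \<longrightarrow> radd (f_zero R) x = x \<and> rmul (f_one R) x = x) \<and>
     (\<forall>x. is_real x \<longrightarrow> (\<exists>y. is_real y \<and> radd x y = f_zero R)) \<and>
     (\<forall>x. is_real x \<and> x \<noteq> f_zero R \<longrightarrow> (\<exists>y. is_real y \<and> rmul x y = f_one R)) \<and>
     (\<forall>x y z. is_real x \<and> is_real y \<and> is_real z \<longrightarrow>
        (rle x y \<or> rle y x) \<and> (rle x y \<and> rle y x \<longrightarrow> x = y) \<and>
        (rle x y \<and> rle y z \<longrightarrow> rle x z) \<and>
        (rle x y \<longrightarrow> rle (radd x z) (radd y z)) \<and>
        (rle x y \<and> rle (f_zero R) z \<longrightarrow> rle (rmul x z) (rmul y z))) \<and>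
     (\<forall>S. subset_of S (f_set R) \<and> (\<exists>x. x \<epsilon> S) \<and> (\<exists>b. is_real b \<and> (\<forall>x. x \<epsilon> S \<longrightarrow> rle x b)) \<longrightarrow>
        (\<exists>s. is_real s \<and> (\<forall>x. x \<epsilon> S \<longrightarrow> rle x s) \<and>
             (\<forall>b. is_real b \<and> (\<forall>x. x \<epsilon> S \<longrightarrow> rle x b) \<longrightarrow> rle s b)))"

definition standard_field_str :: bool where
  "standard_field_str \<longleftrightarrow>
     st (f_set R) \<and> st (f_add R) \<and> st (f_mul R) \<and> st (f_le R) \<and> st (f_zero R) \<and> st (f_one R)"

definition rneg :: "'u \<Rightarrow> 'u" where
  "rneg x = (THE y. is_real y \<and> radd x y = f_zero R)"

definition rinv :: "'u \<Rightarrow> 'u" where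
  "rinv x = (THE y. is_real y \<and> rmul x y = f_one R)"

definition rabs :: "'u \<Rightarrow> 'u" where
  "rabs x = (if rle (f_zero R) x then x else rneg x)"

definition rdist :: "'u \<Rightarrow> 'u \<Rightarrow> 'u" where
  "rdist x y = rabs (radd x (rneg y))"

text \<open>The natural numbers as a subset of the reals; \<open>J\<close> ranges over sets of the structure.\<close>

definition rnat :: "'u \<Rightarrow> bool" where
  "rnat n \<longleftrightarrow> (\<forall>J. f_zero R \<epsilon> J \<and> (\<forall>x. x \<epsilon> J \<longrightarrow> radd x (f_one R) \<epsilon> J) \<longrightarrow> n \<epsilon> J)"

definition limited :: "'u \<Rightarrow> bool" where
  "limited r \<longleftrightarrow> is_real r \<and> (\<exists>n. st n \<and> rnat n \<and> rless (rabs r) n)"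

definition infclose :: "'u \<Rightarrow> 'u \<Rightarrow> bool" where
  "infclose r s \<longleftrightarrow>
     is_real r \<and> is_real s \<and>
     (\<forall>n. st n \<and> rnat n \<and> n \<noteq> f_zero R \<longrightarrow> rless (rdist r s) (rinv n))"

definition shadow :: "'u \<Rightarrow> 'u" where
  "shadow r = (THE s. st s \<and> is_real s \<and> infclose r s)"


subsection \<open>Uniform spaces\<close>

definition pseudo_metric :: "'u \<Rightarrow> 'u \<Rightarrow> bool" where
  "pseudo_metric X d \<longleftrightarrow>
     is_fun d (cprod X X) (f_set R) \<and>
     (\<forall>x y z. x \<epsilon> X \<and> y \<epsilon> X \<and> z \<epsilon> X \<longrightarrow>
        rle (f_zero R) (app2 d x y) \<and> app2 d x x = f_zero R \<and> app2 d x y = app2 d y x \<and>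
        rle (app2 d x z) (radd (app2 d x y) (app2 d y z)))"

definition is_uniform_space :: "'u \<Rightarrow> 'u \<Rightarrow> bool" where
  "is_uniform_space X G \<longleftrightarrow> (\<forall>d. d \<epsilon> G \<longrightarrow> pseudo_metric X d)"

text \<open>The entourages of the uniform structure on \<open>X\<close> generated by the family \<open>G\<close>.\<close>

definition entourage :: "'u \<Rightarrow> 'u \<Rightarrow> 'u \<Rightarrow> bool" where
  "entourage X G V \<longleftrightarrow>
     subset_of V (cprod X X) \<and>
     (\<exists>a r. subset_of a G \<and> is_finite a \<and> is_real r \<and> rless (f_zero R) r \<and>
        (\<forall>x y. x \<epsilon> X \<and> y \<epsilon> X \<and> (\<forall>d. d \<epsilon> a \<longrightarrow> rless (app2 d x y) r) \<longrightarrow> ord_pair x y \<epsilon> V))"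

definition nbhd :: "'u \<Rightarrow> 'u \<Rightarrow> 'u \<Rightarrow> 'u \<Rightarrow> bool" where
  "nbhd X G x N \<longleftrightarrow> (\<exists>V. entourage X G V \<and> (\<forall>y. y \<epsilon> N \<longleftrightarrow> ord_pair x y \<epsilon> V))"

definition is_hausdorff :: "'u \<Rightarrow> 'u \<Rightarrow> bool" where
  "is_hausdorff X G \<longleftrightarrow>
     (\<forall>x y. x \<epsilon> X \<and> y \<epsilon> X \<and> x \<noteq> y \<longrightarrow>
        (\<exists>N N'. nbhd X G x N \<and> nbhd X G y N' \<and> \<not> (\<exists>z. z \<epsilon> N \<and> z \<epsilon> N')))"

definition is_filter :: "'u \<Rightarrow> 'u \<Rightarrow> bool" where
  "is_filter X F \<longleftrightarrow>
     (\<forall>A. A \<epsilon> F \<longrightarrow> subset_of A X) \<and> X \<epsilon> F \<and> \<not> empty_set \<epsilon> F \<and>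
     (\<forall>A B. A \<epsilon> F \<and> B \<epsilon> F \<longrightarrow> inter_set A B \<epsilon> F) \<and>
     (\<forall>A B. A \<epsilon> F \<and> subset_of A B \<and> subset_of B X \<longrightarrow> B \<epsilon> F)"

definition cauchy_filter :: "'u \<Rightarrow> 'u \<Rightarrow> 'u \<Rightarrow> bool" where
  "cauchy_filter X G F \<longleftrightarrow>
     is_filter X F \<and> (\<forall>V. entourage X G V \<longrightarrow> (\<exists>A. A \<epsilon> F \<and> subset_of (cprod A A) V))"

definition converges_to :: "'u \<Rightarrow> 'u \<Rightarrow> 'u \<Rightarrow> 'u \<Rightarrow> bool" where
  "converges_to X G F x \<longleftrightarrow> x \<epsilon> X \<and> (\<forall>N. nbhd X G x N \<longrightarrow> N \<epsilon> F)"

definition is_complete :: "'u \<Rightarrow> 'u \<Rightarrow> bool" where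
  "is_complete X G \<longleftrightarrow> (\<forall>F. cauchy_filter X G F \<longrightarrow> (\<exists>x. converges_to X G F x))"


subsection \<open>Standardization and \<open>w\<close>-standard sets\<close>

text \<open>\<open>\<^sup>s\<^sup>t{x \<in> A | P x}\<close>; it exists and is unique for \<open>P\<close> given by an st-\<open>\<in>\<close>-formula.\<close>

definition st_set :: "'u \<Rightarrow> ('u \<Rightarrow> bool) \<Rightarrow> 'u" where
  "st_set A P = (THE S. st S \<and> (\<forall>x. st x \<longrightarrow> (x \<epsilon> S \<longleftrightarrow> x \<epsilon> A \<and> P x)))"

definition w_standard :: "'u \<Rightarrow> 'u \<Rightarrow> 'u \<Rightarrow> bool" where
  "w_standard I w x \<longleftrightarrow> (\<exists>f B. st f \<and> is_fun f I B \<and> x = app f w)"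

text \<open>
  Idealization into \<open>w\<close>-standard sets over standard sets of cardinality at most \<open>k\<close>. In a formula \<open>p\<close>
  the variables with indices \<open>0\<close> and \<open>1\<close> are \<open>x\<close> and \<open>y\<close>; the environment \<open>e\<close> supplies the parameters.
\<close>

definition w_idealization :: "'u \<Rightarrow> 'u \<Rightarrow> 'u \<Rightarrow> bool" where
  "w_idealization I w k \<longleftrightarrow>
     (\<forall>p e A. st_free p \<and> (\<forall>i. w_standard I w (e i)) \<and> st A \<and> card_le A k \<longrightarrow>
        ((\<forall>a. st a \<and> is_finite a \<and> subset_of a A \<longrightarrow> (\<exists>y. \<forall>x. x \<epsilon> a \<longrightarrow>
            sat mem st p (x ## y ## e))) \<longleftrightarrow>
         (\<exists>y. w_standard I w y \<and> (\<forall>x. st x \<and> x \<epsilon> A \<longrightarrow> sat mem st p (x ## y ## e)))))"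


subsection \<open>The nonstandard hull\<close>

context
  fixes M :: 'u and \<Delta> :: 'u and I :: 'u and w :: 'u
begin

definition finite_point :: "'u \<Rightarrow> bool" where
  "finite_point x \<longleftrightarrow>
     x \<epsilon> M \<and> (\<forall>d. st d \<and> d \<epsilon> \<Delta> \<longrightarrow> (\<exists>q. st q \<and> q \<epsilon> M \<and> limited (app2 d x q)))"

definition hull_B :: "'u" where
  "hull_B = st_set (funs I M) (\<lambda>f. finite_point (app f w))"

definition hull_E :: "'u" where
  "hull_E = st_set (cprod hull_B hull_B)
     (\<lambda>p. \<exists>f g. p = ord_pair f g \<and>
        (\<forall>d. st d \<and> d \<epsilon> \<Delta> \<longrightarrow> infclose (app2 d (app f w) (app g w)) (f_zero R)))"

definition hull_class :: "'u \<Rightarrow> 'u" where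
  "hull_class f = set_of (\<lambda>g. g \<epsilon> hull_B \<and> ord_pair f g \<epsilon> hull_E)"

definition hull_M :: "'u" where
  "hull_M = set_of (\<lambda>q. \<exists>f. f \<epsilon> hull_B \<and> q = hull_class f)"

text \<open>The function \<open>D\<close> and the induced \<open>D^\<close> on classes, for a standard \<open>d\<close>.\<close>

definition hull_D :: "'u \<Rightarrow> 'u" where
  "hull_D d = (THE D. st D \<and> is_fun D (cprod hull_B hull_B) (f_set R) \<and>
     (\<forall>f g. st f \<and> st g \<and> f \<epsilon> hull_B \<and> g \<epsilon> hull_B \<longrightarrow>
        app2 D f g = shadow (app2 d (app f w) (app g w))))"

definition hull_dist :: "'u \<Rightarrow> 'u" where
  "hull_dist d = (THE h. is_fun h (cprod hull_M hull_M) (f_set R) \<and>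
     (\<forall>f g. f \<epsilon> hull_B \<and> g \<epsilon> hull_B \<longrightarrow>
        app2 h (hull_class f) (hull_class g) = app2 (hull_D d) f g))"

definition hull_family :: "'u" where
  "hull_family = st_set (funs (cprod hull_M hull_M) (f_set R))
     (\<lambda>h. \<exists>d. st d \<and> d \<epsilon> \<Delta> \<and> h = hull_dist d)"

text \<open>
  The standard map on all of \<open>\<Delta>\<close>; for nonstandard \<open>d\<close> the pseudo-metric corresponding to \<open>d\<close> is its
  value at \<open>d\<close>, not \<open>hull_dist d\<close>.
\<close>

definition hull_map :: "'u" where
  "hull_map = (THE H. st H \<and> is_fun H \<Delta> hull_family \<and>
     (\<forall>d. st d \<and> d \<epsilon> \<Delta> \<longrightarrow> app H d = hull_dist d))"

definition const_fun :: "'u \<Rightarrow> 'u" where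
  "const_fun x = set_of (\<lambda>p. \<exists>i. i \<epsilon> I \<and> p = ord_pair i x)"

definition hull_c :: "'u" where
  "hull_c = set_of (\<lambda>p. \<exists>x. x \<epsilon> M \<and> p = ord_pair x (hull_class (const_fun x)))"

end

text \<open>\<open>c\<close> embeds \<open>(X, G)\<close> into \<open>(Y, G')\<close>, where \<open>H : G \<rightarrow> G'\<close> matches up the pseudo-metrics.\<close>

definition embeds :: "'u \<Rightarrow> 'u \<Rightarrow> 'u \<Rightarrow> 'u \<Rightarrow> 'u \<Rightarrow> 'u \<Rightarrow> bool" where
  "embeds c H X G Y G' \<longleftrightarrow>
     is_fun H G G' \<and> is_inj c X Y \<and>
     (\<forall>x y d. x \<epsilon> X \<and> y \<epsilon> X \<and> d \<epsilon> G \<longrightarrow> app2 (app H d) (app c x) (app c y) = app2 d x y)"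

end


section \<open>The axioms of BST\<close>

text \<open>
  In Standardization and in the schemata of ZFC, the environment \<open>e\<close> supplies arbitrary parameters.
  In Replacement, index \<open>0\<close> is the argument and index \<open>1\<close> the value.
\<close>

locale BST =
  fixes mem :: "'u \<Rightarrow> 'u \<Rightarrow> bool"  (infix \<open>\<epsilon>\<close> 50)
    and st :: "'u \<Rightarrow> bool"
  assumes Extensionality: "(\<forall>x. x \<epsilon> a \<longleftrightarrow> x \<epsilon> b) \<Longrightarrow> a = b"
    and Foundation: "x \<epsilon> a \<Longrightarrow> \<exists>y. y \<epsilon> a \<and> \<not> (\<exists>z. z \<epsilon> y \<and> z \<epsilon> a)"
    and Pairing: "\<exists>c. a \<epsilon> c \<and> b \<epsilon> c"
    and Union: "\<exists>u. \<forall>x y. x \<epsilon> y \<and> y \<epsilon> a \<longrightarrow> x \<epsilon> u"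
    and Power_Set: "\<exists>u. \<forall>x. subset_of mem x a \<longrightarrow> x \<epsilon> u"
    and Infinity: "\<exists>J. is_inductive mem J"
    and Choice: "(\<forall>x. x \<epsilon> a \<longrightarrow> (\<exists>z. z \<epsilon> x)) \<Longrightarrow>
       (\<forall>x y. x \<epsilon> a \<and> y \<epsilon> a \<and> x \<noteq> y \<longrightarrow> \<not> (\<exists>z. z \<epsilon> x \<and> z \<epsilon> y)) \<Longrightarrow>
       \<exists>c. \<forall>x. x \<epsilon> a \<longrightarrow> (\<exists>!z. z \<epsilon> x \<and> z \<epsilon> c)"
    and Separation: "st_free p \<Longrightarrow> \<exists>s. \<forall>x. x \<epsilon> s \<longleftrightarrow> x \<epsilon> a \<and> sat mem st p (x ## e)"
    and Replacement: "st_free p \<Longrightarrow> (\<forall>x. x \<epsilon> a \<longrightarrow> (\<exists>!y. sat mem st p (x ## y ## e))) \<Longrightarrow>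
       \<exists>s. \<forall>y. y \<epsilon> s \<longleftrightarrow> (\<exists>x. x \<epsilon> a \<and> sat mem st p (x ## y ## e))"
    and Boundedness: "\<exists>y. st y \<and> x \<epsilon> y"
    and Transfer: "st_free p \<Longrightarrow> (\<forall>i. st (e i)) \<Longrightarrow>
       (\<forall>x. st x \<longrightarrow> sat mem st p (x ## e)) \<longrightarrow> (\<forall>x. sat mem st p (x ## e))"
    and Standardization: "\<exists>s. st s \<and> (\<forall>x. st x \<longrightarrow> (x \<epsilon> s \<longleftrightarrow> x \<epsilon> a \<and> sat mem st p (x ## e)))"
    and Bounded_Idealization: "st A \<Longrightarrow> st_free p \<Longrightarrow>
       (\<forall>a. st a \<and> is_finite mem a \<and> subset_of mem a A \<longrightarrow> (\<exists>y. \<forall>x. x \<epsilon> a \<longrightarrow>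
            sat mem st p (x ## y ## e))) \<longleftrightarrow>
       (\<exists>y. \<forall>x. st x \<and> x \<epsilon> A \<longrightarrow> sat mem st p (x ## y ## e))"

end

theory Submission
  imports Defs
begin

text \<open>
  Shadows turn the distances \<open>d(f(w), g(w))\<close> into standard pseudo-metrics on \<open>B\<close>, since
  \<open>r \<le> p + q\<close> implies \<open>sh r \<le> sh p + sh q\<close>; all claims except completeness then follow by Transfer
  from the case of standard points. For completeness let \<open>F\<close> be a standard Cauchy filter and \<open>q\<^sub>n\<close>
  a standard null sequence. Choose a standard family \<open>k(d, n) \<in> B\<close> such that the ball of radius \<open>q\<^sub>n\<close>
  about the class of \<open>k(d, n)\<close> belongs to \<open>F\<close>. Finitely many of these balls have a common standard
  point, so Idealization into \<open>w\<close>-standard sets yields a point \<open>f(w)\<close>, \<open>f\<close> standard, at distance less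
  than \<open>q\<^sub>n\<close> from \<open>k(d, n)(w)\<close> for all standard \<open>d\<close> and \<open>n\<close>. The class of \<open>f\<close> is the limit of \<open>F\<close>.
\<close>

section \<open>Definable predicates\<close>

text \<open>The axiom schemata speak of formulas as data, whereas the notions of the hull are HOL
  functions built from \<open>app\<close> and \<open>THE\<close>, with unspecified values outside
  their intended domain. Each notion therefore needs a characterization that is visibly a formula
  before Transfer, Standardization or Idealization can be applied to it; this determines the form of
  many lemmas.

  Ordinary Idealization would also give a point near all the centres, but possibly not one of the
  form f(w) with f standard, and only such points determine standard elements of the hull. The bound
  \<kappa> limits the number of conditions that can be met at once: one for each pseudo-metric and
  each term of a sequence is affordable, one for each standard positive real may not be. Hence the
  null sequence.

  The distances of the hull are tied to values at w only through standard functions. So every claim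
  is checked at standard elements, where D can be compared with d, and nonstandard elements are
  reached by Transfer alone.\<close>

primrec rename_fm :: "(nat \<Rightarrow> nat) \<Rightarrow> fm \<Rightarrow> fm" where
  "rename_fm f (FMem i j) = FMem (f i) (f j)"
| "rename_fm f (FEq i j) = FEq (f i) (f j)"
| "rename_fm f (FSt i) = FSt (f i)"
| "rename_fm f (FNeg p) = FNeg (rename_fm f p)"
| "rename_fm f (FAnd p q) = FAnd (rename_fm f p) (rename_fm f q)"
| "rename_fm f (FAll p) = FAll (rename_fm (case_nat 0 (\<lambda>i. Suc (f i))) p)"

lemma ext_env_simps [simp]: "(x ## e) 0 = x" "(x ## e) (Suc n) = e n"
  by (simp_all add: ext_env_def)

lemma sat_rename_fm: "sat mem st (rename_fm f p) e \<longleftrightarrow> sat mem st p (\<lambda>i. e (f i))"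
proof (induction p arbitrary: f e)
  case (FAll p)
  have "(\<lambda>i. (x ## e) (case i of 0 \<Rightarrow> 0 | Suc i \<Rightarrow> Suc (f i))) = x ## (\<lambda>i. e (f i))" for x
    by (rule ext) (simp add: ext_env_def split: nat.split)
  then show ?case by (simp add: FAll.IH)
qed auto

lemma st_free_rename_fm [simp]: "st_free (rename_fm f p) = st_free p"
  by (induction p arbitrary: f) auto

text \<open>Variables of a formula occupy the even slots and parameters the odd ones. Both supplies
  are infinite, so a formula never has to declare how many free variables it has, and renaming
  variables leaves the parameters in place.\<close>

definition interleave :: "(nat \<Rightarrow> 'u) \<Rightarrow> (nat \<Rightarrow> 'u) \<Rightarrow> nat \<Rightarrow> 'u" where
  "interleave e c i = (if even i then e (i div 2) else c (i div 2))"

lemma interleave_simps [simp]: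
  "interleave e c (2 * n) = e n" "interleave e c (Suc (2 * n)) = c n"
  by (simp_all add: interleave_def)

context BST
begin

text \<open>
  \<open>definable K b P\<close>: the predicate \<open>P\<close> on environments is given by a formula whose parameters are
  standard or satisfy \<open>K\<close>; the predicate \<open>st\<close> may occur in it only if \<open>b\<close> holds. The closure rules
  \<open>definable_intros\<close> recognize HOL predicates written with \<open>e 0\<close>, \<open>e 1\<close>, \<dots> as formulas.
\<close>

definition definable :: "('u \<Rightarrow> bool) \<Rightarrow> bool \<Rightarrow> ((nat \<Rightarrow> 'u) \<Rightarrow> bool) \<Rightarrow> bool" where
  "definable K b P \<longleftrightarrow> (\<exists>p c. (b \<or> st_free p) \<and> (\<forall>i. st (c i) \<or> K (c i)) \<and>
     (\<forall>e. P e \<longleftrightarrow> sat (\<epsilon>) st p (interleave e c)))"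

text \<open>The language has no function symbols, so a term is represented by its graph, with the
  value in slot 0 and the arguments shifted by one.\<close>

definition definable_term :: "('u \<Rightarrow> bool) \<Rightarrow> bool \<Rightarrow> ((nat \<Rightarrow> 'u) \<Rightarrow> 'u) \<Rightarrow> bool" where
  "definable_term K b t \<longleftrightarrow> definable K b (\<lambda>e. e 0 = t (\<lambda>n. e (Suc n)))"

lemma ex_standard: "\<exists>x. st x"
  using Boundedness by blast

lemma definable_rename:
  assumes "definable K b P"
  shows "definable K b (\<lambda>e. P (\<lambda>n. e (f n)))"
proof -
  obtain p c where p: "b \<or> st_free p" "\<forall>i. st (c i) \<or> K (c i)"
    and P: "\<And>e. P e \<longleftrightarrow> sat (\<epsilon>) st p (interleave e c)"
    using assms unfolding definable_def by blast
  let ?g = "\<lambda>i. if even i then 2 * f (i div 2) else i"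
  have "interleave (\<lambda>n. e (f n)) c = (\<lambda>i. interleave e c (?g i))" for e
    by (rule ext) (auto simp: interleave_def elim!: oddE evenE)
  then have "P (\<lambda>n. e (f n)) \<longleftrightarrow> sat (\<epsilon>) st (rename_fm ?g p) (interleave e c)" for e
    by (simp add: P sat_rename_fm)
  then show ?thesis
    unfolding definable_def using p by (intro exI[of _ "rename_fm ?g p"] exI[of _ c]) auto
qed

lemma definable_not: "definable K b P \<Longrightarrow> definable K b (\<lambda>e. \<not> P e)"
  unfolding definable_def
  by (elim exE conjE, rule_tac x = "FNeg p" in exI, rule_tac x = c in exI) auto

lemma definable_conj:
  assumes "definable K b P" "definable K b Q"
  shows "definable K b (\<lambda>e. P e \<and> Q e)"
proof -
  obtain p c where p: "b \<or> st_free p" "\<forall>i. st (c i) \<or> K (c i)"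
    and P: "\<And>e. P e \<longleftrightarrow> sat (\<epsilon>) st p (interleave e c)"
    using assms(1) unfolding definable_def by blast
  obtain q d where q: "b \<or> st_free q" "\<forall>i. st (d i) \<or> K (d i)"
    and Q: "\<And>e. Q e \<longleftrightarrow> sat (\<epsilon>) st q (interleave e d)"
    using assms(2) unfolding definable_def by blast
  \<comment> \<open>The two parameter sequences are merged by interleaving them a second time;
    \<open>?f\<close> and \<open>?g\<close> redirect the odd slots of \<open>p\<close> and
    \<open>q\<close> to the places where \<open>c\<close> and \<open>d\<close> end up.\<close>
  let ?cd = "interleave c d"
  let ?f = "\<lambda>i. if even i then i else Suc (2 * (2 * (i div 2)))"
  let ?g = "\<lambda>i. if even i then i else Suc (2 * Suc (2 * (i div 2)))"
  have f: "interleave e c = (\<lambda>i. interleave e ?cd (?f i))" for e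
    by (rule ext) (auto simp: interleave_def elim!: oddE evenE)
  have g: "interleave e d = (\<lambda>i. interleave e ?cd (?g i))" for e
    by (rule ext) (auto simp: interleave_def elim!: oddE evenE)
  have "P e \<and> Q e \<longleftrightarrow>
      sat (\<epsilon>) st (FAnd (rename_fm ?f p) (rename_fm ?g q)) (interleave e ?cd)" for e
    by (simp add: P Q sat_rename_fm f[symmetric] g[symmetric])
  moreover have "st (?cd i) \<or> K (?cd i)" for i
    using p(2) q(2) by (simp add: interleave_def)
  ultimately show ?thesis
    unfolding definable_def using p(1) q(1)
    by (intro exI[of _ "FAnd (rename_fm ?f p) (rename_fm ?g q)"] exI[of _ ?cd]) auto
qed

lemma definable_all:
  assumes "definable K b (\<lambda>e. P (e 0) (\<lambda>n. e (Suc n)))"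
  shows "definable K b (\<lambda>e. \<forall>x. P x e)"
proof -
  obtain p c where p: "b \<or> st_free p" "\<forall>i. st (c i) \<or> K (c i)"
    and P: "\<And>e. P (e 0) (\<lambda>n. e (Suc n)) \<longleftrightarrow> sat (\<epsilon>) st p (interleave e c)"
    using assms unfolding definable_def by blast
  \<comment> \<open>Under the quantifier the bound variable stands in front of the whole interleaved
    sequence instead of in front of the variables alone. Even slots beyond 0 therefore move down by
    one and odd slots up by one.\<close>
  let ?f = "\<lambda>i. if i = 0 then 0 else if even i then i - 1 else Suc i"
  have "interleave (x ## e) c = (\<lambda>i. (x ## interleave e c) (?f i))" for x e
  proof
    fix i
    show "interleave (x ## e) c i = (x ## interleave e c) (?f i)"
    proof (cases "even i")
      case True
      then obtain k where "i = 2 * k" by auto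
      then show ?thesis by (cases k) (auto simp: interleave_def)
    next
      case False
      then obtain k where "i = Suc (2 * k)" by (auto elim: oddE)
      then show ?thesis by (auto simp: interleave_def)
    qed
  qed
  then have "(\<forall>x. P x e) \<longleftrightarrow> sat (\<epsilon>) st (FAll (rename_fm ?f p)) (interleave e c)" for e
    using P[of "_ ## e"] by (simp add: sat_rename_fm)
  then show ?thesis
    unfolding definable_def using p by (intro exI[of _ "FAll (rename_fm ?f p)"] exI[of _ c]) auto
qed

lemma definable_disj:
  assumes "definable K b P" "definable K b Q"
  shows "definable K b (\<lambda>e. P e \<or> Q e)"
  using definable_not[OF definable_conj[OF definable_not[OF assms(1)] definable_not[OF assms(2)]]]
  by simp

lemma definable_imp:
  assumes "definable K b P" "definable K b Q"
  shows "definable K b (\<lambda>e. P e \<longrightarrow> Q e)"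
  using definable_disj[OF definable_not[OF assms(1)] assms(2)] by (simp only: imp_conv_disj)

lemma definable_iff:
  assumes "definable K b P" "definable K b Q"
  shows "definable K b (\<lambda>e. P e \<longleftrightarrow> Q e)"
  using definable_conj[OF definable_imp[OF assms] definable_imp[OF assms(2,1)]]
  by (simp only: iff_conv_conj_imp)

lemma definable_ex:
  assumes "definable K b (\<lambda>e. P (e 0) (\<lambda>n. e (Suc n)))"
  shows "definable K b (\<lambda>e. \<exists>x. P x e)"
  using definable_not[OF definable_all[where P = "\<lambda>x e. \<not> P x e", OF definable_not[OF assms]]]
  by simp

text \<open>\<open>Q\<close> is any HOL proposition that does not mention the environment; whichever
  truth value it has, it agrees with a fixed formula.\<close>

lemma definable_const: "definable K b (\<lambda>e. Q)"
proof -
  obtain s where "st s" using ex_standard by blast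
  have "definable K b (\<lambda>e. \<forall>x. x = x)"
    unfolding definable_def using \<open>st s\<close>
    by (intro exI[of _ "FAll (FEq 0 0)"] exI[of _ "\<lambda>_. s"]) auto
  from this definable_not[OF this] show ?thesis by (cases Q) simp_all
qed

lemma definable_term_var: "definable_term K b (\<lambda>e. e n)"
proof -
  obtain s where "st s" using ex_standard by blast
  then show ?thesis
    unfolding definable_term_def definable_def
    by (intro exI[of _ "FEq 0 (2 * Suc n)"] exI[of _ "\<lambda>_. s"])
      (auto simp: interleave_def simp del: mult_Suc_right)
qed

lemma definable_term_const:
  assumes "st a \<or> K a"
  shows "definable_term K b (\<lambda>e. a)"
  unfolding definable_term_def definable_def using assms
  by (intro exI[of _ "FEq 0 1"] exI[of _ "\<lambda>_. a"]) (auto simp: interleave_def)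

text \<open>Substituting a term becomes \<open>\<exists>x. x = t e \<and> P x e\<close>, which uses
  only the graph of \<open>t\<close>.\<close>

lemma definable_subst:
  assumes "definable_term K b t" "definable K b (\<lambda>e. P (e 0) (\<lambda>n. e (Suc n)))"
  shows "definable K b (\<lambda>e. P (t e) e)"
proof -
  have "definable K b (\<lambda>e. \<exists>x. x = t e \<and> P x e)"
    by (intro definable_ex definable_conj assms(1)[unfolded definable_term_def] assms(2))
  then show ?thesis by simp
qed

lemma definable_subst1:
  assumes "definable K b (\<lambda>e. Q (e 0))" "definable_term K b t"
  shows "definable K b (\<lambda>e. Q (t e))"
  using assms(2) assms(1) by (rule definable_subst[where P = "\<lambda>x e. Q x"])

lemma definable_term_rename:
  assumes "definable_term K b t"
  shows "definable_term K b (\<lambda>e. t (\<lambda>n. e (f n)))"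
  using definable_rename[OF assms[unfolded definable_term_def], of "case_nat 0 (\<lambda>i. Suc (f i))"]
  by (simp add: definable_term_def)

lemma definable_subst2:
  assumes Q: "definable K b (\<lambda>e. Q (e 0) (e 1))" and s: "definable_term K b s"
    and t: "definable_term K b t"
  shows "definable K b (\<lambda>e. Q (s e) (t e))"
proof (rule definable_subst[where P = "\<lambda>x e. Q x (t e)", OF s])
  have "definable K b (\<lambda>e. Q (e 1) (e 0))"
    using definable_rename[OF Q, of "\<lambda>n. if n = 0 then 1 else 0"] by simp
  then have "definable K b (\<lambda>e. Q (e (Suc 0)) (e 0))" by simp
  from definable_subst[where P = "\<lambda>y e. Q (e 0) y", OF definable_term_rename[OF t, of Suc] this]
  show "definable K b (\<lambda>e. Q (e 0) (t (\<lambda>n. e (Suc n))))" .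
qed

lemma definable_subst3:
  assumes Q: "definable K b (\<lambda>e. Q (e 0) (e 1) (e 2))" and s: "definable_term K b s"
    and t: "definable_term K b t" and u: "definable_term K b u"
  shows "definable K b (\<lambda>e. Q (s e) (t e) (u e))"
proof (rule definable_subst[where P = "\<lambda>x e. Q x (t e) (u e)", OF s])
  let ?S = "\<lambda>e n. e (Suc n)"
  show "definable K b (\<lambda>e. Q (e 0) (t (?S e)) (u (?S e)))"
  proof (rule definable_subst[where P = "\<lambda>y e. Q (e 0) y (u (?S e))", OF definable_term_rename[OF t]])
    have "definable K b (\<lambda>e. Q (e 2) (e 1) (e 0))"
      using definable_rename[OF Q, of "\<lambda>n. 2 - n"] by simp
    then have "definable K b (\<lambda>e. Q (e (Suc (Suc 0))) (e (Suc 0)) (e 0))"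
      by (simp add: numeral_2_eq_2)
    from definable_subst[where P = "\<lambda>z e. Q (e 1) (e 0) z",
        OF definable_term_rename[OF u, of "\<lambda>n. Suc (Suc n)"]] this
    show "definable K b (\<lambda>e. Q (e (Suc 0)) (e 0) (u (\<lambda>n. e (Suc (Suc n)))))" by simp
  qed
qed

lemma definable_eq:
  assumes "definable_term K b s" "definable_term K b t"
  shows "definable K b (\<lambda>e. s e = t e)"
proof (rule definable_subst2[OF _ assms])
  show "definable K b (\<lambda>e. e 0 = e 1)"
    using definable_term_var[of K b 0] by (simp add: definable_term_def)
qed

lemma definable_mem:
  assumes "definable_term K b s" "definable_term K b t"
  shows "definable K b (\<lambda>e. s e \<epsilon> t e)"
proof (rule definable_subst2[OF _ assms])
  obtain s where "st s" using ex_standard by blast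
  then show "definable K b (\<lambda>e. e 0 \<epsilon> e 1)"
    unfolding definable_def
    by (intro exI[of _ "FMem 0 2"] exI[of _ "\<lambda>_. s"]) (auto simp: interleave_def)
qed

lemma definable_st:
  assumes "definable_term K True t"
  shows "definable K True (\<lambda>e. st (t e))"
proof (rule definable_subst1[OF _ assms])
  obtain s where "st s" using ex_standard by blast
  then show "definable K True (\<lambda>e. st (e 0))"
    unfolding definable_def
    by (intro exI[of _ "FSt 0"] exI[of _ "\<lambda>_. s"]) (auto simp: interleave_def)
qed

lemma definable_ex1:
  assumes "definable K b (\<lambda>e. P (e 0) (\<lambda>n. e (Suc n)))"
  shows "definable K b (\<lambda>e. \<exists>!x. P x e)"
proof -
  have *: "definable K b (\<lambda>e. P (e 0) (\<lambda>n. e (Suc (Suc n))))"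
    using definable_rename[OF assms, of "case_nat 0 (\<lambda>n. Suc (Suc n))"] by simp
  have "definable K b (\<lambda>e. \<exists>x. P x e \<and> (\<forall>y. P y e \<longrightarrow> y = x))"
    by (intro definable_ex definable_conj definable_all definable_imp definable_eq
        definable_term_var assms *)
  then show ?thesis by (simp add: Ex1_def)
qed

lemma definable_if:
  assumes "definable K b P" "definable K b Q" "definable K b R"
  shows "definable K b (\<lambda>e. if P e then Q e else R e)"
proof -
  have "definable K b (\<lambda>e. (P e \<longrightarrow> Q e) \<and> (\<not> P e \<longrightarrow> R e))"
    by (intro definable_conj definable_imp definable_not assms)
  then show ?thesis by (simp add: if_bool_eq_conj)
qed

lemmas definable_intros =
  definable_const definable_not definable_conj definable_disj definable_imp definable_iff
  definable_all definable_ex definable_ex1 definable_if definable_eq definable_mem definable_st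
  definable_term_var definable_term_const

lemma definable_term1:
  assumes "\<And>z x. z = F x \<longleftrightarrow> Q z x" "definable K b (\<lambda>e. Q (e 0) (e 1))" "definable_term K b s"
  shows "definable_term K b (\<lambda>e. F (s e))"
  unfolding definable_term_def assms(1)
  by (rule definable_subst2[OF assms(2) definable_term_var definable_term_rename[OF assms(3)]])

lemma definable_term2:
  assumes "\<And>z x y. z = F x y \<longleftrightarrow> Q z x y" "definable K b (\<lambda>e. Q (e 0) (e 1) (e 2))"
    "definable_term K b s" "definable_term K b t"
  shows "definable_term K b (\<lambda>e. F (s e) (t e))"
  unfolding definable_term_def assms(1)
  by (rule definable_subst3[OF assms(2) definable_term_var definable_term_rename[OF assms(3)]
        definable_term_rename[OF assms(4)]])

section \<open>The axiom schemata for definable predicates\<close>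

abbreviation standard_definable :: "((nat \<Rightarrow> 'u) \<Rightarrow> bool) \<Rightarrow> bool" where
  "standard_definable \<equiv> definable (\<lambda>_. False) False"

abbreviation internal :: "((nat \<Rightarrow> 'u) \<Rightarrow> bool) \<Rightarrow> bool" where
  "internal \<equiv> definable (\<lambda>_. True) False"

abbreviation external :: "((nat \<Rightarrow> 'u) \<Rightarrow> bool) \<Rightarrow> bool" where
  "external \<equiv> definable (\<lambda>_. True) True"

text \<open>Passes to the format of the axioms, where the variable stands in front of the
  parameters. As \<open>P\<close> looks only at slot 0, the rest of the environment is free;
  evaluating at \<open>x ## c\<close> makes every slot of the interleaved sequence an entry of
  \<open>x ## c\<close>, so that a renaming suffices.\<close>

lemma definable_formula1:
  assumes "definable K b (\<lambda>e. P (e 0))"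
  obtains p c where "b \<or> st_free p" "\<forall>i. st (c i) \<or> K (c i)" "\<And>x. P x \<longleftrightarrow> sat (\<epsilon>) st p (x ## c)"
proof -
  obtain p c where p: "b \<or> st_free p" "\<forall>i. st (c i) \<or> K (c i)"
    and P: "\<And>e. P (e 0) \<longleftrightarrow> sat (\<epsilon>) st p (interleave e c)"
    using assms unfolding definable_def by blast
  let ?f = "\<lambda>i. if even i then i div 2 else Suc (i div 2)"
  have "interleave (x ## c) c = (\<lambda>i. (x ## c) (?f i))" for x
    by (rule ext) (auto simp: interleave_def)
  then have "P x \<longleftrightarrow> sat (\<epsilon>) st (rename_fm ?f p) (x ## c)" for x
    using P[of "x ## c"] by (simp add: sat_rename_fm)
  then show thesis
    using p that[of "rename_fm ?f p" c] by simp
qed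

lemma definable_formula2:
  assumes "definable K b (\<lambda>e. P (e 0) (e 1))"
  obtains p c where "b \<or> st_free p" "\<forall>i. st (c i) \<or> K (c i)"
    "\<And>x y. P x y \<longleftrightarrow> sat (\<epsilon>) st p (x ## y ## c)"
proof -
  obtain p c where p: "b \<or> st_free p" "\<forall>i. st (c i) \<or> K (c i)"
    and P: "\<And>e. P (e 0) (e 1) \<longleftrightarrow> sat (\<epsilon>) st p (interleave e c)"
    using assms unfolding definable_def by blast
  let ?f = "\<lambda>i. if even i then i div 2 else Suc (Suc (i div 2))"
  have "interleave (x ## y ## c) c = (\<lambda>i. (x ## y ## c) (?f i))" for x y
    by (rule ext) (auto simp: interleave_def)
  then have "P x y \<longleftrightarrow> sat (\<epsilon>) st (rename_fm ?f p) (x ## y ## c)" for x y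
    using P[of "x ## y ## c"] by (simp add: sat_rename_fm)
  then show thesis
    using p that[of "rename_fm ?f p" c] by simp
qed

section \<open>Transfer and its consequences\<close>

lemma transfer:
  assumes "standard_definable (\<lambda>e. P (e 0))" "\<And>x. st x \<Longrightarrow> P x"
  shows "P x"
proof -
  obtain p c where p: "st_free p" "\<forall>i. st (c i)" and P: "\<And>x. P x \<longleftrightarrow> sat (\<epsilon>) st p (x ## c)"
    using definable_formula1[OF assms(1)] by auto
  show ?thesis using Transfer[of p c] p assms(2) by (simp add: P)
qed

text \<open>Transfer in \<open>x\<close> is applied with \<open>y\<close> bound. The instance at a
  standard \<open>x\<close> is Transfer in \<open>y\<close>, for which \<open>x\<close> is an
  admissible parameter.\<close>

lemma transfer2:
  assumes P: "standard_definable (\<lambda>e. P (e 0) (e 1))" "\<And>x y. st x \<Longrightarrow> st y \<Longrightarrow> P x y"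
  shows "P x y"
proof -
  have "\<forall>y. P x y" for x
  proof (rule transfer[where P = "\<lambda>x. \<forall>y. P x y"])
    show "standard_definable (\<lambda>e. \<forall>y. P (e 0) y)"
      by (intro definable_intros definable_subst2[OF P(1)])
    show "\<forall>y. P x y" if "st x" for x
    proof
      show "P x y" for y
        by (rule transfer[where P = "P x"])
          (intro definable_intros definable_subst2[OF P(1)], use that P(2) in auto)
    qed
  qed
  then show ?thesis by blast
qed

lemma transfer3:
  assumes P: "standard_definable (\<lambda>e. P (e 0) (e 1) (e 2))"
    "\<And>x y z. st x \<Longrightarrow> st y \<Longrightarrow> st z \<Longrightarrow> P x y z"
  shows "P x y z"
proof -
  have "\<forall>z. P x y z" for x y
  proof (rule transfer2[where P = "\<lambda>x y. \<forall>z. P x y z"])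
    show "standard_definable (\<lambda>e. \<forall>z. P (e 0) (e 1) z)"
      by (intro definable_intros definable_subst3[OF P(1)])
    show "\<forall>z. P x y z" if "st x" "st y" for x y
    proof
      show "P x y z" for z
        by (rule transfer[where P = "P x y"])
          (intro definable_intros definable_subst3[OF P(1)], use that P(2) in auto)
    qed
  qed
  then show ?thesis by blast
qed

lemma transfer_ex:
  assumes "standard_definable (\<lambda>e. P (e 0))" "P x"
  shows "\<exists>x. st x \<and> P x"
  using transfer[of "\<lambda>x. \<not> P x"] definable_not[OF assms(1)] assms(2) by blast

text \<open>Transfer produces a standard solution, and uniqueness identifies it with the given one.
  This is the usual way to see that a constructed set is standard.\<close>

lemma standard_unique:
  assumes "standard_definable (\<lambda>e. P (e 0))" "P x" "\<And>y. P y \<Longrightarrow> y = x"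
  shows "st x"
  using transfer_ex[OF assms(1,2)] assms(3) by blast

lemma transfer_subset:
  assumes "st A" "st B" "\<And>x. st x \<Longrightarrow> x \<epsilon> A \<Longrightarrow> x \<epsilon> B"
  shows "x \<epsilon> A \<Longrightarrow> x \<epsilon> B"
proof -
  have "x \<epsilon> A \<longrightarrow> x \<epsilon> B"
    by (rule transfer[where P = "\<lambda>x. x \<epsilon> A \<longrightarrow> x \<epsilon> B"])
      (intro definable_intros, use assms in auto)
  then show "x \<epsilon> A \<Longrightarrow> x \<epsilon> B" by blast
qed

lemma standard_eqI:
  assumes "st A" "st B" "\<And>x. st x \<Longrightarrow> x \<epsilon> A \<longleftrightarrow> x \<epsilon> B"
  shows "A = B"
  using transfer_subset[OF assms(1,2)] transfer_subset[OF assms(2,1)] assms(3)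
  by (blast intro: Extensionality)

section \<open>Separation and Standardization\<close>

lemma separation:
  assumes "internal (\<lambda>e. P (e 0))"
  shows "\<exists>s. \<forall>x. x \<epsilon> s \<longleftrightarrow> x \<epsilon> a \<and> P x"
proof -
  obtain p c where "st_free p" and P: "\<And>x. P x \<longleftrightarrow> sat (\<epsilon>) st p (x ## c)"
    using definable_formula1[OF assms] by auto
  then show ?thesis using Separation[of p a c] by simp
qed

lemma set_of_eqI: "\<forall>x. x \<epsilon> s \<longleftrightarrow> P x \<Longrightarrow> set_of (\<epsilon>) P = s"
  unfolding set_of_def by (blast intro: Extensionality)

lemma mem_set_of: "\<exists>s. \<forall>x. x \<epsilon> s \<longleftrightarrow> P x \<Longrightarrow> x \<epsilon> set_of (\<epsilon>) P \<longleftrightarrow> P x"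
  using set_of_eqI by metis

text \<open>\<open>set_of\<close> is a description and says nothing about proper classes. A bounding
  set turns the class into an instance of Separation, which is how most constructions are shown to
  have the intended elements.\<close>

lemma mem_set_of_bounded:
  assumes "internal (\<lambda>e. P (e 0))" "\<And>x. P x \<Longrightarrow> x \<epsilon> a"
  shows "x \<epsilon> set_of (\<epsilon>) P \<longleftrightarrow> P x"
  using separation[OF assms(1), of a] assms(2) by (intro mem_set_of) blast

lemma st_set_unique:
  assumes "st S" "\<And>x. st x \<Longrightarrow> x \<epsilon> S \<longleftrightarrow> x \<epsilon> A \<and> P x"
  shows "st_set (\<epsilon>) st A P = S"
  unfolding st_set_def using assms by (intro the_equality) (auto intro: standard_eqI)

text \<open>Two predicates occur because the \<open>P\<close> of a definition usually contains
  \<open>app\<close> or a description and is not given as a formula. Agreement with an external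
  \<open>Q\<close> on the standard elements of \<open>A\<close> is all that Standardization
  sees.\<close>

lemma standardization:
  assumes "external (\<lambda>e. Q (e 0))" "\<And>x. st x \<Longrightarrow> x \<epsilon> A \<Longrightarrow> P x \<longleftrightarrow> Q x"
  shows "st (st_set (\<epsilon>) st A P)" "\<And>x. st x \<Longrightarrow> x \<epsilon> st_set (\<epsilon>) st A P \<longleftrightarrow> x \<epsilon> A \<and> P x"
proof -
  obtain p c where "\<And>x. Q x \<longleftrightarrow> sat (\<epsilon>) st p (x ## c)"
    using definable_formula1[OF assms(1)] by auto
  then obtain S where S: "st S" "\<forall>x. st x \<longrightarrow> (x \<epsilon> S \<longleftrightarrow> x \<epsilon> A \<and> Q x)"
    using Standardization[of A p c] by auto
  then have "st_set (\<epsilon>) st A P = S" using assms(2) by (intro st_set_unique) auto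
  with S assms(2) show "st (st_set (\<epsilon>) st A P)"
    "\<And>x. st x \<Longrightarrow> x \<epsilon> st_set (\<epsilon>) st A P \<longleftrightarrow> x \<epsilon> A \<and> P x"
    by auto
qed

section \<open>Sets and functions of the structure\<close>

lemma definable_subset_of:
  assumes "definable_term K b s" "definable_term K b t"
  shows "definable K b (\<lambda>e. subset_of (\<epsilon>) (s e) (t e))"
proof (rule definable_subst2[OF _ assms])
  show "definable K b (\<lambda>e. subset_of (\<epsilon>) (e 0) (e 1))"
    unfolding subset_of_def by (intro definable_intros)
qed

lemma subset_ofI: "(\<And>x. x \<epsilon> a \<Longrightarrow> x \<epsilon> b) \<Longrightarrow> subset_of (\<epsilon>) a b"
  by (simp add: subset_of_def)

lemma subset_ofD: "subset_of (\<epsilon>) a b \<Longrightarrow> x \<epsilon> a \<Longrightarrow> x \<epsilon> b"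
  by (simp add: subset_of_def)

lemma not_mem_empty [simp]: "\<not> x \<epsilon> empty_set (\<epsilon>)"
proof -
  have "\<exists>s. \<forall>x. x \<epsilon> s \<longleftrightarrow> x \<epsilon> undefined \<and> False"
    by (rule separation) (rule definable_const)
  then show ?thesis unfolding empty_set_def by (subst mem_set_of) auto
qed

lemma eq_empty_iff: "z = empty_set (\<epsilon>) \<longleftrightarrow> (\<forall>x. \<not> x \<epsilon> z)"
  using Extensionality not_mem_empty by blast

lemma st_empty: "st (empty_set (\<epsilon>))"
  by (rule standard_unique[where P = "\<lambda>z. \<forall>x. \<not> x \<epsilon> z"])
    (intro definable_intros, auto simp: eq_empty_iff)

lemma mem_unord_pair [simp]: "x \<epsilon> unord_pair (\<epsilon>) a b \<longleftrightarrow> x = a \<or> x = b"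
proof -
  obtain c where "a \<epsilon> c" "b \<epsilon> c" using Pairing by blast
  then show ?thesis
    unfolding unord_pair_def
    by (intro mem_set_of_bounded[where a = c]) (intro definable_intros, auto)
qed

lemma eq_unord_pair_iff: "z = unord_pair (\<epsilon>) a b \<longleftrightarrow> (\<forall>x. x \<epsilon> z \<longleftrightarrow> x = a \<or> x = b)"
  using Extensionality[of z "unord_pair (\<epsilon>) a b"] by auto

lemma definable_unord_pair:
  assumes "definable_term K b s" "definable_term K b t"
  shows "definable_term K b (\<lambda>e. unord_pair (\<epsilon>) (s e) (t e))"
  by (rule definable_term2[OF eq_unord_pair_iff _ assms]) (intro definable_intros)

lemma definable_ord_pair:
  assumes "definable_term K b s" "definable_term K b t"
  shows "definable_term K b (\<lambda>e. ord_pair (\<epsilon>) (s e) (t e))"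
  unfolding ord_pair_def by (intro definable_unord_pair assms)

abbreviation pr :: "'u \<Rightarrow> 'u \<Rightarrow> 'u" where "pr \<equiv> ord_pair (\<epsilon>)"

lemma ord_pair_inject [simp]: "pr a b = pr c d \<longleftrightarrow> a = c \<and> b = d"
proof
  assume eq: "pr a b = pr c d"
  have mem: "x \<epsilon> pr u v \<longleftrightarrow> x = unord_pair (\<epsilon>) u u \<or> x = unord_pair (\<epsilon>) u v" for x u v
    by (simp add: ord_pair_def)
  have up: "unord_pair (\<epsilon>) u v = unord_pair (\<epsilon>) x y \<longleftrightarrow> u = x \<and> v = y \<or> u = y \<and> v = x" for u v x y
    by (auto simp: eq_unord_pair_iff)
  show "a = c \<and> b = d"
    using mem[of _ a b] mem[of _ c d] unfolding eq by (metis up)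
qed simp

lemma mem_pow_ex: "\<exists>u. \<forall>x. x \<epsilon> u \<longleftrightarrow> subset_of (\<epsilon>) x a"
proof -
  obtain u where u: "\<forall>x. subset_of (\<epsilon>) x a \<longrightarrow> x \<epsilon> u" using Power_Set by blast
  have "\<exists>s. \<forall>x. x \<epsilon> s \<longleftrightarrow> x \<epsilon> u \<and> subset_of (\<epsilon>) x a"
    by (rule separation) (intro definable_intros definable_subset_of, auto)
  with u show ?thesis by blast
qed

lemma mem_Un_ex: "\<exists>u. \<forall>x. x \<epsilon> a \<or> x \<epsilon> b \<longrightarrow> x \<epsilon> u"
  using Union[of "unord_pair (\<epsilon>) a b"] by (metis mem_unord_pair)

lemma mem_cprod: "p \<epsilon> cprod (\<epsilon>) A B \<longleftrightarrow> (\<exists>a b. a \<epsilon> A \<and> b \<epsilon> B \<and> p = pr a b)"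
proof -
  obtain u where u: "\<forall>x. x \<epsilon> A \<or> x \<epsilon> B \<longrightarrow> x \<epsilon> u" using mem_Un_ex by blast
  \<comment> \<open>A pair of elements of \<open>u\<close> is a set of subsets of \<open>u\<close>,
    so two power sets bound the product.\<close>
  obtain v where v: "\<forall>x. x \<epsilon> v \<longleftrightarrow> subset_of (\<epsilon>) x u" using mem_pow_ex by blast
  obtain z where z: "\<forall>x. x \<epsilon> z \<longleftrightarrow> subset_of (\<epsilon>) x v" using mem_pow_ex by blast
  have "pr a b \<epsilon> z" if "a \<epsilon> A" "b \<epsilon> B" for a b
    using that u by (auto simp: z v subset_of_def ord_pair_def)
  then show ?thesis
    unfolding cprod_def
    by (intro mem_set_of_bounded[where a = z]) (intro definable_intros definable_ord_pair, auto)
qed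

lemma pair_mem_cprod [simp]: "pr a b \<epsilon> cprod (\<epsilon>) A B \<longleftrightarrow> a \<epsilon> A \<and> b \<epsilon> B"
  by (auto simp: mem_cprod)

lemma cprodE:
  assumes "p \<epsilon> cprod (\<epsilon>) A B"
  obtains a b where "a \<epsilon> A" "b \<epsilon> B" "p = pr a b"
  using assms by (auto simp: mem_cprod)

lemma eq_cprod_iff:
  "z = cprod (\<epsilon>) A B \<longleftrightarrow> (\<forall>p. p \<epsilon> z \<longleftrightarrow> (\<exists>a b. a \<epsilon> A \<and> b \<epsilon> B \<and> p = pr a b))"
  using Extensionality[of z "cprod (\<epsilon>) A B"] by (auto simp: mem_cprod)

lemma definable_cprod:
  assumes "definable_term K b s" "definable_term K b t"
  shows "definable_term K b (\<lambda>e. cprod (\<epsilon>) (s e) (t e))"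
  by (rule definable_term2[OF eq_cprod_iff _ assms]) (intro definable_intros definable_ord_pair)

lemma mem_inter_set [simp]: "x \<epsilon> inter_set (\<epsilon>) a b \<longleftrightarrow> x \<epsilon> a \<and> x \<epsilon> b"
  unfolding inter_set_def
  by (rule mem_set_of_bounded[where a = a]) (intro definable_intros, auto)

lemma eq_inter_set_iff: "z = inter_set (\<epsilon>) a b \<longleftrightarrow> (\<forall>x. x \<epsilon> z \<longleftrightarrow> x \<epsilon> a \<and> x \<epsilon> b)"
  using Extensionality[of z "inter_set (\<epsilon>) a b"] by auto

lemma definable_inter_set:
  assumes "definable_term K b s" "definable_term K b t"
  shows "definable_term K b (\<lambda>e. inter_set (\<epsilon>) (s e) (t e))"
  by (rule definable_term2[OF eq_inter_set_iff _ assms]) (intro definable_intros)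

lemma definable_is_fun:
  assumes "definable_term K b s" "definable_term K b t" "definable_term K b u"
  shows "definable K b (\<lambda>e. is_fun (\<epsilon>) (s e) (t e) (u e))"
proof (rule definable_subst3[OF _ assms])
  show "definable K b (\<lambda>e. is_fun (\<epsilon>) (e 0) (e 1) (e 2))"
    unfolding is_fun_def
    by (intro definable_intros definable_subset_of definable_cprod definable_ord_pair)
qed

text \<open>
  The value of \<open>app f x\<close> is an arbitrary HOL value unless \<open>f\<close> has exactly one value at \<open>x\<close>, so \<open>app\<close>
  itself is not definable; \<open>ap\<close> is its definable modification.
\<close>

definition ap :: "'u \<Rightarrow> 'u \<Rightarrow> 'u" where
  "ap f x = (if \<exists>!y. pr x y \<epsilon> f then app (\<epsilon>) f x else empty_set (\<epsilon>))"

abbreviation ap2 :: "'u \<Rightarrow> 'u \<Rightarrow> 'u \<Rightarrow> 'u" where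
  "ap2 f x y \<equiv> ap f (pr x y)"

lemma eq_ap_iff:
  "z = ap f x \<longleftrightarrow> (if \<exists>!y. pr x y \<epsilon> f then pr x z \<epsilon> f else \<forall>y. \<not> y \<epsilon> z)"
proof (cases "\<exists>!y. pr x y \<epsilon> f")
  case True
  from theI'[OF this] have "pr x (app (\<epsilon>) f x) \<epsilon> f" by (simp add: app_def)
  with True show ?thesis unfolding ap_def by auto
qed (auto simp: ap_def eq_empty_iff)

lemma definable_ap:
  assumes "definable_term K b s" "definable_term K b t"
  shows "definable_term K b (\<lambda>e. ap (s e) (t e))"
  by (rule definable_term2[OF eq_ap_iff _ assms]) (intro definable_intros definable_ord_pair)

lemma is_fun_ex1: "is_fun (\<epsilon>) f A B \<Longrightarrow> x \<epsilon> A \<Longrightarrow> \<exists>!y. pr x y \<epsilon> f"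
  unfolding is_fun_def by blast

lemma app_eq_ap: "is_fun (\<epsilon>) f A B \<Longrightarrow> x \<epsilon> A \<Longrightarrow> app (\<epsilon>) f x = ap f x"
  using is_fun_ex1 by (simp add: ap_def)

lemma app2_eq_ap:
  "is_fun (\<epsilon>) f (cprod (\<epsilon>) A A') B \<Longrightarrow> x \<epsilon> A \<Longrightarrow> y \<epsilon> A' \<Longrightarrow> app2 (\<epsilon>) f x y = ap2 f x y"
  by (simp add: app2_def app_eq_ap)

lemma pair_mem_fun_iff: "is_fun (\<epsilon>) f A B \<Longrightarrow> x \<epsilon> A \<Longrightarrow> pr x y \<epsilon> f \<longleftrightarrow> y = ap f x"
  using is_fun_ex1 by (simp add: eq_ap_iff)

lemma ap_mem: "is_fun (\<epsilon>) f A B \<Longrightarrow> x \<epsilon> A \<Longrightarrow> ap f x \<epsilon> B"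
  using pair_mem_fun_iff[of f A B x "ap f x"] pair_mem_cprod[of x "ap f x" A B]
  unfolding is_fun_def subset_of_def by blast

lemma fun_subset_cprod: "is_fun (\<epsilon>) f A B \<Longrightarrow> p \<epsilon> f \<Longrightarrow> p \<epsilon> cprod (\<epsilon>) A B"
  unfolding is_fun_def subset_of_def by blast

lemma fun_eqI:
  assumes "is_fun (\<epsilon>) f A B" "is_fun (\<epsilon>) g A C" "\<And>x. x \<epsilon> A \<Longrightarrow> ap f x = ap g x"
  shows "f = g"
proof (rule Extensionality, rule allI)
  fix p
  have "pr x y \<epsilon> f \<longleftrightarrow> pr x y \<epsilon> g" if "x \<epsilon> A" for x y
    using that by (simp add: pair_mem_fun_iff[OF assms(1)] pair_mem_fun_iff[OF assms(2)] assms(3))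
  then show "p \<epsilon> f \<longleftrightarrow> p \<epsilon> g"
    using fun_subset_cprod[OF assms(1), of p] fun_subset_cprod[OF assms(2), of p]
    by (auto simp: mem_cprod)
qed

lemma mem_funs: "f \<epsilon> funs (\<epsilon>) A B \<longleftrightarrow> is_fun (\<epsilon>) f A B"
proof -
  obtain u where u: "\<forall>x. x \<epsilon> u \<longleftrightarrow> subset_of (\<epsilon>) x (cprod (\<epsilon>) A B)" using mem_pow_ex by blast
  show ?thesis
    unfolding funs_def
    by (rule mem_set_of_bounded[where a = u])
      (intro definable_intros definable_is_fun, auto simp: u is_fun_def)
qed

lemma eq_funs_iff: "z = funs (\<epsilon>) A B \<longleftrightarrow> (\<forall>f. f \<epsilon> z \<longleftrightarrow> is_fun (\<epsilon>) f A B)"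
  using Extensionality[of z "funs (\<epsilon>) A B"] by (auto simp: mem_funs)

lemma definable_funs:
  assumes "definable_term K b s" "definable_term K b t"
  shows "definable_term K b (\<lambda>e. funs (\<epsilon>) (s e) (t e))"
  by (rule definable_term2[OF eq_funs_iff _ assms]) (intro definable_intros definable_is_fun)

lemmas definable_set_intros =
  definable_intros definable_subset_of definable_ord_pair definable_unord_pair definable_cprod
  definable_inter_set definable_is_fun definable_ap definable_funs

section \<open>Standardness of the basic operations\<close>

lemma definable_term_standard:
  assumes "standard_definable (\<lambda>e. e 0 = t)"
  shows "st t"
  by (rule standard_unique[where P = "\<lambda>x. x = t"]) (use assms in auto)

lemma st_ord_pair: "st a \<Longrightarrow> st b \<Longrightarrow> st (pr a b)"
  by (rule definable_term_standard) (intro definable_set_intros, auto)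

lemma st_unord_pair: "st a \<Longrightarrow> st b \<Longrightarrow> st (unord_pair (\<epsilon>) a b)"
  by (rule definable_term_standard) (intro definable_set_intros, auto)

lemma st_cprod: "st a \<Longrightarrow> st b \<Longrightarrow> st (cprod (\<epsilon>) a b)"
  by (rule definable_term_standard) (intro definable_set_intros, auto)

lemma st_funs: "st a \<Longrightarrow> st b \<Longrightarrow> st (funs (\<epsilon>) a b)"
  by (rule definable_term_standard) (intro definable_set_intros, auto)

lemma st_ap: "st f \<Longrightarrow> st x \<Longrightarrow> st (ap f x)"
  by (rule definable_term_standard) (intro definable_set_intros, auto)

lemma st_ord_pairD:
  assumes "st (pr a b)"
  shows "st a" "st b"
proof -
  show "st a"
    by (rule standard_unique[where P = "\<lambda>x. \<exists>y. pr a b = pr x y"])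
      (intro definable_set_intros, use assms in auto)
  show "st b"
    by (rule standard_unique[where P = "\<lambda>y. \<exists>x. pr a b = pr x y"])
      (intro definable_set_intros, use assms in auto)
qed

section \<open>Functions from Choice and from Standardization\<close>

lemma definable_mono:
  assumes "definable K b P" "\<And>x. K x \<Longrightarrow> K' x"
  shows "definable K' b P"
  using assms unfolding definable_def by blast

lemma standard_definable_internal: "standard_definable P \<Longrightarrow> internal P"
  by (erule definable_mono) simp

text \<open>Choice is available for families of disjoint sets. \<open>S\<close> collects the slices
  {(x, y) | y in B, Q x y}, one for each x in A; distinct slices are disjoint because a pair
  remembers x. A choice set meets each slice in exactly one pair, and these pairs form
  \<open>f\<close>.\<close>

lemma fun_choice:
  assumes Q: "internal (\<lambda>e. Q (e 0) (e 1))" and ex: "\<And>x. x \<epsilon> A \<Longrightarrow> \<exists>y. y \<epsilon> B \<and> Q x y"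
  shows "\<exists>f. is_fun (\<epsilon>) f A B \<and> (\<forall>x. x \<epsilon> A \<longrightarrow> Q x (ap f x))"
proof -
  note intros = definable_set_intros definable_subst2[OF Q]
  obtain u where u: "\<forall>x. x \<epsilon> u \<longleftrightarrow> subset_of (\<epsilon>) x (cprod (\<epsilon>) A B)" using mem_pow_ex by blast
  have "\<exists>S. \<forall>z. z \<epsilon> S \<longleftrightarrow> z \<epsilon> u \<and>
      (\<exists>x. x \<epsilon> A \<and> (\<forall>p. p \<epsilon> z \<longleftrightarrow> (\<exists>y. y \<epsilon> B \<and> p = pr x y \<and> Q x y)))"
    by (rule separation) (intro intros, auto)
  then obtain S where S: "\<And>z. z \<epsilon> S \<longleftrightarrow> z \<epsilon> u \<and>
      (\<exists>x. x \<epsilon> A \<and> (\<forall>p. p \<epsilon> z \<longleftrightarrow> (\<exists>y. y \<epsilon> B \<and> p = pr x y \<and> Q x y)))" by blast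
  have slice: "\<exists>z. z \<epsilon> S \<and> (\<forall>p. p \<epsilon> z \<longleftrightarrow> (\<exists>y. y \<epsilon> B \<and> p = pr x y \<and> Q x y))" if "x \<epsilon> A" for x
  proof -
    have "\<exists>z. \<forall>p. p \<epsilon> z \<longleftrightarrow> p \<epsilon> cprod (\<epsilon>) A B \<and> (\<exists>y. y \<epsilon> B \<and> p = pr x y \<and> Q x y)"
      by (rule separation) (intro intros, auto)
    then obtain z where "\<forall>p. p \<epsilon> z \<longleftrightarrow> p \<epsilon> cprod (\<epsilon>) A B \<and> (\<exists>y. y \<epsilon> B \<and> p = pr x y \<and> Q x y)" ..
    then have z: "\<forall>p. p \<epsilon> z \<longleftrightarrow> (\<exists>y. y \<epsilon> B \<and> p = pr x y \<and> Q x y)" using that by auto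
    have "z \<epsilon> u" using z u that by (auto simp: subset_of_def)
    with z that S show ?thesis by blast
  qed
  have "\<exists>c. \<forall>z. z \<epsilon> S \<longrightarrow> (\<exists>!p. p \<epsilon> z \<and> p \<epsilon> c)"
  proof (rule Choice)
    show "\<forall>z. z \<epsilon> S \<longrightarrow> (\<exists>p. p \<epsilon> z)"
      using ex unfolding S by metis
    show "\<forall>y z. y \<epsilon> S \<and> z \<epsilon> S \<and> y \<noteq> z \<longrightarrow> \<not> (\<exists>p. p \<epsilon> y \<and> p \<epsilon> z)"
    proof (intro allI impI notI)
      fix y z assume "y \<epsilon> S \<and> z \<epsilon> S \<and> y \<noteq> z" "\<exists>p. p \<epsilon> y \<and> p \<epsilon> z"
      moreover from this have "\<forall>p. p \<epsilon> y \<longleftrightarrow> p \<epsilon> z" unfolding S by (metis ord_pair_inject)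
      ultimately show False using Extensionality by blast
    qed
  qed
  then obtain c where c: "\<And>z. z \<epsilon> S \<Longrightarrow> \<exists>!p. p \<epsilon> z \<and> p \<epsilon> c" by blast
  have "\<exists>f. \<forall>p. p \<epsilon> f \<longleftrightarrow> p \<epsilon> cprod (\<epsilon>) A B \<and> p \<epsilon> c \<and> (\<exists>x y. p = pr x y \<and> Q x y)"
    by (rule separation) (intro intros, auto)
  then obtain f where f: "\<And>p. p \<epsilon> f \<longleftrightarrow> p \<epsilon> cprod (\<epsilon>) A B \<and> p \<epsilon> c \<and> (\<exists>x y. p = pr x y \<and> Q x y)"
    by blast
  have ex1: "\<exists>!y. pr x y \<epsilon> f" if x: "x \<epsilon> A" for x
  proof -
    obtain z where z: "z \<epsilon> S" "\<forall>p. p \<epsilon> z \<longleftrightarrow> (\<exists>y. y \<epsilon> B \<and> p = pr x y \<and> Q x y)"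
      using slice[OF x] by blast
    have "pr x y \<epsilon> f \<longleftrightarrow> pr x y \<epsilon> z \<and> pr x y \<epsilon> c" for y
      using z(2) x by (auto simp: f)
    with c[OF z(1)] z(2) show ?thesis by (metis ord_pair_inject)
  qed
  then have "is_fun (\<epsilon>) f A B" unfolding is_fun_def by (auto simp: f subset_of_def)
  moreover from this have "Q x (ap f x)" if "x \<epsilon> A" for x
    using pair_mem_fun_iff[of f A B x "ap f x"] that by (auto simp: f)
  ultimately show ?thesis by blast
qed

text \<open>Transfer is used twice: it extends solvability from standard to all arguments, and it
  replaces a chosen function by a standard one. As \<open>Q\<close> has only standard parameters,
  the chosen property holds at nonstandard arguments too.\<close>

lemma standard_fun_choice:
  assumes Q: "standard_definable (\<lambda>e. Q (e 0) (e 1))" and st: "st A" "st B"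
    and ex: "\<And>x. st x \<Longrightarrow> x \<epsilon> A \<Longrightarrow> \<exists>y. y \<epsilon> B \<and> Q x y"
  shows "\<exists>f. st f \<and> is_fun (\<epsilon>) f A B \<and> (\<forall>x. x \<epsilon> A \<longrightarrow> Q x (ap f x))"
proof -
  note intros = definable_set_intros definable_subst2[OF Q]
  have "x \<epsilon> A \<longrightarrow> (\<exists>y. y \<epsilon> B \<and> Q x y)" for x
    by (rule transfer[where P = "\<lambda>x. x \<epsilon> A \<longrightarrow> (\<exists>y. y \<epsilon> B \<and> Q x y)"]) (intro intros, use st ex in auto)
  then obtain f where f: "is_fun (\<epsilon>) f A B \<and> (\<forall>x. x \<epsilon> A \<longrightarrow> Q x (ap f x))"
    using fun_choice[OF standard_definable_internal[OF Q], of A B] by blast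
  show ?thesis
    by (rule transfer_ex[where P = "\<lambda>f. is_fun (\<epsilon>) f A B \<and> (\<forall>x. x \<epsilon> A \<longrightarrow> Q x (ap f x))", OF _ f])
      (intro intros, use st in auto)
qed

text \<open>The counterpart for external relations. Standardization fixes the graph on standard
  pairs, and Transfer of "exactly one value" makes it a function everywhere. \<open>P\<close> itself
  cannot be transferred, so it is obtained at standard arguments only; and since no choice is made,
  the standard value has to be unique.\<close>

lemma standardization_fun:
  assumes Q: "external (\<lambda>e. Q (e 0) (e 1))" and st: "st A" "st B"
    and PQ: "\<And>x y. st x \<Longrightarrow> st y \<Longrightarrow> x \<epsilon> A \<Longrightarrow> y \<epsilon> B \<Longrightarrow> P x y \<longleftrightarrow> Q x y"
    and ex: "\<And>x. st x \<Longrightarrow> x \<epsilon> A \<Longrightarrow> \<exists>!y. st y \<and> y \<epsilon> B \<and> P x y"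
  shows "\<exists>f. st f \<and> is_fun (\<epsilon>) f A B \<and> (\<forall>x. st x \<and> x \<epsilon> A \<longrightarrow> P x (ap f x))"
proof -
  define R where "R p \<longleftrightarrow> (\<exists>x y. p = pr x y \<and> Q x y)" for p
  have R: "external (\<lambda>e. R (e 0))"
    unfolding R_def by (intro definable_set_intros definable_subst2[OF Q])
  define f where "f = st_set (\<epsilon>) st (cprod (\<epsilon>) A B) R"
  have f: "st f" "\<And>p. st p \<Longrightarrow> p \<epsilon> f \<longleftrightarrow> p \<epsilon> cprod (\<epsilon>) A B \<and> R p"
    using standardization[of R "cprod (\<epsilon>) A B" R, OF R] by (simp_all add: f_def)
  have sub: "p \<epsilon> f \<Longrightarrow> p \<epsilon> cprod (\<epsilon>) A B" for p
    by (rule transfer_subset[of f]) (use f st in \<open>auto simp: st_cprod\<close>)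
  have mem: "pr x y \<epsilon> f \<longleftrightarrow> x \<epsilon> A \<and> y \<epsilon> B \<and> P x y" if "st x" "st y" for x y
    using that by (auto simp: f st_ord_pair R_def PQ)
  have "x \<epsilon> A \<longrightarrow> (\<exists>!y. pr x y \<epsilon> f)" for x
  proof (rule transfer[where P = "\<lambda>x. x \<epsilon> A \<longrightarrow> (\<exists>!y. pr x y \<epsilon> f)"])
    show "standard_definable (\<lambda>e. e 0 \<epsilon> A \<longrightarrow> (\<exists>!y. pr (e 0) y \<epsilon> f))"
      by (intro definable_set_intros) (use f st in auto)
    fix x assume x: "st x"
    show "x \<epsilon> A \<longrightarrow> (\<exists>!y. pr x y \<epsilon> f)"
    proof
      assume "x \<epsilon> A"
      from ex[OF x this] obtain y where y: "st y" "y \<epsilon> B" "P x y"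
        and uniq: "\<And>z. st z \<Longrightarrow> z \<epsilon> B \<Longrightarrow> P x z \<Longrightarrow> z = y" by blast
      \<comment> \<open>Uniqueness excludes the other standard candidates; Transfer, with
        \<open>x\<close>, \<open>y\<close> and \<open>f\<close> standard, then excludes the
        nonstandard ones.\<close>
      have *: "pr x z \<epsilon> f \<longrightarrow> z = y" if "st z" for z
        using mem[OF x that] uniq[OF that] by blast
      have "pr x z \<epsilon> f \<longrightarrow> z = y" for z
        by (rule transfer[where P = "\<lambda>z. pr x z \<epsilon> f \<longrightarrow> z = y", OF _ *])
          (intro definable_set_intros, simp_all add: x y f(1))
      then show "\<exists>!y. pr x y \<epsilon> f" using y x mem \<open>x \<epsilon> A\<close> by blast
    qed
  qed
  then have fn: "is_fun (\<epsilon>) f A B" using sub unfolding is_fun_def subset_of_def by blast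
  have "P x (ap f x)" if "st x" "x \<epsilon> A" for x
    using pair_mem_fun_iff[OF fn, of x "ap f x"] mem[of x "ap f x"] that st_ap[OF f(1)] by blast
  with f(1) fn show ?thesis by blast
qed

lemma standard_fun_eqI:
  assumes "st f" "st g" "st A" "is_fun (\<epsilon>) f A B" "is_fun (\<epsilon>) g A C"
    "\<And>x. st x \<Longrightarrow> x \<epsilon> A \<Longrightarrow> ap f x = ap g x"
  shows "f = g"
proof (rule fun_eqI[OF assms(4,5)])
  have "x \<epsilon> A \<longrightarrow> ap f x = ap g x" for x
    by (rule transfer[where P = "\<lambda>x. x \<epsilon> A \<longrightarrow> ap f x = ap g x"])
      (intro definable_set_intros, use assms in auto)
  then show "\<And>x. x \<epsilon> A \<Longrightarrow> ap f x = ap g x" by blast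
qed

section \<open>Natural numbers and finite sets of the structure\<close>

definition suc :: "'u \<Rightarrow> 'u" where
  "suc n = set_of (\<epsilon>) (\<lambda>x. x \<epsilon> n \<or> x = n)"

lemma mem_suc [simp]: "x \<epsilon> suc n \<longleftrightarrow> x \<epsilon> n \<or> x = n"
proof -
  obtain u where "\<forall>x. x \<epsilon> n \<or> x \<epsilon> unord_pair (\<epsilon>) n n \<longrightarrow> x \<epsilon> u" using mem_Un_ex by blast
  then show ?thesis
    unfolding suc_def
    by (intro mem_set_of_bounded[where a = u]) (intro definable_intros, auto)
qed

lemma eq_suc_iff: "z = suc n \<longleftrightarrow> (\<forall>x. x \<epsilon> z \<longleftrightarrow> x \<epsilon> n \<or> x = n)"
  using Extensionality[of z "suc n"] by auto

lemma definable_suc: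
  assumes "definable_term K b s"
  shows "definable_term K b (\<lambda>e. suc (s e))"
  by (rule definable_term1[OF eq_suc_iff _ assms]) (intro definable_intros)

lemma is_inductive_iff:
  "is_inductive (\<epsilon>) J \<longleftrightarrow> empty_set (\<epsilon>) \<epsilon> J \<and> (\<forall>n. n \<epsilon> J \<longrightarrow> suc n \<epsilon> J)"
  unfolding is_inductive_def eq_empty_iff[symmetric] eq_suc_iff[symmetric] by auto

lemma definable_term_st: "st a \<Longrightarrow> definable_term K b (\<lambda>e. a)"
  by (rule definable_term_const) simp

lemma definable_is_inductive:
  assumes "definable_term K b s"
  shows "definable K b (\<lambda>e. is_inductive (\<epsilon>) (s e))"
  by (rule definable_subst1[OF _ assms], unfold is_inductive_iff)
    (intro definable_set_intros definable_suc definable_term_st[OF st_empty])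

lemma mem_omega_iff: "n \<epsilon> omega (\<epsilon>) \<longleftrightarrow> (\<forall>J. is_inductive (\<epsilon>) J \<longrightarrow> n \<epsilon> J)"
proof -
  obtain J where "is_inductive (\<epsilon>) J" using Infinity by blast
  then show ?thesis
    unfolding omega_def
    by (intro mem_set_of_bounded[where a = J]) (intro definable_intros definable_is_inductive, auto)
qed

lemma empty_mem_omega: "empty_set (\<epsilon>) \<epsilon> omega (\<epsilon>)"
  by (simp add: mem_omega_iff is_inductive_iff)

lemma suc_mem_omega: "n \<epsilon> omega (\<epsilon>) \<Longrightarrow> suc n \<epsilon> omega (\<epsilon>)"
  by (simp add: mem_omega_iff is_inductive_iff)

lemma st_omega: "st (omega (\<epsilon>))"
proof (rule standard_unique[where P = "\<lambda>z. \<forall>n. n \<epsilon> z \<longleftrightarrow> (\<forall>J. is_inductive (\<epsilon>) J \<longrightarrow> n \<epsilon> J)"])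
  show "standard_definable (\<lambda>e. \<forall>n. n \<epsilon> e 0 \<longleftrightarrow> (\<forall>J. is_inductive (\<epsilon>) J \<longrightarrow> n \<epsilon> J))"
    by (intro definable_set_intros definable_is_inductive)
next
  fix y assume "\<forall>n. n \<epsilon> y \<longleftrightarrow> (\<forall>J. is_inductive (\<epsilon>) J \<longrightarrow> n \<epsilon> J)"
  then show "y = omega (\<epsilon>)" by (intro Extensionality) (simp add: mem_omega_iff)
qed (simp add: mem_omega_iff)

text \<open>The inductive set has to come from Separation, so the predicate must be internal.
  Induction for the predicate \<open>st\<close>, say, would make every element of
  \<open>omega\<close> standard.\<close>

lemma omega_induct [consumes 1, case_names definable empty suc]:
  assumes "n \<epsilon> omega (\<epsilon>)" "internal (\<lambda>e. P (e 0))" "P (empty_set (\<epsilon>))"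
    "\<And>n. n \<epsilon> omega (\<epsilon>) \<Longrightarrow> P n \<Longrightarrow> P (suc n)"
  shows "P n"
proof -
  obtain J where J: "\<forall>n. n \<epsilon> J \<longleftrightarrow> n \<epsilon> omega (\<epsilon>) \<and> P n" using separation[OF assms(2)] by blast
  then have "is_inductive (\<epsilon>) J"
    unfolding is_inductive_iff using assms(3,4) empty_mem_omega suc_mem_omega by blast
  with assms(1) J show ?thesis by (auto simp: mem_omega_iff)
qed

lemma not_mem_cycle: "m \<epsilon> n \<Longrightarrow> \<not> n \<epsilon> m"
  using Foundation[of m "unord_pair (\<epsilon>) m n"] by auto

lemma suc_inject [simp]: "suc m = suc n \<longleftrightarrow> m = n"
  using not_mem_cycle by (metis mem_suc)

lemma suc_neq_empty [simp]: "suc n \<noteq> empty_set (\<epsilon>)" "empty_set (\<epsilon>) \<noteq> suc n"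
  using eq_empty_iff[of "suc n"] by auto

lemma omega_transitive:
  assumes "n \<epsilon> omega (\<epsilon>)" "m \<epsilon> n"
  shows "m \<epsilon> omega (\<epsilon>)"
proof -
  have "\<forall>m. m \<epsilon> n \<longrightarrow> m \<epsilon> omega (\<epsilon>)"
    using assms(1)
  proof (induction rule: omega_induct)
    case definable
    show ?case by (intro definable_set_intros) auto
  qed auto
  with assms(2) show ?thesis by blast
qed

lemma definable_is_inj:
  assumes "definable_term K b s" "definable_term K b t" "definable_term K b u"
  shows "definable K b (\<lambda>e. is_inj (\<epsilon>) (s e) (t e) (u e))"
proof (rule definable_subst3[OF _ assms])
  have "is_inj (\<epsilon>) f A B \<longleftrightarrow>
      is_fun (\<epsilon>) f A B \<and> (\<forall>x y. x \<epsilon> A \<and> y \<epsilon> A \<and> ap f x = ap f y \<longrightarrow> x = y)" for f A B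
    unfolding is_inj_def using app_eq_ap by metis
  then show "definable K b (\<lambda>e. is_inj (\<epsilon>) (e 0) (e 1) (e 2))"
    by (simp only:) (intro definable_set_intros)
qed

lemma is_bij_iff:
  "is_bij (\<epsilon>) f A B \<longleftrightarrow> is_inj (\<epsilon>) f A B \<and> (\<forall>y. y \<epsilon> B \<longrightarrow> (\<exists>x. x \<epsilon> A \<and> ap f x = y))"
proof (cases "is_fun (\<epsilon>) f A B")
  case True
  have "(\<exists>x. x \<epsilon> A \<and> app (\<epsilon>) f x = y) \<longleftrightarrow> (\<exists>x. x \<epsilon> A \<and> ap f x = y)" for y
    using app_eq_ap[OF True] by metis
  then show ?thesis unfolding is_bij_def by simp
qed (simp add: is_bij_def is_inj_def)

lemma definable_is_bij:
  assumes "definable_term K b s" "definable_term K b t" "definable_term K b u"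
  shows "definable K b (\<lambda>e. is_bij (\<epsilon>) (s e) (t e) (u e))"
  by (rule definable_subst3[OF _ assms], unfold is_bij_iff)
    (intro definable_set_intros definable_is_inj)

lemma definable_is_card_of:
  assumes "definable_term K b s" "definable_term K b t"
  shows "definable K b (\<lambda>e. is_card_of (\<epsilon>) (s e) (t e))"
  by (rule definable_subst2[OF _ assms],
      unfold is_card_of_def is_ordinal_def is_transitive_def)
    (intro definable_set_intros definable_is_bij)

lemma definable_is_filter:
  assumes "definable_term K b s" "definable_term K b t"
  shows "definable K b (\<lambda>e. is_filter (\<epsilon>) (s e) (t e))"
  by (rule definable_subst2[OF _ assms], unfold is_filter_def)
    (intro definable_set_intros definable_term_st[OF st_empty])

lemma is_bij_is_fun: "is_bij (\<epsilon>) f A B \<Longrightarrow> is_fun (\<epsilon>) f A B"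
  by (simp add: is_bij_def is_inj_def)

lemma is_bij_inj: "is_bij (\<epsilon>) f A B \<Longrightarrow> x \<epsilon> A \<Longrightarrow> y \<epsilon> A \<Longrightarrow> ap f x = ap f y \<Longrightarrow> x = y"
  unfolding is_bij_def is_inj_def using app_eq_ap by metis

lemma is_bij_surj: "is_bij (\<epsilon>) f A B \<Longrightarrow> y \<epsilon> B \<Longrightarrow> \<exists>x. x \<epsilon> A \<and> ap f x = y"
  by (simp add: is_bij_iff)

lemma finite_singleton: "is_finite (\<epsilon>) (unord_pair (\<epsilon>) a a)"
proof -
  let ?z = "empty_set (\<epsilon>)"
  \<comment> \<open>The condition is vacuous: any function into the one-element set
    \<open>suc ?z\<close> will do.\<close>
  have "\<exists>f. is_fun (\<epsilon>) f (unord_pair (\<epsilon>) a a) (suc ?z) \<and>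
      (\<forall>x. x \<epsilon> unord_pair (\<epsilon>) a a \<longrightarrow> ap f x = ap f x)"
    by (rule fun_choice) (intro definable_set_intros, simp)
  then obtain f where f: "is_fun (\<epsilon>) f (unord_pair (\<epsilon>) a a) (suc ?z)" by blast
  then have "app (\<epsilon>) f a = ?z"
    using ap_mem[OF f, of a] app_eq_ap[OF f, of a] by simp
  with f have "is_bij (\<epsilon>) f (unord_pair (\<epsilon>) a a) (suc ?z)"
    by (auto simp: is_bij_def is_inj_def)
  then show ?thesis
    unfolding is_finite_def using suc_mem_omega[OF empty_mem_omega] by blast
qed

text \<open>Finiteness is that of the structure, so \<open>a\<close> may be infinite from outside,
  and the refinement is built by internal induction along a bijection of \<open>a\<close> with a
  number \<open>N\<close>. Each stage adds at most one element of \<open>a\<close>; intersecting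
  with the set for it keeps the earlier conditions because \<open>T\<close> passes to
  subsets.\<close>

lemma finite_common_refinement:
  assumes "is_finite (\<epsilon>) a" and T: "internal (\<lambda>e. T (e 0) (e 1))"
    and C: "\<exists>C. C \<epsilon> F" and inter: "\<And>C C'. C \<epsilon> F \<Longrightarrow> C' \<epsilon> F \<Longrightarrow> inter_set (\<epsilon>) C C' \<epsilon> F"
    and anti: "\<And>x C C'. x \<epsilon> a \<Longrightarrow> T x C \<Longrightarrow> subset_of (\<epsilon>) C' C \<Longrightarrow> T x C'"
    and ex: "\<And>x. x \<epsilon> a \<Longrightarrow> \<exists>C. C \<epsilon> F \<and> T x C"
  shows "\<exists>C. C \<epsilon> F \<and> (\<forall>x. x \<epsilon> a \<longrightarrow> T x C)"
proof -
  obtain N f where N: "N \<epsilon> omega (\<epsilon>)" and f: "is_bij (\<epsilon>) f a N"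
    using assms(1) unfolding is_finite_def by blast
  have "\<exists>C. C \<epsilon> F \<and> (\<forall>x. x \<epsilon> a \<longrightarrow> ap f x \<epsilon> N \<longrightarrow> T x C)"
    using N
  proof (induction rule: omega_induct[where P = "\<lambda>n. \<exists>C. C \<epsilon> F \<and> (\<forall>x. x \<epsilon> a \<longrightarrow> ap f x \<epsilon> n \<longrightarrow> T x C)"])
    case definable
    show ?case by (intro definable_set_intros definable_subst2[OF T]) auto
  next
    case empty
    show ?case using C by auto
  next
    case (suc n)
    then obtain C where C: "C \<epsilon> F" "\<And>x. x \<epsilon> a \<Longrightarrow> ap f x \<epsilon> n \<Longrightarrow> T x C" by blast
    show ?case
    proof (cases "\<exists>x. x \<epsilon> a \<and> ap f x = n")
      case True
      then obtain x0 where x0: "x0 \<epsilon> a" "ap f x0 = n" by blast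
      obtain C' where C': "C' \<epsilon> F" "T x0 C'" using ex[OF x0(1)] by blast
      have "T x (inter_set (\<epsilon>) C C')" if x: "x \<epsilon> a" "ap f x \<epsilon> suc n" for x
      proof (cases "ap f x \<epsilon> n")
        case True
        from anti[OF x(1) C(2)[OF x(1) True]] show ?thesis by (simp add: subset_of_def)
      next
        case False
        with x x0 is_bij_inj[OF f] have "x = x0" by auto
        with anti[OF x0(1) C'(2)] show ?thesis by (simp add: subset_of_def)
      qed
      with inter[OF C(1) C'(1)] show ?thesis by blast
    qed (use C in auto)
  qed
  with ap_mem[OF is_bij_is_fun[OF f]] show ?thesis by blast
qed

text \<open>\<open>G\<close> is the least set of pairs that contains the start and is closed under
  the step. It is single-valued by minimality: a pair carrying a second value could be deleted
  without destroying closedness.\<close>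

lemma recursion:
  assumes "a \<epsilon> A" "is_fun (\<epsilon>) g A A"
  shows "\<exists>q. is_fun (\<epsilon>) q (omega (\<epsilon>)) A \<and> ap q (empty_set (\<epsilon>)) = a \<and>
    (\<forall>n. n \<epsilon> omega (\<epsilon>) \<longrightarrow> ap q (suc n) = ap g (ap q n))"
proof -
  define closed where "closed J \<longleftrightarrow> pr (empty_set (\<epsilon>)) a \<epsilon> J \<and>
    (\<forall>n y. n \<epsilon> omega (\<epsilon>) \<longrightarrow> pr n y \<epsilon> J \<longrightarrow> pr (suc n) (ap g y) \<epsilon> J)" for J
  have "internal (\<lambda>e. closed (e 0))"
    unfolding closed_def by (intro definable_set_intros definable_suc) auto
  note intros = definable_set_intros definable_subst1[OF this]
  have "\<exists>G. \<forall>p. p \<epsilon> G \<longleftrightarrow> p \<epsilon> cprod (\<epsilon>) (omega (\<epsilon>)) A \<and> (\<forall>J. closed J \<longrightarrow> p \<epsilon> J)"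
    by (rule separation) (intro intros)
  then obtain G where G: "\<And>p. p \<epsilon> G \<longleftrightarrow> p \<epsilon> cprod (\<epsilon>) (omega (\<epsilon>)) A \<and> (\<forall>J. closed J \<longrightarrow> p \<epsilon> J)"
    by blast
  have G0: "pr (empty_set (\<epsilon>)) a \<epsilon> G"
    using assms(1) by (auto simp: G closed_def empty_mem_omega)
  have GS: "pr (suc n) (ap g y) \<epsilon> G" if "pr n y \<epsilon> G" for n y
    using that ap_mem[OF assms(2)] by (auto simp: G closed_def suc_mem_omega)
  have minus: "closed J \<Longrightarrow> p \<noteq> p0" if "p0 \<epsilon> G" "\<forall>p. p \<epsilon> J \<longleftrightarrow> p \<epsilon> G \<and> p \<noteq> p0" for J p p0
    using that G by blast
  have del: "\<exists>J. \<forall>p. p \<epsilon> J \<longleftrightarrow> p \<epsilon> G \<and> p \<noteq> p0" for p0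
    by (rule separation) (intro intros, auto)
  have uniq: "\<exists>!y. pr n y \<epsilon> G" if "n \<epsilon> omega (\<epsilon>)" for n
    using that
  proof (induction rule: omega_induct)
    case definable
    show ?case by (intro intros) auto
  next
    case empty
    have "y = a" if y: "pr (empty_set (\<epsilon>)) y \<epsilon> G" for y
    proof (rule ccontr)
      assume "y \<noteq> a"
      obtain J where J: "\<forall>p. p \<epsilon> J \<longleftrightarrow> p \<epsilon> G \<and> p \<noteq> pr (empty_set (\<epsilon>)) y" using del by blast
      then have "closed J" using G0 GS \<open>y \<noteq> a\<close> by (auto simp: closed_def)
      from minus[OF y J this] show False by blast
    qed
    with G0 show ?case by blast
  next
    case (suc n)
    then obtain y where y: "pr n y \<epsilon> G" "\<And>z. pr n z \<epsilon> G \<Longrightarrow> z = y" by blast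
    have "z = ap g y" if z: "pr (suc n) z \<epsilon> G" for z
    proof (rule ccontr)
      assume "z \<noteq> ap g y"
      obtain J where J: "\<forall>p. p \<epsilon> J \<longleftrightarrow> p \<epsilon> G \<and> p \<noteq> pr (suc n) z" using del by blast
      then have "closed J" using G0 GS \<open>z \<noteq> ap g y\<close> y(2) by (auto simp: closed_def)
      from minus[OF z J this] show False by blast
    qed
    with GS[OF y(1)] show ?case by blast
  qed
  have fn: "is_fun (\<epsilon>) G (omega (\<epsilon>)) A"
    unfolding is_fun_def using uniq by (auto simp: G subset_of_def)
  have "ap G (suc n) = ap g (ap G n)" if "n \<epsilon> omega (\<epsilon>)" for n
    using GS[of n "ap G n"] pair_mem_fun_iff[OF fn] that suc_mem_omega[OF that] by metis
  moreover have "ap G (empty_set (\<epsilon>)) = a"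
    using G0 pair_mem_fun_iff[OF fn empty_mem_omega] by metis
  ultimately show ?thesis using fn by blast
qed

text \<open>Each n in \<omega> is comparable with all elements of \<delta>, by induction on n. An
  element \<alpha> of \<delta> outside \<omega> can neither be n nor belong to n, so it contains n,
  and transitivity puts n into \<delta>.\<close>

lemma omega_subset_ordinal:
  assumes ord: "is_ordinal (\<epsilon>) \<delta>" and "\<not> subset_of (\<epsilon>) \<delta> (omega (\<epsilon>))"
  shows "subset_of (\<epsilon>) (omega (\<epsilon>)) \<delta>"
proof -
  have tr: "y \<epsilon> \<delta>" if "x \<epsilon> \<delta>" "y \<epsilon> x" for x y
    using ord that unfolding is_ordinal_def is_transitive_def subset_of_def by blast
  have tr': "z \<epsilon> x" if "x \<epsilon> \<delta>" "y \<epsilon> x" "z \<epsilon> y" for x y z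
    using ord that unfolding is_ordinal_def is_transitive_def subset_of_def by blast
  have "\<forall>\<beta>. \<beta> \<epsilon> \<delta> \<longrightarrow> n \<epsilon> \<beta> \<or> n = \<beta> \<or> \<beta> \<epsilon> n" if "n \<epsilon> omega (\<epsilon>)" for n
    using that
  proof (induction rule: omega_induct)
    case definable
    show ?case by (intro definable_set_intros) auto
  next
    case empty
    have "empty_set (\<epsilon>) \<epsilon> \<beta> \<or> empty_set (\<epsilon>) = \<beta>" if \<beta>: "\<beta> \<epsilon> \<delta>" for \<beta>
    proof (cases "\<beta> = empty_set (\<epsilon>)")
      case False
      then obtain x where "x \<epsilon> \<beta>" by (auto simp: eq_empty_iff)
      from Foundation[OF this] obtain y where y: "y \<epsilon> \<beta>" "\<not> (\<exists>z. z \<epsilon> y \<and> z \<epsilon> \<beta>)" by blast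
      with tr'[OF \<beta> y(1)] have "y = empty_set (\<epsilon>)" by (auto simp: eq_empty_iff)
      with y show ?thesis by simp
    qed simp
    then show ?case by blast
  next
    case (suc n)
    let ?bad = "\<lambda>\<beta>. \<not> (suc n \<epsilon> \<beta> \<or> suc n = \<beta> \<or> \<beta> \<epsilon> suc n)"
    have "\<exists>s. \<forall>\<beta>. \<beta> \<epsilon> s \<longleftrightarrow> \<beta> \<epsilon> \<delta> \<and> ?bad \<beta>"
      by (rule separation) (intro definable_set_intros, auto)
    then obtain s where s: "\<And>\<beta>. \<beta> \<epsilon> s \<longleftrightarrow> \<beta> \<epsilon> \<delta> \<and> ?bad \<beta>" by blast
    have "\<not> ?bad \<beta>" if \<beta>: "\<beta> \<epsilon> \<delta>" for \<beta>
    proof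
      assume "?bad \<beta>"
      with s \<beta> have "\<beta> \<epsilon> s" by blast
      \<comment> \<open>A minimal counterexample \<gamma>: by the induction hypothesis it contains
        \<open>n\<close>, hence all of \<open>suc n\<close>, while minimality puts its elements into
        \<open>suc n\<close>. So \<gamma> equals \<open>suc n\<close> and is no
        counterexample.\<close>
      from Foundation[OF this] obtain \<gamma> where \<gamma>: "\<gamma> \<epsilon> s" "\<And>z. z \<epsilon> \<gamma> \<Longrightarrow> \<not> z \<epsilon> s" by blast
      then have g: "\<gamma> \<epsilon> \<delta>" "?bad \<gamma>" using s by auto
      have n: "n \<epsilon> \<gamma>" using suc.IH g by auto
      have "z \<epsilon> suc n" if "z \<epsilon> \<gamma>" for z
        using \<gamma>(2)[OF that] s[of z] tr[OF g(1) that] tr'[OF g(1) that] g(2) that by blast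
      moreover have "z \<epsilon> \<gamma>" if "z \<epsilon> suc n" for z
        using that n tr'[OF g(1) n] by auto
      ultimately have "\<gamma> = suc n" by (intro Extensionality) blast
      with g(2) show False by simp
    qed
    then show ?case by blast
  qed
  note cmp = this
  obtain \<alpha> where \<alpha>: "\<alpha> \<epsilon> \<delta>" "\<not> \<alpha> \<epsilon> omega (\<epsilon>)"
    using assms(2) unfolding subset_of_def by blast
  show ?thesis
  proof (rule subset_ofI)
    fix n assume n: "n \<epsilon> omega (\<epsilon>)"
    from cmp[OF n] \<alpha> omega_transitive[OF n] n have "n \<epsilon> \<alpha>" by blast
    with tr[OF \<alpha>(1)] show "n \<epsilon> \<delta>" by blast
  qed
qed

lemma ord_max_bounds:
  assumes "is_ordinal (\<epsilon>) \<delta>"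
  shows "subset_of (\<epsilon>) \<delta> (ord_max (\<epsilon>) \<delta> (omega (\<epsilon>)))"
    "subset_of (\<epsilon>) (omega (\<epsilon>)) (ord_max (\<epsilon>) \<delta> (omega (\<epsilon>)))"
  using omega_subset_ordinal[OF assms] by (auto simp: ord_max_def) (simp_all add: subset_of_def)

text \<open>Idealization is granted for the bound given by \<delta>, which is not assumed standard,
  but is to be used over the standard set that a cardinal \<delta>' found by Transfer provides. The
  bijections through \<open>A\<close> carry the one bound into the other.\<close>

lemma card_le_ord_max:
  assumes "is_card_of (\<epsilon>) A \<delta>" "is_card_of (\<epsilon>) A \<delta>'"
  shows "card_le (\<epsilon>) (ord_max (\<epsilon>) \<delta>' (omega (\<epsilon>))) (ord_max (\<epsilon>) \<delta> (omega (\<epsilon>)))"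
proof -
  let ?k = "ord_max (\<epsilon>) \<delta> (omega (\<epsilon>))"
  have sub: "subset_of (\<epsilon>) \<delta> ?k" "subset_of (\<epsilon>) (omega (\<epsilon>)) ?k"
    using ord_max_bounds assms(1) by (auto simp: is_card_of_def)
  \<comment> \<open>A total relation in which different arguments share no value yields an injection
    by choice; this takes the place of composing functions explicitly.\<close>
  have inj: "card_le (\<epsilon>) X ?k"
    if Q: "internal (\<lambda>e. Q (e 0) (e 1))" "\<And>x. x \<epsilon> X \<Longrightarrow> \<exists>y. y \<epsilon> ?k \<and> Q x y"
      "\<And>x x' y. x \<epsilon> X \<Longrightarrow> x' \<epsilon> X \<Longrightarrow> Q x y \<Longrightarrow> Q x' y \<Longrightarrow> x = x'" for X Q
  proof -
    obtain f where f: "is_fun (\<epsilon>) f X ?k" "\<And>x. x \<epsilon> X \<Longrightarrow> Q x (ap f x)"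
      using fun_choice[OF Q(1,2)] by blast
    then have "is_inj (\<epsilon>) f X ?k"
      unfolding is_inj_def using Q(3) app_eq_ap by metis
    then show ?thesis unfolding card_le_def by blast
  qed
  obtain f f' where f: "is_bij (\<epsilon>) f A \<delta>" "is_bij (\<epsilon>) f' A \<delta>'"
    using assms unfolding is_card_of_def by blast
  show ?thesis
  proof (cases "subset_of (\<epsilon>) \<delta>' (omega (\<epsilon>))")
    case True
    have "card_le (\<epsilon>) (omega (\<epsilon>)) ?k"
      by (rule inj[where Q = "\<lambda>x y. x = y"]) (intro definable_intros, use sub subset_ofD in auto)
    then show ?thesis using True by (simp add: ord_max_def)
  next
    case False
    have "card_le (\<epsilon>) \<delta>' ?k"
    proof (rule inj[where Q = "\<lambda>x y. \<exists>a. a \<epsilon> A \<and> ap f' a = x \<and> ap f a = y"])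
      show "internal (\<lambda>e. \<exists>a. a \<epsilon> A \<and> ap f' a = e 0 \<and> ap f a = e 1)"
        by (intro definable_set_intros) auto
    next
      fix x assume "x \<epsilon> \<delta>'"
      with is_bij_surj[OF f(2)] obtain a where a: "a \<epsilon> A" "ap f' a = x" by blast
      with ap_mem[OF is_bij_is_fun[OF f(1)] a(1)] sub(1)
      show "\<exists>y. y \<epsilon> ?k \<and> (\<exists>a. a \<epsilon> A \<and> ap f' a = x \<and> ap f a = y)"
        by (auto dest: subset_ofD)
    next
      fix x x' y
      assume "\<exists>a. a \<epsilon> A \<and> ap f' a = x \<and> ap f a = y" "\<exists>a. a \<epsilon> A \<and> ap f' a = x' \<and> ap f a = y"
      then show "x = x'" using is_bij_inj[OF f(1)] by metis
    qed
    then show ?thesis using False by (simp add: ord_max_def)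
  qed
qed

lemma st_ord_max: "st a \<Longrightarrow> st b \<Longrightarrow> st (ord_max (\<epsilon>) a b)"
  by (simp add: ord_max_def)

section \<open>Idealization\<close>

text \<open>Idealization is applied to the relation "y lies in a and differs from x". A nonstandard
  element of \<open>a\<close> would differ from all standard ones, so every standard finite subset
  of \<open>a\<close> would miss some element of \<open>a\<close>, including \<open>a\<close>
  itself.\<close>

lemma st_finite_mem_st:
  assumes "st a" "is_finite (\<epsilon>) a" "x \<epsilon> a"
  shows "st x"
proof (rule ccontr)
  assume "\<not> st x"
  have Q: "internal (\<lambda>e. e 1 \<epsilon> a \<and> e 1 \<noteq> e 0)" by (intro definable_intros) auto
  obtain p c where p: "st_free p" "\<And>x y. y \<epsilon> a \<and> y \<noteq> x \<longleftrightarrow> sat (\<epsilon>) st p (x ## y ## c)"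
    using definable_formula2[OF Q] by auto
  from Bounded_Idealization[OF assms(1) p(1), of c]
  have "(\<forall>b. st b \<and> is_finite (\<epsilon>) b \<and> subset_of (\<epsilon>) b a \<longrightarrow> (\<exists>y. \<forall>x. x \<epsilon> b \<longrightarrow> y \<epsilon> a \<and> y \<noteq> x)) \<longleftrightarrow>
      (\<exists>y. \<forall>x. st x \<and> x \<epsilon> a \<longrightarrow> y \<epsilon> a \<and> y \<noteq> x)"
    by (simp add: p(2))
  moreover have "\<forall>z. st z \<and> z \<epsilon> a \<longrightarrow> x \<epsilon> a \<and> x \<noteq> z" using assms(3) \<open>\<not> st x\<close> by blast
  ultimately have "\<exists>y. \<forall>x. x \<epsilon> a \<longrightarrow> y \<epsilon> a \<and> y \<noteq> x"
    using assms(1,2) by (auto simp: subset_of_def)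
  with assms(3) show False by blast
qed

section \<open>Values at w of standard functions\<close>

lemma st_w_standard:
  assumes "st I" "w \<epsilon> I" "st a"
  shows "w_standard (\<epsilon>) st I w a"
proof -
  have "\<exists>f. st f \<and> is_fun (\<epsilon>) f I (unord_pair (\<epsilon>) a a) \<and> (\<forall>x. x \<epsilon> I \<longrightarrow> ap f x = a)"
    by (rule standard_fun_choice[where Q = "\<lambda>x y. y = a"])
      (intro definable_set_intros, use assms in \<open>auto simp: st_unord_pair\<close>)
  then show ?thesis
    unfolding w_standard_def using assms(2) app_eq_ap by metis
qed

lemma self_w_standard:
  assumes "st I" "w \<epsilon> I"
  shows "w_standard (\<epsilon>) st I w w"
proof -
  have "\<exists>f. st f \<and> is_fun (\<epsilon>) f I I \<and> (\<forall>x. x \<epsilon> I \<longrightarrow> ap f x = x)"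
    by (rule standard_fun_choice[where Q = "\<lambda>x y. y = x"])
      (intro definable_set_intros, use assms in auto)
  then show ?thesis
    unfolding w_standard_def using assms(2) app_eq_ap by metis
qed

text \<open>Writing y = h(w) with h standard, one chooses f(i) from h(i) for all i in I at once;
  uniqueness at \<open>w\<close> then forces f(w) = z. It serves to take the first component of a
  w-standard pair.\<close>

lemma w_standard_fun:
  assumes Q: "standard_definable (\<lambda>e. Q (e 0) (e 1))" and st: "st I" "st B" and w: "w \<epsilon> I"
    and y: "w_standard (\<epsilon>) st I w y" "z \<epsilon> B" "Q y z" "\<And>z'. z' \<epsilon> B \<Longrightarrow> Q y z' \<Longrightarrow> z' = z"
  shows "\<exists>f. st f \<and> is_fun (\<epsilon>) f I B \<and> ap f w = z"
proof -
  obtain h C where h: "st h" "is_fun (\<epsilon>) h I C" "y = ap h w"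
    using y(1) w app_eq_ap unfolding w_standard_def by metis
  \<comment> \<open>The guard keeps the relation solvable at indices i for which nothing in
    \<open>B\<close> is related to h(i). Any element of \<open>B\<close> will do there, and
    \<open>z\<close> shows that there is one.\<close>
  let ?Q = "\<lambda>i z. (\<exists>z. z \<epsilon> B \<and> Q (ap h i) z) \<longrightarrow> Q (ap h i) z"
  have "\<exists>f. st f \<and> is_fun (\<epsilon>) f I B \<and> (\<forall>x. x \<epsilon> I \<longrightarrow> ?Q x (ap f x))"
    by (rule standard_fun_choice[where Q = ?Q])
      (intro definable_set_intros definable_subst2[OF Q], use st h y(2) in auto)
  then obtain f where f: "st f" "is_fun (\<epsilon>) f I B" "?Q w (ap f w)" using w by blast
  have "ap f w = z" using f(3) y(2-4) ap_mem[OF f(2) w] h(3) by blast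
  with f show ?thesis by blast
qed

text \<open>Standard parameters count as w-standard through constant functions, so a formula may mix
  them with values at \<open>w\<close> and with \<open>w\<close> itself.\<close>

lemma w_idealization_definable:
  assumes "w_idealization (\<epsilon>) st I w k" "st I" "w \<epsilon> I"
    and Q: "definable (w_standard (\<epsilon>) st I w) False (\<lambda>e. Q (e 0) (e 1))"
    and A: "st A" "card_le (\<epsilon>) A k"
    and fin: "\<And>a. st a \<Longrightarrow> is_finite (\<epsilon>) a \<Longrightarrow> subset_of (\<epsilon>) a A \<Longrightarrow> \<exists>y. \<forall>x. x \<epsilon> a \<longrightarrow> Q x y"
  shows "\<exists>y. w_standard (\<epsilon>) st I w y \<and> (\<forall>x. st x \<and> x \<epsilon> A \<longrightarrow> Q x y)"
proof -
  obtain p c where p: "st_free p" "\<forall>i. st (c i) \<or> w_standard (\<epsilon>) st I w (c i)"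
    and Q: "\<And>x y. Q x y \<longleftrightarrow> sat (\<epsilon>) st p (x ## y ## c)"
    using definable_formula2[OF Q] by auto
  have "\<forall>i. w_standard (\<epsilon>) st I w (c i)" using p(2) st_w_standard[OF assms(2,3)] by blast
  with assms(1) p(1) A fin show ?thesis
    unfolding w_idealization_def Q by blast
qed

end

section \<open>Real numbers of the structure\<close>

locale BST_reals = BST +
  fixes R :: "'a field_str"
  assumes field: "complete_ordered_field mem R"
    and st_field: "standard_field_str st R"
begin

abbreviation Re :: "'a" where "Re \<equiv> f_set R"
abbreviation add :: "'a \<Rightarrow> 'a \<Rightarrow> 'a" (infixl "\<oplus>" 65) where "x \<oplus> y \<equiv> ap2 (f_add R) x y"
abbreviation mul :: "'a \<Rightarrow> 'a \<Rightarrow> 'a" (infixl "\<otimes>" 70) where "x \<otimes> y \<equiv> ap2 (f_mul R) x y"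
abbreviation le :: "'a \<Rightarrow> 'a \<Rightarrow> bool" (infix "\<preceq>" 50) where "x \<preceq> y \<equiv> rle (\<epsilon>) R x y"
abbreviation less :: "'a \<Rightarrow> 'a \<Rightarrow> bool" (infix "\<prec>" 50) where "x \<prec> y \<equiv> rless (\<epsilon>) R x y"
abbreviation zero :: "'a" ("\<zero>") where "\<zero> \<equiv> f_zero R"
abbreviation one :: "'a" ("\<one>") where "\<one> \<equiv> f_one R"

section \<open>Arithmetic of the ordered field\<close>

lemma st_field_str [simp]:
  "st (f_set R)" "st (f_add R)" "st (f_mul R)" "st (f_le R)" "st (f_zero R)" "st (f_one R)"
  using st_field by (simp_all add: standard_field_str_def)

lemma definable_le:
  assumes "definable_term K b s" "definable_term K b t"
  shows "definable K b (\<lambda>e. s e \<preceq> t e)"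
  unfolding rle_def by (intro definable_set_intros assms) auto

lemma definable_less:
  assumes "definable_term K b s" "definable_term K b t"
  shows "definable K b (\<lambda>e. s e \<prec> t e)"
  unfolding rless_def by (intro definable_set_intros definable_le assms)

lemmas definable_real_intros = definable_set_intros definable_le definable_less

lemma add_fun: "is_fun (\<epsilon>) (f_add R) (cprod (\<epsilon>) Re Re) Re"
  and mul_fun: "is_fun (\<epsilon>) (f_mul R) (cprod (\<epsilon>) Re Re) Re"
  and zero_real [simp]: "\<zero> \<epsilon> Re" and one_real [simp]: "\<one> \<epsilon> Re" and zero_neq_one: "\<zero> \<noteq> \<one>"
  using field by (simp_all add: complete_ordered_field_def is_real_def)

lemma radd_eq: "x \<epsilon> Re \<Longrightarrow> y \<epsilon> Re \<Longrightarrow> radd (\<epsilon>) R x y = x \<oplus> y"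
  unfolding radd_def by (rule app2_eq_ap[OF add_fun])

lemma rmul_eq: "x \<epsilon> Re \<Longrightarrow> y \<epsilon> Re \<Longrightarrow> rmul (\<epsilon>) R x y = x \<otimes> y"
  unfolding rmul_def by (rule app2_eq_ap[OF mul_fun])

lemma add_real [simp]: "x \<epsilon> Re \<Longrightarrow> y \<epsilon> Re \<Longrightarrow> x \<oplus> y \<epsilon> Re"
  using ap_mem[OF add_fun] by simp

lemma mul_real [simp]: "x \<epsilon> Re \<Longrightarrow> y \<epsilon> Re \<Longrightarrow> x \<otimes> y \<epsilon> Re"
  using ap_mem[OF mul_fun] by simp

lemma field_axioms:
  assumes "x \<epsilon> Re" "y \<epsilon> Re" "z \<epsilon> Re"
  shows "(x \<oplus> y) \<oplus> z = x \<oplus> (y \<oplus> z)" and "x \<oplus> y = y \<oplus> x"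
    and "(x \<otimes> y) \<otimes> z = x \<otimes> (y \<otimes> z)" and "x \<otimes> y = y \<otimes> x"
    and "x \<otimes> (y \<oplus> z) = x \<otimes> y \<oplus> x \<otimes> z"
    and "\<zero> \<oplus> x = x" and "\<one> \<otimes> x = x"
    and "\<exists>y. y \<epsilon> Re \<and> x \<oplus> y = \<zero>"
    and "x \<noteq> \<zero> \<Longrightarrow> \<exists>y. y \<epsilon> Re \<and> x \<otimes> y = \<one>"
    and "x \<preceq> y \<or> y \<preceq> x" and "x \<preceq> y \<Longrightarrow> y \<preceq> x \<Longrightarrow> x = y"
    and "x \<preceq> y \<Longrightarrow> y \<preceq> z \<Longrightarrow> x \<preceq> z"
    and "x \<preceq> y \<Longrightarrow> x \<oplus> z \<preceq> y \<oplus> z"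
    and "x \<preceq> y \<Longrightarrow> \<zero> \<preceq> z \<Longrightarrow> x \<otimes> z \<preceq> y \<otimes> z"
proof -
  note f = field[unfolded complete_ordered_field_def is_real_def]
  note a = f[THEN conjunct2, THEN conjunct2, THEN conjunct2, THEN conjunct2, THEN conjunct2, THEN conjunct2]
  note b = a[THEN conjunct2]
  note c = b[THEN conjunct2]
  note d = c[THEN conjunct2]
  note e = d[THEN conjunct2, THEN conjunct1]
  have r: "radd (\<epsilon>) R x y = x \<oplus> y" "radd (\<epsilon>) R y z = y \<oplus> z" "radd (\<epsilon>) R y x = y \<oplus> x"
    "radd (\<epsilon>) R (x \<oplus> y) z = x \<oplus> y \<oplus> z" "radd (\<epsilon>) R x (y \<oplus> z) = x \<oplus> (y \<oplus> z)"
    "rmul (\<epsilon>) R x y = x \<otimes> y" "rmul (\<epsilon>) R y z = y \<otimes> z" "rmul (\<epsilon>) R y x = y \<otimes> x"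
    "rmul (\<epsilon>) R x z = x \<otimes> z" "rmul (\<epsilon>) R (x \<otimes> y) z = x \<otimes> y \<otimes> z"
    "rmul (\<epsilon>) R x (y \<otimes> z) = x \<otimes> (y \<otimes> z)" "rmul (\<epsilon>) R x (y \<oplus> z) = x \<otimes> (y \<oplus> z)"
    "radd (\<epsilon>) R (x \<otimes> y) (x \<otimes> z) = x \<otimes> y \<oplus> x \<otimes> z"
    using assms by (simp_all add: radd_eq rmul_eq)
  from a[THEN conjunct1, rule_format, of x y z, unfolded r] assms
  show "(x \<oplus> y) \<oplus> z = x \<oplus> (y \<oplus> z)" "x \<oplus> y = y \<oplus> x" "(x \<otimes> y) \<otimes> z = x \<otimes> (y \<otimes> z)"
    "x \<otimes> y = y \<otimes> x" "x \<otimes> (y \<oplus> z) = x \<otimes> y \<oplus> x \<otimes> z"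
    by blast+
  from b[THEN conjunct1, rule_format, of x] assms
  show "\<zero> \<oplus> x = x" "\<one> \<otimes> x = x" by (simp_all add: radd_eq rmul_eq)
  from c[THEN conjunct1, rule_format, OF assms(1)] assms
  show "\<exists>y. y \<epsilon> Re \<and> x \<oplus> y = \<zero>" by (auto simp: radd_eq)
  from d[THEN conjunct1, rule_format, of x] assms
  show "x \<noteq> \<zero> \<Longrightarrow> \<exists>y. y \<epsilon> Re \<and> x \<otimes> y = \<one>" by (auto simp: rmul_eq)
  from e[rule_format, of x y z] assms
  show "x \<preceq> y \<or> y \<preceq> x" "x \<preceq> y \<Longrightarrow> y \<preceq> x \<Longrightarrow> x = y" "x \<preceq> y \<Longrightarrow> y \<preceq> z \<Longrightarrow> x \<preceq> z"
    "x \<preceq> y \<Longrightarrow> x \<oplus> z \<preceq> y \<oplus> z" "x \<preceq> y \<Longrightarrow> \<zero> \<preceq> z \<Longrightarrow> x \<otimes> z \<preceq> y \<otimes> z"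
    by (simp_all add: radd_eq rmul_eq)
qed

text \<open>\<open>field_axioms\<close> assumes three reals throughout; where an axiom has fewer
  variables, the spare ones are instantiated with zero.\<close>

lemmas add_assoc = field_axioms(1)
  and add_comm = field_axioms(2)[OF _ _ zero_real]
  and mul_assoc = field_axioms(3)
  and mul_comm = field_axioms(4)[OF _ _ zero_real]
  and distrib = field_axioms(5)
  and add_zero = field_axioms(6)[OF _ zero_real zero_real]
  and mul_one = field_axioms(7)[OF _ zero_real zero_real]
  and ex_neg = field_axioms(8)[OF _ zero_real zero_real]
  and ex_inv = field_axioms(9)[OF _ zero_real zero_real]
  and le_total = field_axioms(10)[OF _ _ zero_real]
  and le_antisym = field_axioms(11)[OF _ _ zero_real]
  and le_trans = field_axioms(12)
  and add_right_mono = field_axioms(13)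
  and mul_right_mono = field_axioms(14)

lemma ex_sup:
  assumes "subset_of (\<epsilon>) S Re" "x \<epsilon> S" "b \<epsilon> Re" "\<And>x. x \<epsilon> S \<Longrightarrow> x \<preceq> b"
  shows "\<exists>s. s \<epsilon> Re \<and> (\<forall>x. x \<epsilon> S \<longrightarrow> x \<preceq> s) \<and> (\<forall>b. b \<epsilon> Re \<and> (\<forall>x. x \<epsilon> S \<longrightarrow> x \<preceq> b) \<longrightarrow> s \<preceq> b)"
  using field[unfolded complete_ordered_field_def is_real_def] assms by blast

lemma add_zero_right: "x \<epsilon> Re \<Longrightarrow> x \<oplus> \<zero> = x"
  using add_comm[of x \<zero>] add_zero by simp

lemmas add_simps = add_zero add_zero_right

lemma le_refl [simp]: "x \<epsilon> Re \<Longrightarrow> x \<preceq> x"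
  using le_total[of x x] by auto

lemma less_le: "x \<prec> y \<Longrightarrow> x \<preceq> y"
  by (simp add: rless_def)

lemma less_irrefl [simp]: "\<not> x \<prec> x"
  by (simp add: rless_def)

lemma not_less: "x \<epsilon> Re \<Longrightarrow> y \<epsilon> Re \<Longrightarrow> \<not> x \<prec> y \<longleftrightarrow> y \<preceq> x"
  unfolding rless_def using le_total[of x y] le_antisym[of x y] le_refl by auto

lemma not_le: "x \<epsilon> Re \<Longrightarrow> y \<epsilon> Re \<Longrightarrow> \<not> x \<preceq> y \<longleftrightarrow> y \<prec> x"
  using not_less[of y x] by auto

lemma le_less_trans: "x \<epsilon> Re \<Longrightarrow> y \<epsilon> Re \<Longrightarrow> z \<epsilon> Re \<Longrightarrow> x \<preceq> y \<Longrightarrow> y \<prec> z \<Longrightarrow> x \<prec> z"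
  using le_trans[of z x y] not_less[of x z] not_less[of y z] by auto

lemma less_le_trans: "x \<epsilon> Re \<Longrightarrow> y \<epsilon> Re \<Longrightarrow> z \<epsilon> Re \<Longrightarrow> x \<prec> y \<Longrightarrow> y \<preceq> z \<Longrightarrow> x \<prec> z"
  using le_trans[of y z x] not_less[of x z] not_less[of x y] by auto

lemma less_trans: "x \<epsilon> Re \<Longrightarrow> y \<epsilon> Re \<Longrightarrow> z \<epsilon> Re \<Longrightarrow> x \<prec> y \<Longrightarrow> y \<prec> z \<Longrightarrow> x \<prec> z"
  using le_less_trans less_le by blast

lemma add_right_cancel:
  assumes "x \<epsilon> Re" "y \<epsilon> Re" "z \<epsilon> Re" "x \<oplus> z = y \<oplus> z"
  shows "x = y"
proof -
  obtain n where "n \<epsilon> Re" "z \<oplus> n = \<zero>" using ex_neg[of z] assms by blast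
  then have "u = (u \<oplus> z) \<oplus> n" if "u \<epsilon> Re" for u
    using that assms(3) by (simp add: add_assoc add_simps)
  with assms show ?thesis by metis
qed

lemma add_right_less: "x \<epsilon> Re \<Longrightarrow> y \<epsilon> Re \<Longrightarrow> z \<epsilon> Re \<Longrightarrow> x \<prec> y \<Longrightarrow> x \<oplus> z \<prec> y \<oplus> z"
  unfolding rless_def using add_right_mono add_right_cancel by blast

lemma add_left_less: "x \<epsilon> Re \<Longrightarrow> y \<epsilon> Re \<Longrightarrow> z \<epsilon> Re \<Longrightarrow> x \<prec> y \<Longrightarrow> z \<oplus> x \<prec> z \<oplus> y"
  using add_right_less[of x y z] add_comm[of z] by simp

lemma add_right_less_iff:
  "x \<epsilon> Re \<Longrightarrow> y \<epsilon> Re \<Longrightarrow> z \<epsilon> Re \<Longrightarrow> x \<oplus> z \<prec> y \<oplus> z \<longleftrightarrow> x \<prec> y"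
  using add_right_less[of x y z] add_right_mono[of y x z] not_less[of x y]
    not_less[of "x \<oplus> z" "y \<oplus> z"] by auto

lemma add_less_mono:
  assumes "x \<epsilon> Re" "y \<epsilon> Re" "x' \<epsilon> Re" "y' \<epsilon> Re" "x \<prec> x'" "y \<prec> y'"
  shows "x \<oplus> y \<prec> x' \<oplus> y'"
  using less_trans[OF _ _ _ add_right_less[of x x' y] add_left_less[of y y' x']] assms by simp

lemma ex_diff:
  assumes "x \<epsilon> Re" "y \<epsilon> Re"
  shows "\<exists>c. c \<epsilon> Re \<and> y = c \<oplus> x"
proof -
  obtain n where n: "n \<epsilon> Re" "x \<oplus> n = \<zero>" using ex_neg[of x] assms by blast
  then have "n \<oplus> x = \<zero>" using add_comm[of n x] assms by simp
  then have "y = (y \<oplus> n) \<oplus> x" using add_assoc[of y n x] assms n by (simp add: add_simps)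
  then show ?thesis using n assms by (intro exI[of _ "y \<oplus> n"]) simp
qed

lemma ex_diff_pos:
  assumes "x \<epsilon> Re" "y \<epsilon> Re" "x \<prec> y"
  shows "\<exists>c. c \<epsilon> Re \<and> \<zero> \<prec> c \<and> y = c \<oplus> x"
proof -
  obtain c where c: "c \<epsilon> Re" "y = c \<oplus> x" using ex_diff assms by blast
  then have "\<zero> \<prec> c" using add_right_less_iff[of \<zero> c x] assms by (simp add: add_simps)
  with c show ?thesis by blast
qed

lemma less_add_pos: "x \<epsilon> Re \<Longrightarrow> y \<epsilon> Re \<Longrightarrow> \<zero> \<prec> y \<Longrightarrow> x \<prec> x \<oplus> y"
  using add_left_less[of \<zero> y x] by (simp add: add_simps)

lemma mul_zero: "x \<epsilon> Re \<Longrightarrow> x \<otimes> \<zero> = \<zero>"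
  using distrib[of x \<zero> \<zero>] add_right_cancel[of "x \<otimes> \<zero>" \<zero> "x \<otimes> \<zero>"] by (simp add: add_simps)

text \<open>If 1 \<le> 0, then n = -1 is nonnegative and so is its square. But that square is 1,
  whence 1 = 0.\<close>

lemma zero_less_one: "\<zero> \<prec> \<one>"
proof (rule ccontr)
  assume "\<not> \<zero> \<prec> \<one>"
  then have le: "\<one> \<preceq> \<zero>" by (simp add: not_less)
  obtain n where n: "n \<epsilon> Re" "\<one> \<oplus> n = \<zero>" using ex_neg[of \<one>] by auto
  have "\<zero> \<preceq> n" using add_right_mono[OF _ _ n(1) le] n by (simp add: add_simps)
  then have "\<zero> \<otimes> n \<preceq> n \<otimes> n" using mul_right_mono[of \<zero> n n] n by simp
  then have nn: "\<zero> \<preceq> n \<otimes> n" using mul_zero mul_comm[of \<zero> n] n by simp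
  have "n \<otimes> (\<one> \<oplus> n) = n \<oplus> n \<otimes> n"
    using distrib[of n \<one> n] mul_comm[of n \<one>] mul_one n by simp
  then have "n \<oplus> n \<otimes> n = n \<oplus> \<one>" using n mul_zero add_comm[of n \<one>] by simp
  then have "n \<otimes> n = \<one>"
    using add_right_cancel[of "n \<otimes> n" \<one> n] add_comm[of n] n by simp
  with nn le le_antisym[of \<one> \<zero>] zero_neq_one show False by simp
qed

lemma mul_right_less:
  assumes "x \<epsilon> Re" "y \<epsilon> Re" "z \<epsilon> Re" "x \<prec> y" "\<zero> \<prec> z"
  shows "x \<otimes> z \<prec> y \<otimes> z"
proof -
  have "x \<otimes> z \<noteq> y \<otimes> z"
  proof
    assume eq: "x \<otimes> z = y \<otimes> z"
    obtain v where v: "v \<epsilon> Re" "z \<otimes> v = \<one>" using ex_inv[of z] assms by (auto simp: rless_def)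
    have "u = (u \<otimes> z) \<otimes> v" if "u \<epsilon> Re" for u
      using mul_assoc[of u z v] mul_one mul_comm[of u \<one>] that v assms by simp
    with assms eq show False by (metis less_irrefl)
  qed
  then show ?thesis
    using mul_right_mono[of x y z] assms by (auto simp: rless_def)
qed

lemma ex_half:
  assumes "r \<epsilon> Re" "\<zero> \<prec> r"
  shows "\<exists>h. h \<epsilon> Re \<and> \<zero> \<prec> h \<and> h \<oplus> h = r"
proof -
  have "\<zero> \<prec> \<one> \<oplus> \<one>"
    using less_trans[OF _ _ _ zero_less_one less_add_pos[OF _ _ zero_less_one]] by simp
  then obtain v where v: "v \<epsilon> Re" "(\<one> \<oplus> \<one>) \<otimes> v = \<one>" using ex_inv[of "\<one> \<oplus> \<one>"]
    by (auto simp: rless_def)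
  let ?h = "r \<otimes> v"
  have h: "?h \<epsilon> Re" using assms v by simp
  have "?h \<oplus> ?h = ?h \<otimes> (\<one> \<oplus> \<one>)"
    using distrib[of ?h \<one> \<one>] mul_comm[of ?h \<one>] mul_one[of ?h] h by simp
  also have "\<dots> = r"
    using mul_assoc[of r v "\<one> \<oplus> \<one>"] mul_comm[of v "\<one> \<oplus> \<one>"] mul_comm[of r \<one>] mul_one[of r] v assms
    by simp
  finally have sum: "?h \<oplus> ?h = r" .
  have "\<zero> \<prec> ?h"
  proof (rule ccontr)
    assume "\<not> \<zero> \<prec> ?h"
    then have "?h \<preceq> \<zero>" using h by (simp add: not_less)
    from add_right_mono[OF h _ h this] this le_trans[of "?h \<oplus> ?h" ?h \<zero>] h sum
    have "r \<preceq> \<zero>" using assms(1) by (simp add: add_simps)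
    with assms not_less[of \<zero> r] show False by simp
  qed
  with h sum show ?thesis by blast
qed

lemma dense:
  assumes "x \<epsilon> Re" "y \<epsilon> Re" "x \<prec> y"
  shows "\<exists>z. z \<epsilon> Re \<and> x \<prec> z \<and> z \<prec> y"
proof -
  obtain c where c: "c \<epsilon> Re" "\<zero> \<prec> c" "y = c \<oplus> x" using ex_diff_pos[OF assms] by blast
  obtain h where h: "h \<epsilon> Re" "\<zero> \<prec> h" "h \<oplus> h = c" using ex_half[OF c(1,2)] by blast
  have "x \<prec> x \<oplus> h" "x \<oplus> h \<prec> (x \<oplus> h) \<oplus> h" using less_add_pos assms h by simp_all
  moreover have "(x \<oplus> h) \<oplus> h = y" using add_assoc[of x h h] add_comm[of x c] c h assms by simp
  ultimately show ?thesis using assms h by (intro exI[of _ "x \<oplus> h"]) simp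
qed

text \<open>The excess of m over x + y is halved, and each summand receives one half. This is what
  lets the triangle inequality survive the passage to shadows.\<close>

lemma split_sum:
  assumes "x \<epsilon> Re" "y \<epsilon> Re" "m \<epsilon> Re" "x \<oplus> y \<prec> m"
  shows "\<exists>s t. s \<epsilon> Re \<and> t \<epsilon> Re \<and> x \<prec> s \<and> y \<prec> t \<and> s \<oplus> t = m"
proof -
  obtain c where c: "c \<epsilon> Re" "\<zero> \<prec> c" "m = c \<oplus> (x \<oplus> y)"
    using ex_diff_pos[OF _ assms(3,4)] assms by auto
  obtain h where h: "h \<epsilon> Re" "\<zero> \<prec> h" "h \<oplus> h = c" using ex_half[OF c(1,2)] by blast
  have "(x \<oplus> h) \<oplus> (y \<oplus> h) = x \<oplus> ((h \<oplus> y) \<oplus> h)"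
    using add_assoc[of x h "y \<oplus> h"] add_assoc[of h y h] assms h by simp
  also have "(h \<oplus> y) \<oplus> h = y \<oplus> c"
    using add_comm[of h y] add_assoc[of y h h] assms h by simp
  also have "x \<oplus> (y \<oplus> c) = m"
    using add_assoc[of x y c] add_comm[of "x \<oplus> y" c] assms c by simp
  finally show ?thesis
    using less_add_pos assms h by (intro exI[of _ "x \<oplus> h"] exI[of _ "y \<oplus> h"]) simp
qed

text \<open>In the definition \<open>J\<close> may contain sets that are not reals, on which
  \<open>radd\<close> is an unspecified description. Cutting \<open>J\<close> down to the reals
  gives a formula that Separation and Transfer accept.\<close>

lemma rnat_iff:
  "rnat (\<epsilon>) R n \<longleftrightarrow>
    (\<forall>J. subset_of (\<epsilon>) J Re \<and> \<zero> \<epsilon> J \<and> (\<forall>x. x \<epsilon> J \<longrightarrow> x \<oplus> \<one> \<epsilon> J) \<longrightarrow> n \<epsilon> J)"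
proof
  assume n: "rnat (\<epsilon>) R n"
  show "\<forall>J. subset_of (\<epsilon>) J Re \<and> \<zero> \<epsilon> J \<and> (\<forall>x. x \<epsilon> J \<longrightarrow> x \<oplus> \<one> \<epsilon> J) \<longrightarrow> n \<epsilon> J"
  proof (intro allI impI)
    fix J assume "subset_of (\<epsilon>) J Re \<and> \<zero> \<epsilon> J \<and> (\<forall>x. x \<epsilon> J \<longrightarrow> x \<oplus> \<one> \<epsilon> J)"
    then show "n \<epsilon> J"
      using n[unfolded rnat_def, rule_format, of J] subset_ofD[of J Re] radd_eq[OF _ one_real] by simp
  qed
next
  assume n: "\<forall>J. subset_of (\<epsilon>) J Re \<and> \<zero> \<epsilon> J \<and> (\<forall>x. x \<epsilon> J \<longrightarrow> x \<oplus> \<one> \<epsilon> J) \<longrightarrow> n \<epsilon> J"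
  show "rnat (\<epsilon>) R n"
    unfolding rnat_def
  proof (intro allI impI)
    fix J assume J: "\<zero> \<epsilon> J \<and> (\<forall>x. x \<epsilon> J \<longrightarrow> radd (\<epsilon>) R x \<one> \<epsilon> J)"
    have "x \<oplus> \<one> \<epsilon> J" if "x \<epsilon> J" "x \<epsilon> Re" for x
      using J that radd_eq[OF that(2) one_real] by metis
    then have "n \<epsilon> inter_set (\<epsilon>) J Re"
      using J by (intro n[rule_format]) (auto simp: subset_of_def)
    then show "n \<epsilon> J" by simp
  qed
qed

lemma definable_rnat:
  assumes "definable_term K b s"
  shows "definable K b (\<lambda>e. rnat (\<epsilon>) R (s e))"
  by (rule definable_subst1[OF _ assms], unfold rnat_iff) (intro definable_set_intros, auto)

lemma rnat_real: "rnat (\<epsilon>) R n \<Longrightarrow> n \<epsilon> Re"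
  unfolding rnat_iff by (drule spec[of _ Re]) (simp add: subset_of_def)

lemma rnat_suc: "rnat (\<epsilon>) R n \<Longrightarrow> rnat (\<epsilon>) R (n \<oplus> \<one>)"
  unfolding rnat_iff by blast

lemma rnat_pos:
  assumes "rnat (\<epsilon>) R n" "n \<noteq> \<zero>"
  shows "\<zero> \<prec> n"
proof -
  have "\<exists>J. \<forall>x. x \<epsilon> J \<longleftrightarrow> x \<epsilon> Re \<and> \<zero> \<preceq> x"
    by (rule separation) (intro definable_real_intros, auto)
  then obtain J where J: "\<And>x. x \<epsilon> J \<longleftrightarrow> x \<epsilon> Re \<and> \<zero> \<preceq> x" by blast
  have "\<zero> \<preceq> x \<oplus> \<one>" if "x \<epsilon> Re" "\<zero> \<preceq> x" for x
    using le_trans[of \<zero> x "x \<oplus> \<one>"] less_le[OF less_add_pos[of x \<one>]] zero_less_one that by simp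
  then have "n \<epsilon> J"
    using assms(1)[unfolded rnat_iff, rule_format, of J] by (simp add: J subset_of_def)
  with assms(2) show ?thesis by (simp add: J rless_def)
qed

lemma archimedean:
  assumes "x \<epsilon> Re"
  shows "\<exists>n. rnat (\<epsilon>) R n \<and> x \<prec> n"
proof (rule ccontr)
  assume no: "\<not> ?thesis"
  have "\<exists>N. \<forall>x. x \<epsilon> N \<longleftrightarrow> x \<epsilon> Re \<and> rnat (\<epsilon>) R x"
    by (rule separation) (intro definable_set_intros definable_rnat)
  then obtain N where N: "\<And>n. n \<epsilon> N \<longleftrightarrow> rnat (\<epsilon>) R n" using rnat_real by blast
  have "n \<preceq> x" if "n \<epsilon> N" for n
    using no that assms N rnat_real not_less by blast
  moreover have "\<zero> \<epsilon> N" unfolding N rnat_iff by blast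
  moreover have "subset_of (\<epsilon>) N Re" using N rnat_real by (auto simp: subset_of_def)
  ultimately obtain s where s: "s \<epsilon> Re" "\<And>n. n \<epsilon> N \<Longrightarrow> n \<preceq> s"
    "\<And>b. b \<epsilon> Re \<Longrightarrow> (\<And>n. n \<epsilon> N \<Longrightarrow> n \<preceq> b) \<Longrightarrow> s \<preceq> b"
    using ex_sup[of N \<zero> x] assms by blast
  obtain c where c: "c \<epsilon> Re" "s = c \<oplus> \<one>" using ex_diff[OF one_real s(1)] by blast
  have "c \<prec> s" using less_add_pos[of c \<one>] zero_less_one c by simp
  then obtain n where n: "n \<epsilon> N" "c \<prec> n"
    using s(3)[OF c(1)] not_le[OF s(1) c(1)] N rnat_real not_le c(1) by blast
  then have "s \<prec> n \<oplus> \<one>" using add_right_less[of c n \<one>] c N rnat_real by simp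
  moreover have "n \<oplus> \<one> \<preceq> s" using s(2) n N rnat_suc by blast
  ultimately show False using not_less[of s "n \<oplus> \<one>"] s(1) n N rnat_real by simp
qed

lemma standard_archimedean:
  assumes "x \<epsilon> Re" "st x"
  shows "\<exists>n. st n \<and> rnat (\<epsilon>) R n \<and> x \<prec> n"
proof -
  obtain n where "rnat (\<epsilon>) R n \<and> x \<prec> n" using archimedean assms by blast
  then show ?thesis
    by (rule transfer_ex[where P = "\<lambda>n. rnat (\<epsilon>) R n \<and> x \<prec> n", rotated])
      (intro definable_real_intros definable_rnat, use assms in auto)
qed

section \<open>Negatives, reciprocals and distances\<close>

lemma rneg:
  assumes "x \<epsilon> Re"
  shows "rneg (\<epsilon>) R x \<epsilon> Re" "x \<oplus> rneg (\<epsilon>) R x = \<zero>"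
proof -
  obtain y where y: "y \<epsilon> Re" "x \<oplus> y = \<zero>" using ex_neg assms by blast
  have "rneg (\<epsilon>) R x = y"
    unfolding rneg_def is_real_def
  proof (rule the_equality)
    fix z assume "z \<epsilon> Re \<and> radd (\<epsilon>) R x z = \<zero>"
    then have "z \<epsilon> Re" "x \<oplus> z = \<zero>" using assms by (auto simp: radd_eq)
    then show "z = y"
      using y assms add_right_cancel[of z y x] add_comm[of x z] add_comm[of x y] by simp
  qed (use y assms in \<open>simp add: radd_eq\<close>)
  with y show "rneg (\<epsilon>) R x \<epsilon> Re" "x \<oplus> rneg (\<epsilon>) R x = \<zero>" by auto
qed

lemma rinv:
  assumes "x \<epsilon> Re" "\<zero> \<prec> x"
  shows "rinv (\<epsilon>) R x \<epsilon> Re" "x \<otimes> rinv (\<epsilon>) R x = \<one>" "\<zero> \<prec> rinv (\<epsilon>) R x"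
    "st x \<Longrightarrow> st (rinv (\<epsilon>) R x)"
proof -
  obtain y where y: "y \<epsilon> Re" "x \<otimes> y = \<one>" using ex_inv[of x] assms by (auto simp: rless_def)
  have uniq: "z = y" if z: "z \<epsilon> Re" "x \<otimes> z = \<one>" for z
  proof -
    have "(z \<otimes> x) \<otimes> y = z"
      unfolding mul_assoc[OF z(1) assms(1) y(1)] y(2) using mul_comm[of z \<one>] mul_one[of z] z by simp
    moreover have "(z \<otimes> x) \<otimes> y = y"
      unfolding mul_comm[OF z(1) assms(1)] z(2) using mul_one y by simp
    ultimately show ?thesis by simp
  qed
  have inv: "rinv (\<epsilon>) R x = y"
    unfolding rinv_def is_real_def
  proof (rule the_equality)
    show "y \<epsilon> Re \<and> rmul (\<epsilon>) R x y = \<one>" using y assms by (simp add: rmul_eq)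
    show "z \<epsilon> Re \<and> rmul (\<epsilon>) R x z = \<one> \<Longrightarrow> z = y" for z
      using uniq[of z] rmul_eq[OF assms(1), of z] by auto
  qed
  with y show "rinv (\<epsilon>) R x \<epsilon> Re" "x \<otimes> rinv (\<epsilon>) R x = \<one>" by auto
  show "\<zero> \<prec> rinv (\<epsilon>) R x"
  proof (rule ccontr)
    assume "\<not> \<zero> \<prec> rinv (\<epsilon>) R x"
    then have "y \<preceq> \<zero>" using y by (simp add: inv not_less)
    then have "y \<otimes> x \<preceq> \<zero> \<otimes> x" using mul_right_mono[of y \<zero> x] y assms less_le by simp
    then have "\<one> \<preceq> \<zero>" using mul_comm[of y x] mul_comm[of \<zero> x] mul_zero y assms by simp
    with zero_less_one show False by (simp add: not_less[symmetric])
  qed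
  show "st (rinv (\<epsilon>) R x)" if "st x"
    unfolding inv
  proof (rule standard_unique[where P = "\<lambda>y. y \<epsilon> Re \<and> x \<otimes> y = \<one>"])
    show "standard_definable (\<lambda>e. e 0 \<epsilon> Re \<and> x \<otimes> e 0 = \<one>)"
      by (intro definable_set_intros) (use that in auto)
  qed (use y uniq in blast)+
qed

lemma rinv_less:
  assumes "x \<epsilon> Re" "y \<epsilon> Re" "\<zero> \<prec> x" "\<zero> \<prec> y" "rinv (\<epsilon>) R x \<prec> y"
  shows "rinv (\<epsilon>) R y \<prec> x"
proof (rule ccontr)
  assume "\<not> rinv (\<epsilon>) R y \<prec> x"
  note x = rinv[OF assms(1,3)] and y = rinv[OF assms(2,4)]
  have "x \<preceq> rinv (\<epsilon>) R y" using \<open>\<not> _\<close> assms y by (simp add: not_less)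
  then have "x \<otimes> y \<preceq> rinv (\<epsilon>) R y \<otimes> y" using mul_right_mono assms y less_le by simp
  then have "x \<otimes> y \<preceq> \<one>" using mul_comm[of y "rinv (\<epsilon>) R y"] assms y by simp
  moreover have "rinv (\<epsilon>) R x \<otimes> x \<prec> y \<otimes> x" using mul_right_less assms x by simp
  then have "\<one> \<prec> x \<otimes> y" using mul_comm[of "rinv (\<epsilon>) R x" x] mul_comm[of y x] assms x by simp
  ultimately show False using not_less[of \<one> "x \<otimes> y"] assms by simp
qed

lemma rdist_less_iff:
  assumes "r \<epsilon> Re" "s \<epsilon> Re" "e \<epsilon> Re"
  shows "rless (\<epsilon>) R (rdist (\<epsilon>) R r s) e \<longleftrightarrow> r \<prec> s \<oplus> e \<and> s \<prec> r \<oplus> e"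
proof -
  let ?n = "rneg (\<epsilon>) R s"
  define u where "u = r \<oplus> ?n"
  have u: "u \<epsilon> Re" using assms rneg[of s] by (simp add: u_def)
  have us: "u \<oplus> s = r"
    using add_assoc[of r ?n s] add_comm[of ?n s] assms rneg[of s] by (simp add: u_def add_simps)
  have d: "rdist (\<epsilon>) R r s = rabs (\<epsilon>) R u"
    using assms rneg[of s] by (simp add: rdist_def radd_eq u_def)
  show ?thesis
  proof (cases "\<zero> \<preceq> u")
    case True
    have "u \<prec> e \<longleftrightarrow> r \<prec> s \<oplus> e"
      using add_right_less_iff[of u e s] us add_comm[of e s] u assms by simp
    moreover have "s \<prec> r \<oplus> e" if "u \<prec> e"
    proof -
      have "\<zero> \<prec> e" using le_less_trans[OF _ u assms(3) True that] by simp
      moreover have "s \<preceq> r" using add_right_mono[of \<zero> u s] True us u assms by (simp add: add_simps)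
      ultimately show ?thesis
        using le_less_trans[of s r "r \<oplus> e"] less_add_pos[of r e] assms by simp
    qed
    ultimately show ?thesis using True by (auto simp: d rabs_def)
  next
    case False
    let ?v = "rneg (\<epsilon>) R u"
    note v = rneg[OF u]
    have u0: "u \<prec> \<zero>" using False u not_le by simp
    have vr: "?v \<oplus> r = s"
      using us[symmetric] add_assoc[of ?v u s] add_comm[of ?v u] v u assms by (simp add: add_simps)
    have "?v \<prec> e \<longleftrightarrow> s \<prec> r \<oplus> e"
      using add_right_less_iff[of ?v e r] vr add_comm[of e r] v assms by simp
    moreover have "r \<prec> s \<oplus> e" if "?v \<prec> e"
    proof -
      have "\<zero> \<prec> ?v" using add_right_less[of u \<zero> ?v] u0 u v by (simp add: add_simps)
      then have "\<zero> \<prec> e" using less_trans[of \<zero> ?v e] that v assms by simp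
      moreover have "r \<prec> s" using add_right_less[of u \<zero> s] u0 us u assms by (simp add: add_simps)
      ultimately show ?thesis
        using less_trans[of r s "s \<oplus> e"] less_add_pos[of s e] assms by simp
    qed
    ultimately show ?thesis using False by (auto simp: d rabs_def)
  qed
qed

section \<open>Shadows\<close>

text \<open>
  Characterizing the shadow by its position relative to the standard reals avoids absolute values
  and reciprocals.
\<close>

definition is_shadow :: "'a \<Rightarrow> 'a \<Rightarrow> bool" where
  "is_shadow r s \<longleftrightarrow> st s \<and> s \<epsilon> Re \<and>
     (\<forall>t. st t \<and> t \<epsilon> Re \<longrightarrow> (t \<prec> s \<longrightarrow> t \<prec> r) \<and> (s \<prec> t \<longrightarrow> r \<prec> t))"

lemma definable_is_shadow:
  assumes "definable_term K True s" "definable_term K True t"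
  shows "definable K True (\<lambda>e. is_shadow (s e) (t e))"
  by (rule definable_subst2[OF _ assms], unfold is_shadow_def) (intro definable_real_intros, auto)

lemma st_add: "st x \<Longrightarrow> st y \<Longrightarrow> st (x \<oplus> y)"
  by (simp add: st_ap st_ord_pair)

lemma st_dense:
  assumes "st x" "st y" "x \<epsilon> Re" "y \<epsilon> Re" "x \<prec> y"
  shows "\<exists>z. st z \<and> z \<epsilon> Re \<and> x \<prec> z \<and> z \<prec> y"
proof -
  obtain z where "z \<epsilon> Re \<and> x \<prec> z \<and> z \<prec> y" using dense assms by blast
  then show ?thesis
    by (rule transfer_ex[where P = "\<lambda>z. z \<epsilon> Re \<and> x \<prec> z \<and> z \<prec> y", rotated])
      (intro definable_real_intros, use assms in auto)
qed

lemma st_split_sum: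
  assumes "st x" "st y" "st m" "x \<epsilon> Re" "y \<epsilon> Re" "m \<epsilon> Re" "x \<oplus> y \<prec> m"
  shows "\<exists>s t. st s \<and> st t \<and> s \<epsilon> Re \<and> t \<epsilon> Re \<and> x \<prec> s \<and> y \<prec> t \<and> s \<oplus> t = m"
proof -
  let ?P = "\<lambda>s t. s \<epsilon> Re \<and> t \<epsilon> Re \<and> x \<prec> s \<and> y \<prec> t \<and> s \<oplus> t = m"
  obtain s where "\<exists>t. ?P s t" using split_sum assms by blast
  then have "\<exists>s. st s \<and> (\<exists>t. ?P s t)"
    by (rule transfer_ex[where P = "\<lambda>s. \<exists>t. ?P s t", rotated])
      (intro definable_real_intros, use assms in auto)
  then obtain s t where s: "st s" "?P s t" by blast
  have "\<exists>t. st t \<and> ?P s t"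
    by (rule transfer_ex[where P = "?P s", OF _ s(2)])
      (intro definable_real_intros, use assms s in auto)
  with s(1) show ?thesis by blast
qed

lemma is_shadow_self: "st r \<Longrightarrow> r \<epsilon> Re \<Longrightarrow> is_shadow r r"
  by (simp add: is_shadow_def)

lemma is_shadow_unique:
  assumes "r \<epsilon> Re" "is_shadow r s" "is_shadow r s'"
  shows "s = s'"
proof -
  have *: False if a: "is_shadow r a" "is_shadow r b" "a \<prec> b" for a b
  proof -
    obtain z where "st z" "z \<epsilon> Re" "a \<prec> z" "z \<prec> b"
      using st_dense[of a b] a unfolding is_shadow_def by blast
    with a have "z \<prec> r" "r \<prec> z" by (simp_all add: is_shadow_def)
    with less_trans[of z r z] \<open>z \<epsilon> Re\<close> assms(1) show False by simp
  qed
  from *[of s s'] *[of s' s] assms not_less[of s s'] not_less[of s' s] le_antisym[of s s']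
  show ?thesis by (auto simp: is_shadow_def)
qed

text \<open>By the Archimedean property every standard e > 0 exceeds 1/n for some standard n, and
  1/n is itself standard; so closeness may be tested with all standard e > 0. A standard t different
  from s lies at such a distance e from s, which links this to the position of r relative to
  t.\<close>

lemma infclose_iff:
  assumes "r \<epsilon> Re" "s \<epsilon> Re" "st s"
  shows "infclose (\<epsilon>) st R r s \<longleftrightarrow> is_shadow r s"
proof
  assume inf: "infclose (\<epsilon>) st R r s"
  have close: "r \<prec> s \<oplus> e \<and> s \<prec> r \<oplus> e" if e: "st e" "e \<epsilon> Re" "\<zero> \<prec> e" for e
  proof -
    note i = rinv[OF e(2,3)]
    obtain n where n: "st n" "rnat (\<epsilon>) R n" "rinv (\<epsilon>) R e \<prec> n"
      using standard_archimedean[OF i(1) i(4)[OF e(1)]] by blast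
    have nr: "n \<epsilon> Re" "\<zero> \<prec> n"
      using less_trans[OF _ i(1) _ i(3) n(3)] rnat_real[OF n(2)] by auto
    then have "n \<noteq> \<zero>" by auto
    with inf n have d: "rless (\<epsilon>) R (rdist (\<epsilon>) R r s) (rinv (\<epsilon>) R n)"
      unfolding infclose_def by blast
    note j = rinv[OF nr]
    have lt: "rinv (\<epsilon>) R n \<prec> e" using rinv_less[OF e(2) nr(1) e(3) nr(2) n(3)] .
    from d have "r \<prec> s \<oplus> rinv (\<epsilon>) R n" "s \<prec> r \<oplus> rinv (\<epsilon>) R n"
      using rdist_less_iff[OF assms(1,2) j(1)] by auto
    then show ?thesis
      using less_trans[of r "s \<oplus> rinv (\<epsilon>) R n" "s \<oplus> e"] less_trans[of s "r \<oplus> rinv (\<epsilon>) R n" "r \<oplus> e"]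
        add_left_less[OF j(1) e(2) _ lt] assms e j by simp
  qed
  have "t \<prec> r" if t: "st t" "t \<epsilon> Re" "t \<prec> s" for t
  proof -
    obtain c where c: "st c" "c \<epsilon> Re" "\<zero> \<prec> c" "s = t \<oplus> c"
    proof -
      obtain c0 where "c0 \<epsilon> Re \<and> \<zero> \<prec> c0 \<and> s = c0 \<oplus> t" using ex_diff_pos t assms by blast
      then have "\<exists>c. st c \<and> c \<epsilon> Re \<and> \<zero> \<prec> c \<and> s = c \<oplus> t"
        by (rule transfer_ex[where P = "\<lambda>c. c \<epsilon> Re \<and> \<zero> \<prec> c \<and> s = c \<oplus> t", rotated])
          (intro definable_real_intros, use t assms in auto)
      with that add_comm t show thesis by metis
    qed
    from close[OF c(1-3)] c show ?thesis using add_right_less_iff[of t r c] t assms by simp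
  qed
  moreover have "r \<prec> t" if t: "st t" "t \<epsilon> Re" "s \<prec> t" for t
  proof -
    obtain c where c: "st c" "c \<epsilon> Re" "\<zero> \<prec> c" "t = s \<oplus> c"
    proof -
      obtain c0 where "c0 \<epsilon> Re \<and> \<zero> \<prec> c0 \<and> t = c0 \<oplus> s" using ex_diff_pos t assms by blast
      then have "\<exists>c. st c \<and> c \<epsilon> Re \<and> \<zero> \<prec> c \<and> t = c \<oplus> s"
        by (rule transfer_ex[where P = "\<lambda>c. c \<epsilon> Re \<and> \<zero> \<prec> c \<and> t = c \<oplus> s", rotated])
          (intro definable_real_intros, use t assms in auto)
      with that add_comm assms show thesis by metis
    qed
    from close[OF c(1-3)] c show ?thesis by simp
  qed
  ultimately show "is_shadow r s" using assms by (simp add: is_shadow_def)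
next
  assume sh: "is_shadow r s"
  have "rless (\<epsilon>) R (rdist (\<epsilon>) R r s) (rinv (\<epsilon>) R n)"
    if n: "st n" "rnat (\<epsilon>) R n" "n \<noteq> \<zero>" for n
  proof -
    note i = rinv[OF rnat_real[OF n(2)] rnat_pos[OF n(2,3)]]
    let ?i = "rinv (\<epsilon>) R n"
    have "s \<prec> s \<oplus> ?i" using less_add_pos assms i by simp
    then have 1: "r \<prec> s \<oplus> ?i" using sh assms i n st_add by (simp add: is_shadow_def)
    obtain m where m: "m \<epsilon> Re" "s = m \<oplus> ?i" using ex_diff[OF i(1) assms(2)] by blast
    have "st m"
      by (rule standard_unique[where P = "\<lambda>m. m \<epsilon> Re \<and> s = m \<oplus> ?i"])
        (intro definable_set_intros, use m i(4)[OF n(1)] assms(3) in simp_all, metis add_right_cancel m(1) i(1))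
    moreover have "m \<prec> s" using less_add_pos[of m ?i] m i by simp
    ultimately have "m \<prec> r" using sh m by (simp add: is_shadow_def)
    then have "s \<prec> r \<oplus> ?i" using add_right_less[of m r ?i] m i assms by simp
    with 1 show ?thesis using rdist_less_iff[OF assms(1,2) i(1)] by simp
  qed
  with assms show "infclose (\<epsilon>) st R r s" by (simp add: infclose_def is_real_def)
qed

lemma shadow_eq:
  assumes "r \<epsilon> Re" "is_shadow r s"
  shows "shadow (\<epsilon>) st R r = s"
  unfolding shadow_def
proof (rule the_equality)
  show "st s \<and> is_real (\<epsilon>) R s \<and> infclose (\<epsilon>) st R r s"
    using assms infclose_iff by (simp add: is_shadow_def is_real_def)
  fix s' assume "st s' \<and> is_real (\<epsilon>) R s' \<and> infclose (\<epsilon>) st R r s'"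
  then show "s' = s"
    using assms infclose_iff[of r s'] is_shadow_unique[of r s' s] by (simp add: is_real_def)
qed

lemma limited_iff:
  assumes "r \<epsilon> Re" "\<zero> \<preceq> r"
  shows "limited (\<epsilon>) st R r \<longleftrightarrow> (\<exists>a. st a \<and> a \<epsilon> Re \<and> r \<prec> a)"
proof
  assume "limited (\<epsilon>) st R r"
  then show "\<exists>a. st a \<and> a \<epsilon> Re \<and> r \<prec> a"
    using assms rnat_real by (auto simp: limited_def rabs_def)
next
  assume "\<exists>a. st a \<and> a \<epsilon> Re \<and> r \<prec> a"
  then obtain a where a: "st a" "a \<epsilon> Re" "r \<prec> a" by blast
  obtain n where n: "st n" "rnat (\<epsilon>) R n" "a \<prec> n" using standard_archimedean a by blast
  then have "r \<prec> n" using less_trans[of r a n] a assms rnat_real by simp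
  with n assms show "limited (\<epsilon>) st R r" by (auto simp: limited_def rabs_def is_real_def)
qed

text \<open>The shadow is the supremum of the standard set \<open>S\<close> whose standard elements
  are the standard reals below r. The internal cut {t | t < r} would have r itself as its supremum;
  Standardization is what makes the supremum standard.\<close>

lemma ex_is_shadow:
  assumes "r \<epsilon> Re" "\<zero> \<preceq> r" "st b" "b \<epsilon> Re" "r \<prec> b"
  shows "\<exists>s. is_shadow r s"
proof -
  have "external (\<lambda>e. e 0 \<prec> r)" by (intro definable_real_intros) auto
  from standardization[OF this, of Re "\<lambda>t. t \<prec> r"]
  obtain S where S: "st S" "\<And>t. st t \<Longrightarrow> t \<epsilon> S \<longleftrightarrow> t \<epsilon> Re \<and> t \<prec> r" by blast
  have sub: "subset_of (\<epsilon>) S Re"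
    by (rule subset_ofI, rule transfer_subset[OF S(1)]) (use S in auto)
  \<comment> \<open>The real -1 witnesses that \<open>S\<close> is nonempty. Zero would not do,
    since r may be 0.\<close>
  obtain n where n: "n \<epsilon> Re" "\<zero> = n \<oplus> \<one>" using ex_diff[of \<one> \<zero>] by auto
  have "st n"
    by (rule standard_unique[where P = "\<lambda>n. n \<epsilon> Re \<and> \<zero> = n \<oplus> \<one>"])
      (intro definable_set_intros, use n(1) in \<open>simp_all add: n(2)[symmetric]\<close>, metis add_right_cancel n one_real)
  moreover have "n \<prec> \<zero>" using less_add_pos[of n \<one>] zero_less_one n by simp
  then have "n \<prec> r" using less_le_trans[of n \<zero> r] n assms by simp
  ultimately have nS: "n \<epsilon> S" using S n by blast
  \<comment> \<open>For nonstandard elements of \<open>S\<close>, membership says nothing directly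
    about r. Transfer with the standard bound \<open>t\<close> in place of r covers them.\<close>
  have ub: "x \<preceq> t" if t: "st t" "t \<epsilon> Re" "r \<preceq> t" and x: "x \<epsilon> S" for x t
  proof -
    have "x \<epsilon> S \<longrightarrow> x \<preceq> t" for x
    proof (rule transfer[where P = "\<lambda>x. x \<epsilon> S \<longrightarrow> x \<preceq> t"])
      show "standard_definable (\<lambda>e. e 0 \<epsilon> S \<longrightarrow> e 0 \<preceq> t)"
        by (intro definable_real_intros) (use S t in auto)
      show "x \<epsilon> S \<longrightarrow> x \<preceq> t" if "st x" for x
        using S(2)[OF that] less_le_trans[of x r t] less_le t assms by blast
    qed
    with x show ?thesis by blast
  qed
  let ?P = "\<lambda>s. s \<epsilon> Re \<and> (\<forall>x. x \<epsilon> S \<longrightarrow> x \<preceq> s) \<and> (\<forall>b. b \<epsilon> Re \<and> (\<forall>x. x \<epsilon> S \<longrightarrow> x \<preceq> b) \<longrightarrow> s \<preceq> b)"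
  obtain s0 where "?P s0"
    using ex_sup[OF sub nS assms(4) ub] assms less_le by blast
  then have "\<exists>s. st s \<and> ?P s"
    by (rule transfer_ex[where P = ?P, rotated]) (intro definable_real_intros, use S in auto)
  then obtain s where s: "st s" "?P s" by blast
  have "t \<prec> r" if t: "st t" "t \<epsilon> Re" "t \<prec> s" for t
  proof (rule ccontr)
    assume "\<not> t \<prec> r"
    then have "r \<preceq> t" using t assms not_less by simp
    from ub[OF t(1,2) this] s(2) t(2) have "s \<preceq> t" by blast
    with t s not_less show False by blast
  qed
  moreover have "r \<prec> t" if t: "st t" "t \<epsilon> Re" "s \<prec> t" for t
  proof -
    obtain z where z: "st z" "z \<epsilon> Re" "s \<prec> z" "z \<prec> t" using st_dense s t by blast
    have "\<not> z \<prec> r" using s z S(2)[OF z(1)] not_less by blast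
    then have "r \<preceq> z" using not_less z assms by simp
    with le_less_trans[of r z t] z t assms show ?thesis by simp
  qed
  ultimately show ?thesis using s unfolding is_shadow_def by blast
qed

lemma is_shadow_nonneg:
  assumes "r \<epsilon> Re" "\<zero> \<preceq> r" "is_shadow r s"
  shows "\<zero> \<preceq> s"
  using assms not_less[of s \<zero>] not_less[of r \<zero>] unfolding is_shadow_def by auto

text \<open>If s1 + s2 < s, a standard m strictly between them splits into standard reals t1 + t2
  with s1 < t1 and s2 < t2. Then p < t1, q < t2 and m < r, against r \<le> p + q.\<close>

lemma is_shadow_triangle:
  assumes "r \<epsilon> Re" "p \<epsilon> Re" "q \<epsilon> Re" "r \<preceq> p \<oplus> q"
    and sh: "is_shadow r s" "is_shadow p s1" "is_shadow q s2"
  shows "s \<preceq> s1 \<oplus> s2"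
proof (rule ccontr)
  assume "\<not> s \<preceq> s1 \<oplus> s2"
  have s: "s \<epsilon> Re" "s1 \<epsilon> Re" "s2 \<epsilon> Re" "st s" "st s1" "st s2"
    using sh by (simp_all add: is_shadow_def)
  with \<open>\<not> _\<close> have "s1 \<oplus> s2 \<prec> s" using not_le by simp
  then obtain m where m: "st m" "m \<epsilon> Re" "s1 \<oplus> s2 \<prec> m" "m \<prec> s"
    using st_dense[of "s1 \<oplus> s2" s] s st_add by auto
  obtain t1 t2 where t: "st t1" "st t2" "t1 \<epsilon> Re" "t2 \<epsilon> Re" "s1 \<prec> t1" "s2 \<prec> t2" "t1 \<oplus> t2 = m"
    using st_split_sum[OF s(5,6) m(1) s(2,3) m(2,3)] by blast
  have "m \<prec> r" "p \<prec> t1" "q \<prec> t2" using sh m t by (simp_all add: is_shadow_def)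
  then have "p \<oplus> q \<prec> m" using add_less_mono[of p q t1 t2] t assms by simp
  with le_less_trans[of r "p \<oplus> q" m] less_trans[of r m r] \<open>m \<prec> r\<close> m assms show False by simp
qed

lemma is_shadow_less: "is_shadow r s \<Longrightarrow> s \<prec> t \<Longrightarrow> st t \<Longrightarrow> t \<epsilon> Re \<Longrightarrow> r \<prec> t"
  by (simp add: is_shadow_def)

lemma is_shadow_le:
  assumes "is_shadow r s" "r \<epsilon> Re" "r \<prec> t" "st t" "t \<epsilon> Re"
  shows "s \<preceq> t"
  using assms not_less[of t s] less_trans[of t r t] unfolding is_shadow_def by auto

section \<open>Uniform spaces\<close>

lemma pseudo_metric_iff:
  "pseudo_metric (\<epsilon>) R X d \<longleftrightarrow> is_fun (\<epsilon>) d (cprod (\<epsilon>) X X) Re \<and>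
     (\<forall>x y z. x \<epsilon> X \<and> y \<epsilon> X \<and> z \<epsilon> X \<longrightarrow>
        \<zero> \<preceq> ap2 d x y \<and> ap2 d x x = \<zero> \<and> ap2 d x y = ap2 d y x \<and>
        ap2 d x z \<preceq> ap2 d x y \<oplus> ap2 d y z)"
proof (cases "is_fun (\<epsilon>) d (cprod (\<epsilon>) X X) Re")
  case True
  have "app2 (\<epsilon>) d x y = ap2 d x y" "ap2 d x y \<epsilon> Re" if "x \<epsilon> X" "y \<epsilon> X" for x y
    using app2_eq_ap[OF True] ap_mem[OF True] that by simp_all
  then show ?thesis
    using True unfolding pseudo_metric_def by (simp add: radd_eq cong: imp_cong)
qed (simp add: pseudo_metric_def)

lemma definable_pseudo_metric:
  assumes "definable_term K b s" "definable_term K b t"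
  shows "definable K b (\<lambda>e. pseudo_metric (\<epsilon>) R (s e) (t e))"
  by (rule definable_subst2[OF _ assms], unfold pseudo_metric_iff)
    (intro definable_real_intros, auto)

context
  fixes X d
  assumes pm: "pseudo_metric (\<epsilon>) R X d"
begin

lemma pm_fun: "is_fun (\<epsilon>) d (cprod (\<epsilon>) X X) Re"
  using pm by (simp add: pseudo_metric_iff)

lemma pm_app2: "x \<epsilon> X \<Longrightarrow> y \<epsilon> X \<Longrightarrow> app2 (\<epsilon>) d x y = ap2 d x y"
  by (rule app2_eq_ap[OF pm_fun])

lemma pm_real: "x \<epsilon> X \<Longrightarrow> y \<epsilon> X \<Longrightarrow> ap2 d x y \<epsilon> Re"
  using ap_mem[OF pm_fun] by simp

lemma pm_nonneg: "x \<epsilon> X \<Longrightarrow> y \<epsilon> X \<Longrightarrow> \<zero> \<preceq> ap2 d x y"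
  and pm_self: "x \<epsilon> X \<Longrightarrow> ap2 d x x = \<zero>"
  and pm_sym: "x \<epsilon> X \<Longrightarrow> y \<epsilon> X \<Longrightarrow> ap2 d x y = ap2 d y x"
  and pm_triangle: "x \<epsilon> X \<Longrightarrow> y \<epsilon> X \<Longrightarrow> z \<epsilon> X \<Longrightarrow> ap2 d x z \<preceq> ap2 d x y \<oplus> ap2 d y z"
  using pm unfolding pseudo_metric_iff by blast+

lemma pm_pos: "x \<epsilon> X \<Longrightarrow> y \<epsilon> X \<Longrightarrow> ap2 d x y \<noteq> \<zero> \<Longrightarrow> \<zero> \<prec> ap2 d x y"
  using pm_nonneg by (auto simp: rless_def)

lemma pm_triangle_less:
  assumes "x \<epsilon> X" "y \<epsilon> X" "z \<epsilon> X" "s \<epsilon> Re" "t \<epsilon> Re" "ap2 d x y \<prec> s" "ap2 d y z \<prec> t"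
  shows "ap2 d x z \<prec> s \<oplus> t"
  using le_less_trans[OF _ _ _ pm_triangle[OF assms(1-3)] add_less_mono[OF _ _ assms(4,5)]]
    assms pm_real by simp

lemma pm_zero_eq:
  assumes "x \<epsilon> X" "y \<epsilon> X" "z \<epsilon> X" "ap2 d x y = \<zero>"
  shows "ap2 d x z = ap2 d y z"
proof -
  have "ap2 d y x = \<zero>" using pm_sym[of x y] assms by simp
  then have "ap2 d x z \<preceq> ap2 d y z" "ap2 d y z \<preceq> ap2 d x z"
    using pm_triangle[of x y z] pm_triangle[of y x z] assms pm_real by (simp_all add: add_simps)
  then show ?thesis using le_antisym pm_real assms by simp
qed

end

context
  fixes X G
  assumes uniform: "is_uniform_space (\<epsilon>) R X G"
begin

lemma uniform_pm: "d \<epsilon> G \<Longrightarrow> pseudo_metric (\<epsilon>) R X d"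
  using uniform by (simp add: is_uniform_space_def)

lemma ball_ex: "\<exists>N. \<forall>y. y \<epsilon> N \<longleftrightarrow> y \<epsilon> X \<and> ap2 d x y \<prec> r"
  by (rule separation) (intro definable_real_intros, auto)

lemma entourage_ball:
  assumes "d \<epsilon> G" "r \<epsilon> Re" "\<zero> \<prec> r"
  shows "\<exists>V. entourage (\<epsilon>) R X G V \<and> (\<forall>x y. pr x y \<epsilon> V \<longleftrightarrow> x \<epsilon> X \<and> y \<epsilon> X \<and> ap2 d x y \<prec> r)"
proof -
  have "\<exists>V. \<forall>p. p \<epsilon> V \<longleftrightarrow> p \<epsilon> cprod (\<epsilon>) X X \<and> ap d p \<prec> r"
    by (rule separation) (intro definable_real_intros, auto)
  then obtain V where V: "\<And>p. p \<epsilon> V \<longleftrightarrow> p \<epsilon> cprod (\<epsilon>) X X \<and> ap d p \<prec> r" by blast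
  have "entourage (\<epsilon>) R X G V"
    unfolding entourage_def is_real_def
  proof (intro conjI exI allI impI)
    show "subset_of (\<epsilon>) (unord_pair (\<epsilon>) d d) G" using assms by (simp add: subset_of_def)
    fix x y assume "x \<epsilon> X \<and> y \<epsilon> X \<and>
      (\<forall>da. da \<epsilon> unord_pair (\<epsilon>) d d \<longrightarrow> rless (\<epsilon>) R (app2 (\<epsilon>) da x y) r)"
    then show "pr x y \<epsilon> V" using pm_app2[OF uniform_pm[OF assms(1)], of x y] by (simp add: V)
  qed (use assms V finite_singleton in \<open>auto simp: subset_of_def\<close>)
  then show ?thesis using V by auto
qed

lemma nbhd_ball:
  assumes "d \<epsilon> G" "r \<epsilon> Re" "\<zero> \<prec> r" "x \<epsilon> X" "\<forall>y. y \<epsilon> N \<longleftrightarrow> y \<epsilon> X \<and> ap2 d x y \<prec> r"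
  shows "nbhd (\<epsilon>) R X G x N"
  using entourage_ball[OF assms(1-3)] assms(4,5) unfolding nbhd_def by metis

lemma hausdorffI:
  assumes "\<And>x y. x \<epsilon> X \<Longrightarrow> y \<epsilon> X \<Longrightarrow> x \<noteq> y \<Longrightarrow> \<exists>d. d \<epsilon> G \<and> ap2 d x y \<noteq> \<zero>"
  shows "is_hausdorff (\<epsilon>) R X G"
  unfolding is_hausdorff_def
proof (intro allI impI)
  fix x y assume xy: "x \<epsilon> X \<and> y \<epsilon> X \<and> x \<noteq> y"
  then obtain d where d: "d \<epsilon> G" "ap2 d x y \<noteq> \<zero>" using assms by blast
  note pm = uniform_pm[OF d(1)]
  let ?r = "ap2 d x y"
  have r: "?r \<epsilon> Re" "\<zero> \<prec> ?r" using pm_real[OF pm] pm_pos[OF pm] xy d by auto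
  obtain h where h: "h \<epsilon> Re" "\<zero> \<prec> h" "h \<oplus> h = ?r" using ex_half[OF r] by blast
  obtain N where N: "\<forall>z. z \<epsilon> N \<longleftrightarrow> z \<epsilon> X \<and> ap2 d x z \<prec> h" using ball_ex by blast
  obtain N' where N': "\<forall>z. z \<epsilon> N' \<longleftrightarrow> z \<epsilon> X \<and> ap2 d y z \<prec> h" using ball_ex by blast
  have "\<not> (z \<epsilon> N \<and> z \<epsilon> N')" for z
    using pm_triangle_less[OF pm, of x z y h h] pm_sym[OF pm, of y z] N N' xy h by auto
  then show "\<exists>N N'. nbhd (\<epsilon>) R X G x N \<and> nbhd (\<epsilon>) R X G y N' \<and> \<not> (\<exists>z. z \<epsilon> N \<and> z \<epsilon> N')"
    using nbhd_ball[OF d(1) h(1,2) _ N] nbhd_ball[OF d(1) h(1,2) _ N'] xy by blast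
qed

text \<open>If all distances from x to y vanish, then y lies in every neighbourhood of x, as it does
  in each of its own, so no two such neighbourhoods are disjoint.\<close>

lemma hausdorffD:
  assumes "is_hausdorff (\<epsilon>) R X G" "x \<epsilon> X" "y \<epsilon> X" "x \<noteq> y"
  shows "\<exists>d. d \<epsilon> G \<and> ap2 d x y \<noteq> \<zero>"
proof (rule ccontr)
  assume no: "\<not> ?thesis"
  obtain N N' where N: "nbhd (\<epsilon>) R X G x N" "nbhd (\<epsilon>) R X G y N'" "\<not> (\<exists>z. z \<epsilon> N \<and> z \<epsilon> N')"
    using assms unfolding is_hausdorff_def by blast
  have "y \<epsilon> N"
    using N(1) no assms(2,3) pm_app2[OF uniform_pm]
    unfolding nbhd_def entourage_def subset_of_def by metis
  moreover have "y \<epsilon> N'"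
    using N(2) assms(3) pm_app2[OF uniform_pm] pm_self[OF uniform_pm]
    unfolding nbhd_def entourage_def subset_of_def by metis
  ultimately show False using N(3) by blast
qed

lemma cauchy_filter_small:
  assumes "cauchy_filter (\<epsilon>) R X G F" "d \<epsilon> G" "r \<epsilon> Re" "\<zero> \<prec> r"
  shows "\<exists>A. A \<epsilon> F \<and> (\<forall>x y. x \<epsilon> A \<and> y \<epsilon> A \<longrightarrow> ap2 d x y \<prec> r)"
proof -
  obtain V where V: "entourage (\<epsilon>) R X G V"
    "\<And>x y. pr x y \<epsilon> V \<longleftrightarrow> x \<epsilon> X \<and> y \<epsilon> X \<and> ap2 d x y \<prec> r"
    using entourage_ball[OF assms(2-4)] by blast
  then obtain A where "A \<epsilon> F" "subset_of (\<epsilon>) (cprod (\<epsilon>) A A) V"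
    using assms(1) unfolding cauchy_filter_def by blast
  then have "x \<epsilon> A \<and> y \<epsilon> A \<longrightarrow> ap2 d x y \<prec> r" for x y
    using subset_ofD[of "cprod (\<epsilon>) A A" V "pr x y"] V(2) by simp
  with \<open>A \<epsilon> F\<close> show ?thesis by blast
qed

text \<open>The set of pseudo-metrics behind an entourage is finite only in the sense of the
  structure, so one member of the filter that is good for all of them comes from
  \<open>finite_common_refinement\<close>. Together with \<open>cauchy_filter_small\<close> this
  reduces completeness to conditions on one pseudo-metric and one radius at a time, which are easy
  to transfer.\<close>

lemma converges_toI:
  assumes F: "is_filter (\<epsilon>) X F" and x: "x \<epsilon> X"
    and small: "\<And>d r. d \<epsilon> G \<Longrightarrow> r \<epsilon> Re \<Longrightarrow> \<zero> \<prec> r \<Longrightarrow>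
      \<exists>A. A \<epsilon> F \<and> (\<forall>y. y \<epsilon> A \<longrightarrow> ap2 d x y \<prec> r)"
  shows "converges_to (\<epsilon>) R X G F x"
  unfolding converges_to_def
proof (intro conjI allI impI x)
  fix N assume "nbhd (\<epsilon>) R X G x N"
  then obtain V a r where V: "\<forall>y. y \<epsilon> N \<longleftrightarrow> pr x y \<epsilon> V" "subset_of (\<epsilon>) V (cprod (\<epsilon>) X X)"
    and a: "subset_of (\<epsilon>) a G" "is_finite (\<epsilon>) a" and r: "r \<epsilon> Re" "\<zero> \<prec> r"
    and ball: "\<And>x y. x \<epsilon> X \<and> y \<epsilon> X \<and> (\<forall>d. d \<epsilon> a \<longrightarrow> rless (\<epsilon>) R (app2 (\<epsilon>) d x y) r) \<Longrightarrow> pr x y \<epsilon> V"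
    unfolding nbhd_def entourage_def is_real_def by blast
  have "\<exists>C. C \<epsilon> F \<and> (\<forall>d. d \<epsilon> a \<longrightarrow> (\<forall>y. y \<epsilon> C \<longrightarrow> ap2 d x y \<prec> r))"
  proof (rule finite_common_refinement[OF a(2)])
    show "internal (\<lambda>e. \<forall>y. y \<epsilon> e 1 \<longrightarrow> ap2 (e 0) x y \<prec> r)"
      by (intro definable_real_intros) auto
    show "\<exists>C. C \<epsilon> F" "\<And>C C'. C \<epsilon> F \<Longrightarrow> C' \<epsilon> F \<Longrightarrow> inter_set (\<epsilon>) C C' \<epsilon> F"
      using F unfolding is_filter_def by blast+
    show "\<exists>C. C \<epsilon> F \<and> (\<forall>y. y \<epsilon> C \<longrightarrow> ap2 d x y \<prec> r)" if "d \<epsilon> a" for d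
      using small r subset_ofD[OF a(1) that] by blast
  qed (auto dest: subset_ofD)
  then obtain C where C: "C \<epsilon> F" "\<And>d y. d \<epsilon> a \<Longrightarrow> y \<epsilon> C \<Longrightarrow> ap2 d x y \<prec> r" by blast
  have CX: "y \<epsilon> X" if "y \<epsilon> C" for y using F C(1) that unfolding is_filter_def subset_of_def by blast
  have "subset_of (\<epsilon>) C N"
  proof (rule subset_ofI)
    fix y assume y: "y \<epsilon> C"
    have "rless (\<epsilon>) R (app2 (\<epsilon>) d x y) r" if "d \<epsilon> a" for d
      using pm_app2[OF uniform_pm[OF subset_ofD[OF a(1) that]] x CX[OF y]] C(2)[OF that y] by simp
    with ball x CX[OF y] V(1) show "y \<epsilon> N" by blast
  qed
  moreover have "subset_of (\<epsilon>) N X"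
    using V by (auto simp: subset_of_def)
  ultimately show "N \<epsilon> F" using F C(1) unfolding is_filter_def by blast
qed

end

text \<open>Start at 1 and halve. The terms are indexed by \<omega> because this is the set
  contained in the bound for Idealization; the natural numbers of the field need not be the same
  set.\<close>

lemma ex_null_sequence:
  "\<exists>q. st q \<and> is_fun (\<epsilon>) q (omega (\<epsilon>)) Re \<and> (\<forall>n. n \<epsilon> omega (\<epsilon>) \<longrightarrow> \<zero> \<prec> ap q n) \<and>
     (\<forall>r. r \<epsilon> Re \<and> \<zero> \<prec> r \<longrightarrow> (\<exists>n. n \<epsilon> omega (\<epsilon>) \<and> ap q n \<prec> r))"
proof -
  let ?Q = "\<lambda>x y. \<zero> \<prec> x \<longrightarrow> \<zero> \<prec> y \<and> y \<oplus> y = x"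
  have "\<exists>g. is_fun (\<epsilon>) g Re Re \<and> (\<forall>x. x \<epsilon> Re \<longrightarrow> ?Q x (ap g x))"
  proof (rule fun_choice)
    show "internal (\<lambda>e. ?Q (e 0) (e 1))" by (intro definable_real_intros) auto
    show "\<exists>y. y \<epsilon> Re \<and> ?Q x y" if "x \<epsilon> Re" for x using ex_half[OF that] that by blast
  qed
  then obtain g where g: "is_fun (\<epsilon>) g Re Re" "\<And>x. x \<epsilon> Re \<Longrightarrow> ?Q x (ap g x)" by blast
  obtain q where q: "is_fun (\<epsilon>) q (omega (\<epsilon>)) Re" "ap q (empty_set (\<epsilon>)) = \<one>"
    "\<And>n. n \<epsilon> omega (\<epsilon>) \<Longrightarrow> ap q (suc n) = ap g (ap q n)"
    using recursion[OF one_real g(1)] by blast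
  note qr = ap_mem[OF q(1)]
  have pos: "\<zero> \<prec> ap q n" if "n \<epsilon> omega (\<epsilon>)" for n
    using that
  proof (induction rule: omega_induct)
    case definable
    show ?case by (intro definable_real_intros) auto
  next
    case (suc n)
    then show ?case using g(2)[OF qr] q(3) by simp
  qed (simp add: q zero_less_one)
  have dbl: "ap q (suc n) \<oplus> ap q (suc n) = ap q n" if "n \<epsilon> omega (\<epsilon>)" for n
    using g(2)[OF qr[OF that]] pos[OF that] q(3)[OF that] by simp
  have null: "\<exists>n. n \<epsilon> omega (\<epsilon>) \<and> ap q n \<prec> r" if r: "r \<epsilon> Re" "\<zero> \<prec> r" for r
  proof (rule ccontr)
    assume no: "\<not> ?thesis"
    \<comment> \<open>Otherwise the lower bounds of the sequence have a positive supremum s. Each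
      term is twice the next one, so 2s is a lower bound as well, against s < 2s.\<close>
    have "\<exists>S. \<forall>s. s \<epsilon> S \<longleftrightarrow> s \<epsilon> Re \<and> (\<forall>n. n \<epsilon> omega (\<epsilon>) \<longrightarrow> s \<preceq> ap q n)"
      by (rule separation) (intro definable_real_intros, auto)
    then obtain S where S: "\<And>s. s \<epsilon> S \<longleftrightarrow> s \<epsilon> Re \<and> (\<forall>n. n \<epsilon> omega (\<epsilon>) \<longrightarrow> s \<preceq> ap q n)" by blast
    have rS: "r \<epsilon> S" using no r qr not_less by (auto simp: S)
    have "subset_of (\<epsilon>) S Re" by (simp add: S subset_of_def)
    moreover have "x \<preceq> \<one>" if "x \<epsilon> S" for x
      using that S q(2) empty_mem_omega by metis
    ultimately obtain s where s: "s \<epsilon> Re" "\<And>x. x \<epsilon> S \<Longrightarrow> x \<preceq> s"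
      "\<And>b. b \<epsilon> Re \<Longrightarrow> \<forall>x. x \<epsilon> S \<longrightarrow> x \<preceq> b \<Longrightarrow> s \<preceq> b"
      using ex_sup[OF _ rS one_real] by blast
    have low: "s \<preceq> ap q n" if "n \<epsilon> omega (\<epsilon>)" for n
      using s(3)[OF qr[OF that]] S that by blast
    have "s \<oplus> s \<preceq> ap q n" if n: "n \<epsilon> omega (\<epsilon>)" for n
    proof -
      let ?t = "ap q (suc n)"
      have t: "?t \<epsilon> Re" "s \<preceq> ?t" using qr low suc_mem_omega[OF n] by auto
      have "s \<oplus> s \<preceq> ?t \<oplus> s" "?t \<oplus> s \<preceq> ?t \<oplus> ?t"
        using add_right_mono[OF s(1) t(1) s(1) t(2)] add_right_mono[OF s(1) t(1) t(1) t(2)]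
          add_comm[OF s(1) t(1)] by simp_all
      with le_trans[of "s \<oplus> s" "?t \<oplus> s" "?t \<oplus> ?t"] dbl[OF n] qr[OF n] s t show ?thesis by simp
    qed
    then have "s \<oplus> s \<preceq> s" using s by (simp add: S)
    moreover have "\<zero> \<prec> s" using less_le_trans[of \<zero> r s] r s rS by simp
    then have "s \<prec> s \<oplus> s" using less_add_pos s by simp
    ultimately show False using not_less[of s "s \<oplus> s"] s by simp
  qed
  show ?thesis
    by (rule transfer_ex[where P = "\<lambda>q. is_fun (\<epsilon>) q (omega (\<epsilon>)) Re \<and>
        (\<forall>n. n \<epsilon> omega (\<epsilon>) \<longrightarrow> \<zero> \<prec> ap q n) \<and>
        (\<forall>r. r \<epsilon> Re \<and> \<zero> \<prec> r \<longrightarrow> (\<exists>n. n \<epsilon> omega (\<epsilon>) \<and> ap q n \<prec> r))" and x = q])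
      (intro definable_real_intros, use q(1) pos null st_omega in auto)
qed

end

section \<open>The nonstandard hull\<close>

locale hull_setup = BST_reals +
  fixes M \<Delta> I w :: 'a
  assumes st_M [simp]: "st M" and st_\<Delta> [simp]: "st \<Delta>" and st_I [simp]: "st I"
    and w_mem: "w \<epsilon> I"
    and uniform: "is_uniform_space (\<epsilon>) R M \<Delta>"
begin

abbreviation B where "B \<equiv> hull_B (\<epsilon>) st R M \<Delta> I w"
abbreviation E where "E \<equiv> hull_E (\<epsilon>) st R M \<Delta> I w"
abbreviation cls where "cls \<equiv> hull_class (\<epsilon>) st R M \<Delta> I w"
abbreviation hull where "hull \<equiv> hull_M (\<epsilon>) st R M \<Delta> I w"
abbreviation D where "D \<equiv> hull_D (\<epsilon>) st R M \<Delta> I w"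
abbreviation hdist where "hdist \<equiv> hull_dist (\<epsilon>) st R M \<Delta> I w"
abbreviation family where "family \<equiv> hull_family (\<epsilon>) st R M \<Delta> I w"
abbreviation H where "H \<equiv> hull_map (\<epsilon>) st R M \<Delta> I w"

abbreviation dist_w where "dist_w d f g \<equiv> ap2 d (ap f w) (ap g w)"

lemmas pm = uniform_pm[OF uniform]

section \<open>Finite points, the set B and the pseudo-metrics on it\<close>

lemma ap_w: "is_fun (\<epsilon>) f I M \<Longrightarrow> ap f w \<epsilon> M"
  using ap_mem w_mem by blast

lemma finite_point_iff:
  "finite_point (\<epsilon>) st R M \<Delta> x \<longleftrightarrow> x \<epsilon> M \<and>
     (\<forall>d. st d \<and> d \<epsilon> \<Delta> \<longrightarrow> (\<exists>q a. st q \<and> q \<epsilon> M \<and> st a \<and> a \<epsilon> Re \<and> ap2 d x q \<prec> a))"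
proof (cases "x \<epsilon> M")
  case True
  have "limited (\<epsilon>) st R (app2 (\<epsilon>) d x q) \<longleftrightarrow> (\<exists>a. st a \<and> a \<epsilon> Re \<and> ap2 d x q \<prec> a)"
    if "d \<epsilon> \<Delta>" "q \<epsilon> M" for d q
    using limited_iff pm_app2[OF pm] pm_real[OF pm] pm_nonneg[OF pm] that True by simp
  with True show ?thesis unfolding finite_point_def by (metis (no_types))
qed (simp add: finite_point_def)

lemma B_standard [simp]: "st B"
  and mem_B_st: "st f \<Longrightarrow> f \<epsilon> B \<longleftrightarrow> is_fun (\<epsilon>) f I M \<and> finite_point (\<epsilon>) st R M \<Delta> (ap f w)"
proof -
  have "external (\<lambda>e. finite_point (\<epsilon>) st R M \<Delta> (ap (e 0) w))"
    unfolding finite_point_iff by (intro definable_real_intros) auto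
  from standardization[OF this, of "funs (\<epsilon>) I M" "\<lambda>f. finite_point (\<epsilon>) st R M \<Delta> (app (\<epsilon>) f w)"]
  have *: "st B" "\<And>f. st f \<Longrightarrow> f \<epsilon> B \<longleftrightarrow>
      f \<epsilon> funs (\<epsilon>) I M \<and> finite_point (\<epsilon>) st R M \<Delta> (app (\<epsilon>) f w)"
    unfolding hull_B_def by (auto simp: mem_funs app_eq_ap w_mem)
  show "st B" by (rule *)
  show "st f \<Longrightarrow> f \<epsilon> B \<longleftrightarrow> is_fun (\<epsilon>) f I M \<and> finite_point (\<epsilon>) st R M \<Delta> (ap f w)"
    using *(2) app_eq_ap[OF _ w_mem, of f M] by (auto simp: mem_funs)
qed

lemma B_fun: "f \<epsilon> B \<Longrightarrow> is_fun (\<epsilon>) f I M"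
  using transfer_subset[OF B_standard st_funs[OF st_I st_M], of f] mem_B_st by (simp add: mem_funs)

lemma B_ap_w: "f \<epsilon> B \<Longrightarrow> ap f w \<epsilon> M"
  using B_fun ap_w by blast

lemma dist_w_real [simp]: "d \<epsilon> \<Delta> \<Longrightarrow> f \<epsilon> B \<Longrightarrow> g \<epsilon> B \<Longrightarrow> dist_w d f g \<epsilon> Re"
  using pm_real[OF pm] B_ap_w by blast

lemma ex_shadow_dist:
  assumes "st d" "d \<epsilon> \<Delta>" "st f" "st g" "f \<epsilon> B" "g \<epsilon> B"
  shows "\<exists>s. is_shadow (dist_w d f g) s"
proof -
  note p = pm[OF assms(2)]
  note fg = B_ap_w[OF assms(5)] B_ap_w[OF assms(6)]
  obtain q a where q: "st q" "q \<epsilon> M" "st a" "a \<epsilon> Re" "ap2 d (ap f w) q \<prec> a"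
    using mem_B_st assms unfolding finite_point_iff by meson
  obtain q' a' where q': "st q'" "q' \<epsilon> M" "st a'" "a' \<epsilon> Re" "ap2 d (ap g w) q' \<prec> a'"
    using mem_B_st assms unfolding finite_point_iff by meson
  \<comment> \<open>The standard points near f(w) and g(w) may differ, so the bound runs through the
    standard distance between them; adding 1 makes that inequality strict.\<close>
  let ?m = "ap2 d q q' \<oplus> \<one>"
  have m: "ap2 d q q' \<prec> ?m" "?m \<epsilon> Re" "st ?m"
    using less_add_pos[of "ap2 d q q'" \<one>] pm_real[OF p] q q' zero_less_one
    by (simp_all add: st_ap st_ord_pair assms)
  have "ap2 d (ap f w) q' \<prec> a \<oplus> ?m"
    using pm_triangle_less[OF p fg(1) q(2) q'(2) q(4) m(2) q(5) m(1)] .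
  moreover have "ap2 d q' (ap g w) \<prec> a'" using pm_sym[OF p] q' fg by simp
  ultimately have "dist_w d f g \<prec> (a \<oplus> ?m) \<oplus> a'"
    using pm_triangle_less[OF p fg(1) q'(2) fg(2)] q q' m by simp
  then show ?thesis
    by (intro ex_is_shadow[of _ "(a \<oplus> ?m) \<oplus> a'"])
      (use q q' m fg pm_real[OF p] pm_nonneg[OF p] in \<open>simp_all add: st_add\<close>)
qed

text \<open>\<open>hull_D\<close> is a description. The relation "r is the shadow of d(f(w), g(w))"
  is external, and \<open>standardization_fun\<close> provides a standard function with these
  values; standard functions that agree at standard arguments are equal, so the description denotes
  it.\<close>

lemma D_props:
  assumes d: "st d" "d \<epsilon> \<Delta>"
  shows D_standard: "st (D d)" and D_fun: "is_fun (\<epsilon>) (D d) (cprod (\<epsilon>) B B) Re"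
    and D_shadow: "\<And>f g. st f \<Longrightarrow> st g \<Longrightarrow> f \<epsilon> B \<Longrightarrow> g \<epsilon> B \<Longrightarrow> is_shadow (dist_w d f g) (ap2 (D d) f g)"
proof -
  define P where "P p r \<longleftrightarrow> (\<exists>f g. p = pr f g \<and> is_shadow (dist_w d f g) r)" for p r
  have P: "external (\<lambda>e. P (e 0) (e 1))"
    unfolding P_def by (intro definable_real_intros definable_is_shadow) auto
  have "\<exists>D. st D \<and> is_fun (\<epsilon>) D (cprod (\<epsilon>) B B) Re \<and>
      (\<forall>p. st p \<and> p \<epsilon> cprod (\<epsilon>) B B \<longrightarrow> P p (ap D p))"
  proof (rule standardization_fun[OF P])
    show "\<exists>!r. st r \<and> r \<epsilon> Re \<and> P p r" if p: "st p" "p \<epsilon> cprod (\<epsilon>) B B" for p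
    proof -
      obtain f g where fg: "f \<epsilon> B" "g \<epsilon> B" "p = pr f g" using p(2) by (rule cprodE)
      obtain s where s: "is_shadow (dist_w d f g) s"
        using ex_shadow_dist d fg st_ord_pairD p(1) by metis
      moreover have "dist_w d f g \<epsilon> Re" using d fg by simp
      ultimately show ?thesis
        using is_shadow_unique[of "dist_w d f g"] fg unfolding P_def is_shadow_def[of _ s]
        by (auto intro!: ex1I[of _ s] simp: s)
    qed
  qed (simp_all add: st_cprod)
  then obtain D0 where D0: "st D0" "is_fun (\<epsilon>) D0 (cprod (\<epsilon>) B B) Re"
    and P0: "\<And>p. st p \<Longrightarrow> p \<epsilon> cprod (\<epsilon>) B B \<Longrightarrow> P p (ap D0 p)" by blast
  have sh: "is_shadow (dist_w d f g) (ap2 D0 f g)" if "st f" "st g" "f \<epsilon> B" "g \<epsilon> B" for f g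
    using P0[of "pr f g"] that by (auto simp: P_def st_ord_pair)
  have eq: "shadow (\<epsilon>) st R (app2 (\<epsilon>) d (app (\<epsilon>) f w) (app (\<epsilon>) g w)) = ap2 D0 f g"
    if "st f" "st g" "f \<epsilon> B" "g \<epsilon> B" for f g
    using shadow_eq[OF dist_w_real sh] that d
    by (simp add: app_eq_ap[OF B_fun w_mem] pm_app2[OF pm] B_ap_w)
  have "D d = D0"
    unfolding hull_D_def
  proof (rule the_equality)
    show "st D0 \<and> is_fun (\<epsilon>) D0 (cprod (\<epsilon>) B B) (f_set R) \<and>
      (\<forall>f g. st f \<and> st g \<and> f \<epsilon> B \<and> g \<epsilon> B \<longrightarrow> app2 (\<epsilon>) D0 f g =
        shadow (\<epsilon>) st R (app2 (\<epsilon>) d (app (\<epsilon>) f w) (app (\<epsilon>) g w)))"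
      using D0 eq app2_eq_ap[OF D0(2)] by simp
  next
    fix D1
    assume D1: "st D1 \<and> is_fun (\<epsilon>) D1 (cprod (\<epsilon>) B B) (f_set R) \<and>
      (\<forall>f g. st f \<and> st g \<and> f \<epsilon> B \<and> g \<epsilon> B \<longrightarrow> app2 (\<epsilon>) D1 f g =
        shadow (\<epsilon>) st R (app2 (\<epsilon>) d (app (\<epsilon>) f w) (app (\<epsilon>) g w)))"
    then have D1_fun: "is_fun (\<epsilon>) D1 (cprod (\<epsilon>) B B) Re" by blast
    show "D1 = D0"
    proof (rule standard_fun_eqI[OF _ D0(1) _ D1_fun D0(2)])
      fix p assume p: "st p" "p \<epsilon> cprod (\<epsilon>) B B"
      from p(2) obtain f g where fg: "f \<epsilon> B" "g \<epsilon> B" "p = pr f g" by (rule cprodE)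
      moreover from p fg have "st f" "st g" using st_ord_pairD by blast+
      ultimately show "ap D1 p = ap D0 p"
        using D1 eq[of f g] app2_eq_ap[OF D1_fun, of f g] by simp
    qed (use D1 in \<open>simp_all add: st_cprod\<close>)
  qed
  with D0 sh show "st (D d)" "is_fun (\<epsilon>) (D d) (cprod (\<epsilon>) B B) Re"
    "\<And>f g. st f \<Longrightarrow> st g \<Longrightarrow> f \<epsilon> B \<Longrightarrow> g \<epsilon> B \<Longrightarrow> is_shadow (dist_w d f g) (ap2 (D d) f g)"
    by simp_all
qed

lemma D_pm:
  assumes d: "st d" "d \<epsilon> \<Delta>"
  shows "pseudo_metric (\<epsilon>) R B (D d)"
  unfolding pseudo_metric_iff
proof (intro conjI allI)
  note p = pm[OF d(2)] and sh = D_shadow[OF d]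
  show "is_fun (\<epsilon>) (D d) (cprod (\<epsilon>) B B) Re" by (rule D_fun[OF d])
  let ?P = "\<lambda>f g h. f \<epsilon> B \<and> g \<epsilon> B \<and> h \<epsilon> B \<longrightarrow>
      \<zero> \<preceq> ap2 (D d) f g \<and> ap2 (D d) f f = \<zero> \<and> ap2 (D d) f g = ap2 (D d) g f \<and>
      ap2 (D d) f h \<preceq> ap2 (D d) f g \<oplus> ap2 (D d) g h"
  show "?P f g h" for f g h
  proof (rule transfer3[where P = ?P])
    show "standard_definable (\<lambda>e. ?P (e 0) (e 1) (e 2))"
      by (intro definable_real_intros) (simp_all add: D_standard[OF d])
    fix f g h assume st: "st f" "st g" "st h"
    show "?P f g h"
    proof (intro impI)
      assume "f \<epsilon> B \<and> g \<epsilon> B \<and> h \<epsilon> B"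
      then have m: "f \<epsilon> B" "g \<epsilon> B" "h \<epsilon> B" by auto
      note w = B_ap_w[OF m(1)] B_ap_w[OF m(2)] B_ap_w[OF m(3)]
      have "\<zero> \<preceq> ap2 (D d) f g"
        using is_shadow_nonneg[OF _ _ sh] pm_nonneg[OF p] pm_real[OF p] w m st by blast
      moreover have "ap2 (D d) f f = \<zero>"
        using is_shadow_unique[OF _ sh[OF st(1,1) m(1,1)] is_shadow_self[of "dist_w d f f"]]
          pm_self[OF p w(1)] by simp
      moreover have "ap2 (D d) f g = ap2 (D d) g f"
        using is_shadow_unique[OF pm_real[OF p w(1,2)] sh[OF st(1,2) m(1,2)]]
          sh[OF st(2,1) m(2,1)] pm_sym[OF p w(1,2)] by simp
      moreover have "ap2 (D d) f h \<preceq> ap2 (D d) f g \<oplus> ap2 (D d) g h"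
        using is_shadow_triangle[OF _ _ _ pm_triangle[OF p w] sh sh sh] pm_real[OF p] st m w by blast
      ultimately show "\<zero> \<preceq> ap2 (D d) f g \<and> ap2 (D d) f f = \<zero> \<and> ap2 (D d) f g = ap2 (D d) g f \<and>
        ap2 (D d) f h \<preceq> ap2 (D d) f g \<oplus> ap2 (D d) g h" by blast
    qed
  qed
qed

lemma D_zero_iff:
  assumes "st d" "d \<epsilon> \<Delta>" "st f" "st g" "f \<epsilon> B" "g \<epsilon> B"
  shows "is_shadow (dist_w d f g) \<zero> \<longleftrightarrow> ap2 (D d) f g = \<zero>"
  using D_shadow[OF assms] is_shadow_unique[OF dist_w_real[OF assms(2,5,6)]] by metis

section \<open>The equivalence relation and its classes\<close>

lemma E_standard [simp]: "st E"
  and E_iff_st: "st f \<Longrightarrow> st g \<Longrightarrow> pr f g \<epsilon> E \<longleftrightarrow>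
    f \<epsilon> B \<and> g \<epsilon> B \<and> (\<forall>d. st d \<and> d \<epsilon> \<Delta> \<longrightarrow> ap2 (D d) f g = \<zero>)"
proof -
  let ?P = "\<lambda>p. \<exists>f g. p = pr f g \<and> (\<forall>d. st d \<and> d \<epsilon> \<Delta> \<longrightarrow>
      infclose (\<epsilon>) st R (app2 (\<epsilon>) d (app (\<epsilon>) f w) (app (\<epsilon>) g w)) \<zero>)"
  let ?Q = "\<lambda>p. \<exists>f g. p = pr f g \<and> (\<forall>d. st d \<and> d \<epsilon> \<Delta> \<longrightarrow> is_shadow (dist_w d f g) \<zero>)"
  have PQ: "?P p \<longleftrightarrow> ?Q p" if "p \<epsilon> cprod (\<epsilon>) B B" for p
  proof -
    obtain f g where fg: "f \<epsilon> B" "g \<epsilon> B" "p = pr f g" using \<open>p \<epsilon> cprod (\<epsilon>) B B\<close> by (rule cprodE)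
    have "infclose (\<epsilon>) st R (app2 (\<epsilon>) d (app (\<epsilon>) f w) (app (\<epsilon>) g w)) \<zero> \<longleftrightarrow>
        is_shadow (dist_w d f g) \<zero>" if "d \<epsilon> \<Delta>" for d
      using infclose_iff[OF dist_w_real[OF that fg(1,2)] zero_real] fg that
      by (simp add: app_eq_ap[OF B_fun w_mem] pm_app2[OF pm] B_ap_w)
    then show ?thesis by (auto simp: fg)
  qed
  have Q: "external (\<lambda>e. ?Q (e 0))"
    by (intro definable_real_intros definable_is_shadow) auto
  note * = standardization[of ?Q "cprod (\<epsilon>) B B" ?P, OF Q PQ, folded hull_E_def]
  show "st E" by (rule *)
  show "pr f g \<epsilon> E \<longleftrightarrow> f \<epsilon> B \<and> g \<epsilon> B \<and> (\<forall>d. st d \<and> d \<epsilon> \<Delta> \<longrightarrow> ap2 (D d) f g = \<zero>)"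
    if "st f" "st g"
    using *(2)[of "pr f g"] PQ[of "pr f g"] D_zero_iff that by (auto simp: st_ord_pair)
qed

lemma E_subset: "pr f g \<epsilon> E \<Longrightarrow> f \<epsilon> B \<and> g \<epsilon> B"
proof -
  have "pr f g \<epsilon> E \<longrightarrow> f \<epsilon> B \<and> g \<epsilon> B"
    by (rule transfer2[where P = "\<lambda>f g. pr f g \<epsilon> E \<longrightarrow> f \<epsilon> B \<and> g \<epsilon> B"])
      (intro definable_set_intros, auto simp: E_iff_st)
  then show "pr f g \<epsilon> E \<Longrightarrow> f \<epsilon> B \<and> g \<epsilon> B" by blast
qed

lemma E_equiv:
  shows E_refl: "f \<epsilon> B \<Longrightarrow> pr f f \<epsilon> E" and E_sym: "pr f g \<epsilon> E \<Longrightarrow> pr g f \<epsilon> E"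
    and E_trans: "pr f g \<epsilon> E \<Longrightarrow> pr g h \<epsilon> E \<Longrightarrow> pr f h \<epsilon> E"
proof -
  let ?P = "\<lambda>f g h. (f \<epsilon> B \<longrightarrow> pr f f \<epsilon> E) \<and> (pr f g \<epsilon> E \<longrightarrow> pr g f \<epsilon> E) \<and>
    (pr f g \<epsilon> E \<and> pr g h \<epsilon> E \<longrightarrow> pr f h \<epsilon> E)"
  have "?P f g h"
  proof (rule transfer3[where P = ?P])
    show "standard_definable (\<lambda>e. ?P (e 0) (e 1) (e 2))"
      by (intro definable_set_intros) simp_all
    fix f g h assume st: "st f" "st g" "st h"
    have "ap2 (D d) f f = \<zero>" if "f \<epsilon> B" "st d" "d \<epsilon> \<Delta>" for d
      using pm_self[OF D_pm] that by blast
    moreover have "ap2 (D d) g f = \<zero>" if "pr f g \<epsilon> E" "st d" "d \<epsilon> \<Delta>" for d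
      using pm_sym[OF D_pm[OF that(2,3)], of f g] that by (simp add: E_iff_st st)
    moreover have "ap2 (D d) f h = \<zero>" if "pr f g \<epsilon> E" "pr g h \<epsilon> E" "st d" "d \<epsilon> \<Delta>" for d
      using pm_zero_eq[OF D_pm[OF that(3,4)], of f g h] that by (simp add: E_iff_st st)
    ultimately show "?P f g h" using st by (auto simp: E_iff_st)
  qed
  then show "f \<epsilon> B \<Longrightarrow> pr f f \<epsilon> E" "pr f g \<epsilon> E \<Longrightarrow> pr g f \<epsilon> E"
    "pr f g \<epsilon> E \<Longrightarrow> pr g h \<epsilon> E \<Longrightarrow> pr f h \<epsilon> E" by blast+
qed

text \<open>For a fixed standard \<open>d\<close> the implication has only standard parameters and
  transfers to arbitrary \<open>f\<close> and \<open>g\<close>, whereas the criterion of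
  \<open>E_iff_st\<close> quantifies over standard \<open>d\<close> and is not open to
  Transfer.\<close>

lemma E_D_zero:
  assumes d: "st d" "d \<epsilon> \<Delta>" and "pr f g \<epsilon> E"
  shows "ap2 (D d) f g = \<zero>"
proof -
  have "pr f g \<epsilon> E \<longrightarrow> ap2 (D d) f g = \<zero>"
    by (rule transfer2[where P = "\<lambda>f g. pr f g \<epsilon> E \<longrightarrow> ap2 (D d) f g = \<zero>"])
      (intro definable_real_intros, use d in \<open>auto simp: E_iff_st D_standard\<close>)
  with assms show ?thesis by blast
qed

lemma D_respects:
  assumes "st d" "d \<epsilon> \<Delta>" "pr f f' \<epsilon> E" "pr g g' \<epsilon> E"
  shows "ap2 (D d) f g = ap2 (D d) f' g'"
  using pm_zero_eq[OF D_pm[OF assms(1,2)], of f f' g] pm_zero_eq[OF D_pm[OF assms(1,2)], of g g' f']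
    E_D_zero[OF assms(1,2)] assms(3,4) E_subset pm_sym[OF D_pm[OF assms(1,2)]] by metis

lemma mem_cls: "g \<epsilon> cls f \<longleftrightarrow> pr f g \<epsilon> E"
proof -
  have "g \<epsilon> cls f \<longleftrightarrow> g \<epsilon> B \<and> pr f g \<epsilon> E"
    unfolding hull_class_def
    by (rule mem_set_of_bounded[where a = B]) (intro definable_set_intros, auto)
  then show ?thesis using E_subset by blast
qed

lemma eq_cls_iff: "z = cls f \<longleftrightarrow> (\<forall>g. g \<epsilon> z \<longleftrightarrow> pr f g \<epsilon> E)"
  using Extensionality[of z "cls f"] by (auto simp: mem_cls)

lemma definable_cls:
  assumes "definable_term K b s"
  shows "definable_term K b (\<lambda>e. cls (s e))"
  by (rule definable_term1[OF eq_cls_iff _ assms]) (intro definable_set_intros, auto)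

lemmas definable_hull_intros = definable_real_intros definable_cls

lemma cls_eq_iff: "f \<epsilon> B \<Longrightarrow> cls f = cls g \<longleftrightarrow> pr f g \<epsilon> E"
proof -
  assume f: "f \<epsilon> B"
  show ?thesis
  proof
    assume "cls f = cls g"
    then have "f \<epsilon> cls g" using E_refl[OF f] mem_cls by metis
    then show "pr f g \<epsilon> E" using mem_cls E_sym by blast
  next
    assume "pr f g \<epsilon> E"
    then show "cls f = cls g"
      using E_trans E_sym by (intro Extensionality) (metis mem_cls)
  qed
qed

lemma mem_hull: "X \<epsilon> hull \<longleftrightarrow> (\<exists>f. f \<epsilon> B \<and> X = cls f)"
proof -
  obtain u where u: "\<forall>x. x \<epsilon> u \<longleftrightarrow> subset_of (\<epsilon>) x B" using mem_pow_ex by blast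
  show ?thesis
    unfolding hull_M_def
    by (rule mem_set_of_bounded[where a = u])
      (intro definable_hull_intros, auto simp: u subset_of_def mem_cls dest: E_subset)
qed

lemma cls_mem_hull: "f \<epsilon> B \<Longrightarrow> cls f \<epsilon> hull"
  using mem_hull by blast

lemma hull_standard [simp]: "st hull"
proof (rule standard_unique[where P = "\<lambda>z. \<forall>X. X \<epsilon> z \<longleftrightarrow> (\<exists>f. f \<epsilon> B \<and> X = cls f)"])
  show "standard_definable (\<lambda>e. \<forall>X. X \<epsilon> e 0 \<longleftrightarrow> (\<exists>f. f \<epsilon> B \<and> X = cls f))"
    by (intro definable_hull_intros) auto
  show "\<forall>X. X \<epsilon> hull \<longleftrightarrow> (\<exists>f. f \<epsilon> B \<and> X = cls f)" by (simp add: mem_hull)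
  show "z = hull" if "\<forall>X. X \<epsilon> z \<longleftrightarrow> (\<exists>f. f \<epsilon> B \<and> X = cls f)" for z
    using that by (intro Extensionality) (simp add: mem_hull)
qed

lemma st_hullE:
  assumes "st X" "X \<epsilon> hull"
  obtains f where "st f" "f \<epsilon> B" "X = cls f"
proof -
  have "\<exists>f. st f \<and> f \<epsilon> B \<and> X = cls f"
    using assms(2)[unfolded mem_hull]
  proof (elim exE)
    fix f assume "f \<epsilon> B \<and> X = cls f"
    then show ?thesis
      by (rule transfer_ex[where P = "\<lambda>f. f \<epsilon> B \<and> X = cls f", rotated])
        (intro definable_hull_intros, use assms in auto)
  qed
  with that show thesis by blast
qed

section \<open>The induced pseudo-metrics and their family\<close>

lemma hdist_props:
  assumes d: "st d" "d \<epsilon> \<Delta>"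
  shows hdist_standard: "st (hdist d)"
    and hdist_fun: "is_fun (\<epsilon>) (hdist d) (cprod (\<epsilon>) hull hull) Re"
    and hdist_cls: "\<And>f g. f \<epsilon> B \<Longrightarrow> g \<epsilon> B \<Longrightarrow> ap2 (hdist d) (cls f) (cls g) = ap2 (D d) f g"
proof -
  \<comment> \<open>Quantifying over all representatives makes this a formula in the pair of classes
    alone; its solvability is what \<open>D_respects\<close> provides.\<close>
  let ?Q = "\<lambda>p r. \<forall>f g. f \<epsilon> B \<and> g \<epsilon> B \<and> p = pr (cls f) (cls g) \<longrightarrow> r = ap2 (D d) f g"
  have "\<exists>h. st h \<and> is_fun (\<epsilon>) h (cprod (\<epsilon>) hull hull) Re \<and>
      (\<forall>p. p \<epsilon> cprod (\<epsilon>) hull hull \<longrightarrow> ?Q p (ap h p))"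
  proof (rule standard_fun_choice[where Q = ?Q])
    show "standard_definable (\<lambda>e. ?Q (e 0) (e 1))"
      by (intro definable_hull_intros) (use d in \<open>simp_all add: D_standard\<close>)
    fix p assume "p \<epsilon> cprod (\<epsilon>) hull hull"
    then obtain f g where fg: "f \<epsilon> B" "g \<epsilon> B" "p = pr (cls f) (cls g)"
      by (auto simp: mem_cprod mem_hull)
    show "\<exists>r. r \<epsilon> Re \<and> ?Q p r"
    proof (intro exI conjI allI impI)
      show "ap2 (D d) f g \<epsilon> Re" using pm_real[OF D_pm[OF d]] fg by blast
      fix f' g' assume "f' \<epsilon> B \<and> g' \<epsilon> B \<and> p = pr (cls f') (cls g')"
      then show "ap2 (D d) f g = ap2 (D d) f' g'"
        using D_respects[OF d] cls_eq_iff fg by simp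
    qed
  qed (simp_all add: st_cprod)
  then obtain h where h: "st h" "is_fun (\<epsilon>) h (cprod (\<epsilon>) hull hull) Re"
    and Q: "\<And>p. p \<epsilon> cprod (\<epsilon>) hull hull \<Longrightarrow> ?Q p (ap h p)" by blast
  have val: "ap2 h (cls f) (cls g) = ap2 (D d) f g" if "f \<epsilon> B" "g \<epsilon> B" for f g
    using Q[of "pr (cls f) (cls g)"] that cls_mem_hull by simp
  have "hdist d = h"
    unfolding hull_dist_def
  proof (rule the_equality)
    show "is_fun (\<epsilon>) h (cprod (\<epsilon>) hull hull) (f_set R) \<and>
      (\<forall>f g. f \<epsilon> B \<and> g \<epsilon> B \<longrightarrow> app2 (\<epsilon>) h (cls f) (cls g) = app2 (\<epsilon>) (D d) f g)"
      using h val by (simp add: app2_eq_ap[OF h(2)] cls_mem_hull pm_app2[OF D_pm[OF d]])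
  next
    fix h' assume h': "is_fun (\<epsilon>) h' (cprod (\<epsilon>) hull hull) (f_set R) \<and>
      (\<forall>f g. f \<epsilon> B \<and> g \<epsilon> B \<longrightarrow> app2 (\<epsilon>) h' (cls f) (cls g) = app2 (\<epsilon>) (D d) f g)"
    then have fn: "is_fun (\<epsilon>) h' (cprod (\<epsilon>) hull hull) Re" by blast
    show "h' = h"
    proof (rule fun_eqI[OF fn h(2)])
      fix p assume "p \<epsilon> cprod (\<epsilon>) hull hull"
      then obtain f g where fg: "f \<epsilon> B" "g \<epsilon> B" "p = pr (cls f) (cls g)"
        by (auto simp: mem_cprod mem_hull)
      then show "ap h' p = ap h p"
        using h' val by (simp add: app2_eq_ap[OF fn] cls_mem_hull pm_app2[OF D_pm[OF d]])
    qed
  qed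
  with h val show "st (hdist d)" "is_fun (\<epsilon>) (hdist d) (cprod (\<epsilon>) hull hull) Re"
    "\<And>f g. f \<epsilon> B \<Longrightarrow> g \<epsilon> B \<Longrightarrow> ap2 (hdist d) (cls f) (cls g) = ap2 (D d) f g" by simp_all
qed

lemma hdist_pm:
  assumes d: "st d" "d \<epsilon> \<Delta>"
  shows "pseudo_metric (\<epsilon>) R hull (hdist d)"
  unfolding pseudo_metric_iff
proof (intro conjI allI impI)
  fix X Y Z assume "X \<epsilon> hull \<and> Y \<epsilon> hull \<and> Z \<epsilon> hull"
  then obtain f g h where fgh: "f \<epsilon> B" "g \<epsilon> B" "h \<epsilon> B" "X = cls f" "Y = cls g" "Z = cls h"
    by (auto simp: mem_hull)
  note val = hdist_cls[OF d] and p = D_pm[OF d]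
  show "\<zero> \<preceq> ap2 (hdist d) X Y" using pm_nonneg[OF p] fgh val by simp
  show "ap2 (hdist d) X X = \<zero>" using pm_self[OF p] fgh val by simp
  show "ap2 (hdist d) X Y = ap2 (hdist d) Y X" using pm_sym[OF p] fgh val by simp
  show "ap2 (hdist d) X Z \<preceq> ap2 (hdist d) X Y \<oplus> ap2 (hdist d) Y Z"
    using pm_triangle[OF p] fgh val by simp
qed (rule hdist_fun[OF d])

text \<open>An external formula for \<open>h = hdist d\<close> with \<open>d\<close> as a variable.
  \<open>hdist\<close> is a description resting on another description, so Standardization of the
  family and of the map cannot refer to it; the values at standard pairs of classes already identify
  a standard \<open>h\<close>.\<close>

definition represents :: "'a \<Rightarrow> 'a \<Rightarrow> bool" where
  "represents d h \<longleftrightarrow> (\<forall>f g. st f \<and> st g \<and> f \<epsilon> B \<and> g \<epsilon> B \<longrightarrow>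
     is_shadow (dist_w d f g) (ap2 h (cls f) (cls g)))"

lemma definable_represents:
  assumes "definable_term (\<lambda>_. True) True s" "definable_term (\<lambda>_. True) True t"
  shows "external (\<lambda>e. represents (s e) (t e))"
  by (rule definable_subst2[OF _ assms], unfold represents_def)
    (intro definable_hull_intros definable_is_shadow, auto)

lemma represents_iff:
  assumes d: "st d" "d \<epsilon> \<Delta>" and h: "st h" "is_fun (\<epsilon>) h (cprod (\<epsilon>) hull hull) Re"
  shows "represents d h \<longleftrightarrow> h = hdist d"
proof
  assume "h = hdist d"
  then show "represents d h"
    unfolding represents_def using hdist_cls[OF d] D_shadow[OF d] by simp
next
  assume r: "represents d h"
  show "h = hdist d"
  proof (rule standard_fun_eqI[OF h(1) hdist_standard[OF d] _ h(2) hdist_fun[OF d]])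
    fix p assume p: "st p" "p \<epsilon> cprod (\<epsilon>) hull hull"
    from p(2) obtain X Y where XY: "X \<epsilon> hull" "Y \<epsilon> hull" "p = pr X Y" by (rule cprodE)
    moreover from XY p have "st X" "st Y" using st_ord_pairD by blast+
    ultimately obtain f g where f: "st f" "f \<epsilon> B" "X = cls f" and g: "st g" "g \<epsilon> B" "Y = cls g"
      using st_hullE by metis
    have "is_shadow (dist_w d f g) (ap h p)" using r f g XY unfolding represents_def by blast
    moreover have "is_shadow (dist_w d f g) (ap (hdist d) p)"
      using D_shadow[OF d f(1) g(1) f(2) g(2)] hdist_cls[OF d] f g XY by simp
    ultimately show "ap h p = ap (hdist d) p"
      using is_shadow_unique[OF dist_w_real] d f g by blast
  qed (simp add: st_cprod)
qed

lemma family_standard [simp]: "st family"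
  and mem_family_st: "st h \<Longrightarrow> h \<epsilon> family \<longleftrightarrow> (\<exists>d. st d \<and> d \<epsilon> \<Delta> \<and> h = hdist d)"
proof -
  let ?P = "\<lambda>h. \<exists>d. st d \<and> d \<epsilon> \<Delta> \<and> h = hdist d"
  let ?Q = "\<lambda>h. \<exists>d. st d \<and> d \<epsilon> \<Delta> \<and> represents d h"
  have Q: "external (\<lambda>e. ?Q (e 0))" by (intro definable_real_intros definable_represents) auto
  have PQ: "?P h \<longleftrightarrow> ?Q h" if "st h" "h \<epsilon> funs (\<epsilon>) (cprod (\<epsilon>) hull hull) Re" for h
    using represents_iff[OF _ _ that(1)] that(2) by (metis mem_funs)
  note * = standardization[of ?Q "funs (\<epsilon>) (cprod (\<epsilon>) hull hull) Re" ?P, OF Q PQ,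
      folded hull_family_def]
  show "st family" by (rule *)
  show "st h \<Longrightarrow> h \<epsilon> family \<longleftrightarrow> ?P h"
    using *(2) hdist_fun by (auto simp: mem_funs)
qed

lemma hdist_mem_family: "st d \<Longrightarrow> d \<epsilon> \<Delta> \<Longrightarrow> hdist d \<epsilon> family"
  using mem_family_st hdist_standard by blast

lemma hull_uniform: "is_uniform_space (\<epsilon>) R hull family"
  unfolding is_uniform_space_def
proof
  show "h \<epsilon> family \<longrightarrow> pseudo_metric (\<epsilon>) R hull h" for h
    by (rule transfer[where P = "\<lambda>h. h \<epsilon> family \<longrightarrow> pseudo_metric (\<epsilon>) R hull h"])
      (intro definable_real_intros definable_pseudo_metric,
        auto simp: mem_family_st intro: hdist_pm)
qed

lemma map_props:
  shows map_standard [simp]: "st H" and map_fun: "is_fun (\<epsilon>) H \<Delta> family"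
    and ap_map: "\<And>d. st d \<Longrightarrow> d \<epsilon> \<Delta> \<Longrightarrow> ap H d = hdist d"
proof -
  have "external (\<lambda>e. represents (e 0) (e 1))"
    by (intro definable_represents definable_real_intros)
  then have "\<exists>H. st H \<and> is_fun (\<epsilon>) H \<Delta> family \<and> (\<forall>d. st d \<and> d \<epsilon> \<Delta> \<longrightarrow> ap H d = hdist d)"
  proof (rule standardization_fun[where P = "\<lambda>d h. h = hdist d"])
    show "h = hdist d \<longleftrightarrow> represents d h" if "st d" "st h" "d \<epsilon> \<Delta>" "h \<epsilon> family" for d h
      using represents_iff[OF that(1,3,2)] pm_fun[OF uniform_pm[OF hull_uniform]] that by blast
  qed (use hdist_mem_family hdist_standard in auto)
  then obtain H0 where H0: "st H0" "is_fun (\<epsilon>) H0 \<Delta> family"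
    "\<And>d. st d \<Longrightarrow> d \<epsilon> \<Delta> \<Longrightarrow> ap H0 d = hdist d" by blast
  have "H = H0"
    unfolding hull_map_def
  proof (rule the_equality)
    show "st H0 \<and> is_fun (\<epsilon>) H0 \<Delta> family \<and> (\<forall>d. st d \<and> d \<epsilon> \<Delta> \<longrightarrow> app (\<epsilon>) H0 d = hdist d)"
      using H0 by (simp add: app_eq_ap[OF H0(2)])
  next
    fix H1 assume H1: "st H1 \<and> is_fun (\<epsilon>) H1 \<Delta> family \<and>
      (\<forall>d. st d \<and> d \<epsilon> \<Delta> \<longrightarrow> app (\<epsilon>) H1 d = hdist d)"
    then have fn: "is_fun (\<epsilon>) H1 \<Delta> family" by blast
    show "H1 = H0"
      by (rule standard_fun_eqI[OF _ H0(1) st_\<Delta> fn H0(2)])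
        (use H1 H0(3) in \<open>simp_all add: app_eq_ap[OF fn]\<close>)
  qed
  with H0 show "st H" "is_fun (\<epsilon>) H \<Delta> family" "\<And>d. st d \<Longrightarrow> d \<epsilon> \<Delta> \<Longrightarrow> ap H d = hdist d" by simp_all
qed

lemma hull_hausdorff: "is_hausdorff (\<epsilon>) R hull family"
proof (rule hausdorffI[OF hull_uniform])
  let ?P = "\<lambda>X Y. X \<epsilon> hull \<and> Y \<epsilon> hull \<and> X \<noteq> Y \<longrightarrow> (\<exists>h. h \<epsilon> family \<and> ap2 h X Y \<noteq> \<zero>)"
  have "?P X Y" for X Y
  proof (rule transfer2[where P = ?P])
    show "standard_definable (\<lambda>e. ?P (e 0) (e 1))" by (intro definable_real_intros) auto
    fix X Y assume st: "st X" "st Y"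
    show "?P X Y"
    proof
      assume XY: "X \<epsilon> hull \<and> Y \<epsilon> hull \<and> X \<noteq> Y"
      then obtain f g where f: "st f" "f \<epsilon> B" "X = cls f" and g: "st g" "g \<epsilon> B" "Y = cls g"
        using st_hullE st by metis
      then obtain d where d: "st d" "d \<epsilon> \<Delta>" "ap2 (D d) f g \<noteq> \<zero>"
        using XY cls_eq_iff E_iff_st by blast
      then show "\<exists>h. h \<epsilon> family \<and> ap2 h X Y \<noteq> \<zero>"
        using hdist_mem_family hdist_cls f g by metis
    qed
  qed
  then show "\<And>x y. x \<epsilon> hull \<Longrightarrow> y \<epsilon> hull \<Longrightarrow> x \<noteq> y \<Longrightarrow> \<exists>d. d \<epsilon> family \<and> ap2 d x y \<noteq> \<zero>" by blast
qed

section \<open>The embedding\<close>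

abbreviation const where "const \<equiv> const_fun (\<epsilon>) I"

lemma mem_const: "p \<epsilon> const x \<longleftrightarrow> (\<exists>i. i \<epsilon> I \<and> p = pr i x)"
  unfolding const_fun_def
  by (rule mem_set_of_bounded[where a = "cprod (\<epsilon>) I (unord_pair (\<epsilon>) x x)"])
    (intro definable_set_intros, auto)

lemma eq_const_iff: "z = const x \<longleftrightarrow> (\<forall>p. p \<epsilon> z \<longleftrightarrow> (\<exists>i. i \<epsilon> I \<and> p = pr i x))"
  using Extensionality[of z "const x"] by (auto simp: mem_const)

lemma definable_const_fun:
  assumes "definable_term K b s"
  shows "definable_term K b (\<lambda>e. const (s e))"
  by (rule definable_term1[OF eq_const_iff _ assms]) (intro definable_set_intros, auto)

lemma const_is_fun: "x \<epsilon> M \<Longrightarrow> is_fun (\<epsilon>) (const x) I M"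
  by (auto simp: is_fun_def subset_of_def mem_const)

lemma ap_const_w: "x \<epsilon> M \<Longrightarrow> ap (const x) w = x"
  using pair_mem_fun_iff[OF const_is_fun w_mem, of x x] w_mem by (simp add: mem_const)

lemma st_const: "st x \<Longrightarrow> st (const x)"
  by (rule definable_term_standard) (intro definable_real_intros definable_const_fun, auto)

lemma const_mem_B: "x \<epsilon> M \<Longrightarrow> const x \<epsilon> B"
proof -
  have "x \<epsilon> M \<longrightarrow> const x \<epsilon> B"
  proof (rule transfer[where P = "\<lambda>x. x \<epsilon> M \<longrightarrow> const x \<epsilon> B"])
    show "standard_definable (\<lambda>e. e 0 \<epsilon> M \<longrightarrow> const (e 0) \<epsilon> B)"
      by (intro definable_real_intros definable_const_fun) auto
    fix x assume "st x"
    show "x \<epsilon> M \<longrightarrow> const x \<epsilon> B"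
    proof
      assume x: "x \<epsilon> M"
      have "\<exists>q a. st q \<and> q \<epsilon> M \<and> st a \<and> a \<epsilon> Re \<and> ap2 d x q \<prec> a" if "d \<epsilon> \<Delta>" for d
        using pm_self[OF pm[OF that] x] \<open>st x\<close> x zero_less_one
        by (intro exI[of _ x] exI[of _ \<one>]) simp
      with x show "const x \<epsilon> B"
        using mem_B_st[OF st_const[OF \<open>st x\<close>]] const_is_fun ap_const_w by (simp add: finite_point_iff)
    qed
  qed
  then show "x \<epsilon> M \<Longrightarrow> const x \<epsilon> B" by blast
qed

text \<open>For standard arguments d(x, y) is standard and hence its own shadow. With
  \<open>ap H d\<close> in place of \<open>hdist d\<close> the statement is a formula, so Transfer
  reaches nonstandard d.\<close>

lemma map_isometry:
  assumes "x \<epsilon> M" "y \<epsilon> M" "d \<epsilon> \<Delta>"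
  shows "ap2 (ap H d) (cls (const x)) (cls (const y)) = ap2 d x y"
proof -
  let ?P = "\<lambda>x y d. x \<epsilon> M \<and> y \<epsilon> M \<and> d \<epsilon> \<Delta> \<longrightarrow>
    ap2 (ap H d) (cls (const x)) (cls (const y)) = ap2 d x y"
  have "?P x y d"
  proof (rule transfer3[where P = ?P])
    show "standard_definable (\<lambda>e. ?P (e 0) (e 1) (e 2))"
      by (intro definable_hull_intros definable_const_fun) auto
    fix x y d assume st: "st x" "st y" "st d"
    show "?P x y d"
    proof
      assume m: "x \<epsilon> M \<and> y \<epsilon> M \<and> d \<epsilon> \<Delta>"
      have real: "ap2 d x y \<epsilon> Re" using pm_real[OF pm] m by blast
      have "is_shadow (ap2 d x y) (ap2 (D d) (const x) (const y))"
        using D_shadow[of d "const x" "const y"] st m by (simp add: st_const const_mem_B ap_const_w)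
      moreover have "is_shadow (ap2 d x y) (ap2 d x y)"
        using is_shadow_self real st by (simp add: st_ap st_ord_pair)
      ultimately show "ap2 (ap H d) (cls (const x)) (cls (const y)) = ap2 d x y"
        using is_shadow_unique[OF real] m st hdist_cls ap_map const_mem_B by simp
    qed
  qed
  with assms show ?thesis by blast
qed

lemma hull_embeds:
  assumes hausdorff: "is_hausdorff (\<epsilon>) R M \<Delta>"
  shows "embeds (\<epsilon>) (hull_c (\<epsilon>) st R M \<Delta> I w) H M \<Delta> hull family"
proof -
  let ?c = "hull_c (\<epsilon>) st R M \<Delta> I w"
  have mem: "p \<epsilon> ?c \<longleftrightarrow> (\<exists>x. x \<epsilon> M \<and> p = pr x (cls (const x)))" for p
    unfolding hull_c_def
    by (rule mem_set_of_bounded[where a = "cprod (\<epsilon>) M hull"])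
      (intro definable_hull_intros definable_const_fun, auto simp: cls_mem_hull const_mem_B)
  then have fn: "is_fun (\<epsilon>) ?c M hull"
    by (auto simp: is_fun_def subset_of_def cls_mem_hull const_mem_B)
  have c: "app (\<epsilon>) ?c x = cls (const x)" if "x \<epsilon> M" for x
    using pair_mem_fun_iff[OF fn that] mem[of "pr x (cls (const x))"] app_eq_ap[OF fn that] that by simp
  have iso: "app2 (\<epsilon>) (app (\<epsilon>) H d) (app (\<epsilon>) ?c x) (app (\<epsilon>) ?c y) = app2 (\<epsilon>) d x y"
    if "x \<epsilon> M" "y \<epsilon> M" "d \<epsilon> \<Delta>" for x y d
    using map_isometry[OF that] that ap_mem[OF map_fun that(3)]
    by (simp add: c app_eq_ap[OF map_fun] pm_app2[OF pm] pm_app2[OF uniform_pm[OF hull_uniform]]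
        cls_mem_hull const_mem_B)
  have "x = y" if "x \<epsilon> M" "y \<epsilon> M" "app (\<epsilon>) ?c x = app (\<epsilon>) ?c y" for x y
  proof (rule ccontr)
    assume "x \<noteq> y"
    then obtain d where d: "d \<epsilon> \<Delta>" "ap2 d x y \<noteq> \<zero>"
      using hausdorffD[OF uniform hausdorff] \<open>x \<epsilon> M\<close> \<open>y \<epsilon> M\<close> by blast
    have "ap2 d x y = ap2 d y y"
      using iso[OF that(1,2) d(1)] iso[OF that(2,2) d(1)] that pm_app2[OF pm[OF d(1)]] by simp
    with d pm_self[OF pm] that show False by simp
  qed
  with fn iso map_fun show ?thesis unfolding embeds_def is_inj_def by blast
qed

section \<open>Completeness\<close>

text \<open>
  Idealization is applied to the index set \<open>\<kappa>\<^sub>0 \<supseteq> \<Delta> \<union> \<omega>\<close> (with \<open>\<Delta>\<close> embedded by \<open>b\<close>) rather than to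
  \<open>\<Delta> \<times> \<omega>\<close>: the object sought is a pair of a point and a set \<open>u\<close> of precision indices, an index from
  \<open>\<omega>\<close> asks to be an element of \<open>u\<close>, and an index from \<open>\<Delta>\<close> asks for every precision in \<open>u\<close>.
  This avoids the cardinal arithmetic needed for \<open>|\<Delta> \<times> \<omega>| \<le> \<kappa>\<close>.
\<close>

lemma standard_cauchy_filter_converges:
  assumes ideal: "w_idealization (\<epsilon>) st I w \<kappa>"
    and \<kappa>\<^sub>0: "st \<kappa>\<^sub>0" "card_le (\<epsilon>) \<kappa>\<^sub>0 \<kappa>" "subset_of (\<epsilon>) (omega (\<epsilon>)) \<kappa>\<^sub>0" "subset_of (\<epsilon>) \<delta> \<kappa>\<^sub>0"
    and b: "st b" "is_bij (\<epsilon>) b \<Delta> \<delta>"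
    and q: "st q" "is_fun (\<epsilon>) q (omega (\<epsilon>)) Re" "\<And>n. n \<epsilon> omega (\<epsilon>) \<Longrightarrow> \<zero> \<prec> ap q n"
      "\<And>r. r \<epsilon> Re \<Longrightarrow> \<zero> \<prec> r \<Longrightarrow> \<exists>n. n \<epsilon> omega (\<epsilon>) \<and> ap q n \<prec> r"
    and F: "st F" "is_filter (\<epsilon>) hull F"
    and cauchy: "\<And>h r. h \<epsilon> family \<Longrightarrow> r \<epsilon> Re \<Longrightarrow> \<zero> \<prec> r \<Longrightarrow>
      \<exists>A. A \<epsilon> F \<and> (\<forall>X Y. X \<epsilon> A \<and> Y \<epsilon> A \<longrightarrow> ap2 h X Y \<prec> r)"
  shows "\<exists>X. X \<epsilon> hull \<and> (\<forall>h r. h \<epsilon> family \<and> r \<epsilon> Re \<and> \<zero> \<prec> r \<longrightarrow>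
    (\<exists>A. A \<epsilon> F \<and> (\<forall>Y. Y \<epsilon> A \<longrightarrow> ap2 h X Y \<prec> r)))"
proof -
  let ?\<omega> = "omega (\<epsilon>)"
  have F_sub: "Y \<epsilon> hull" if "A \<epsilon> F" "Y \<epsilon> A" for A Y
    using F(2) that unfolding is_filter_def subset_of_def by blast
  have F_ne: "\<exists>Y. Y \<epsilon> A" if "A \<epsilon> F" for A
    using F(2) that eq_empty_iff[of A] unfolding is_filter_def by blast
  have F_ex: "\<exists>A. A \<epsilon> F" and F_inter: "\<And>A A'. A \<epsilon> F \<Longrightarrow> A' \<epsilon> F \<Longrightarrow> inter_set (\<epsilon>) A A' \<epsilon> F"
    using F(2) unfolding is_filter_def by blast+
  note hpm = uniform_pm[OF hull_uniform]

  \<comment> \<open>A solution is a centre g whose ball of radius q(n) includes a member of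
    \<open>F\<close>; any representative of an element of a sufficiently small member is one. All
    parameters are standard, so the family of centres can be chosen standard.\<close>
  let ?Q = "\<lambda>p g. \<forall>d n. p = pr d n \<longrightarrow>
      (\<exists>A. A \<epsilon> F \<and> (\<forall>Y. Y \<epsilon> A \<longrightarrow> ap2 (ap H d) (cls g) Y \<prec> ap q n))"
  have "\<exists>k. st k \<and> is_fun (\<epsilon>) k (cprod (\<epsilon>) \<Delta> ?\<omega>) B \<and>
      (\<forall>p. p \<epsilon> cprod (\<epsilon>) \<Delta> ?\<omega> \<longrightarrow> ?Q p (ap k p))"
  proof (rule standard_fun_choice[where Q = ?Q])
    show "standard_definable (\<lambda>e. ?Q (e 0) (e 1))"
      by (intro definable_hull_intros) (use F q in auto)
    fix p assume "p \<epsilon> cprod (\<epsilon>) \<Delta> ?\<omega>"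
    then obtain d n where p: "d \<epsilon> \<Delta>" "n \<epsilon> ?\<omega>" "p = pr d n" by (rule cprodE)
    obtain A where A: "A \<epsilon> F" "\<And>X Y. X \<epsilon> A \<Longrightarrow> Y \<epsilon> A \<Longrightarrow> ap2 (ap H d) X Y \<prec> ap q n"
      using cauchy[OF ap_mem[OF map_fun p(1)] ap_mem[OF q(2) p(2)] q(3)[OF p(2)]] by blast
    obtain X where X: "X \<epsilon> A" using F_ne[OF A(1)] by blast
    obtain g where g: "g \<epsilon> B" "X = cls g" using F_sub[OF A(1) X] mem_hull by blast
    show "\<exists>g. g \<epsilon> B \<and> ?Q p g"
      using g A X p by (intro exI[of _ g]) auto
  qed (simp_all add: st_cprod st_omega)
  then obtain k where k: "st k" "is_fun (\<epsilon>) k (cprod (\<epsilon>) \<Delta> ?\<omega>) B"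
    and kQ: "\<And>p. p \<epsilon> cprod (\<epsilon>) \<Delta> ?\<omega> \<Longrightarrow> ?Q p (ap k p)" by blast
  have k_ball: "\<exists>A. A \<epsilon> F \<and> (\<forall>Y. Y \<epsilon> A \<longrightarrow> ap2 (ap H d) (cls (ap2 k d n)) Y \<prec> ap q n)"
    if "d \<epsilon> \<Delta>" "n \<epsilon> ?\<omega>" for d n
    using kQ[of "pr d n"] that by simp
  have k_mem: "ap2 k d n \<epsilon> B" if "d \<epsilon> \<Delta>" "n \<epsilon> ?\<omega>" for d n
    using ap_mem[OF k(2)] that by simp

  \<comment> \<open>The parameters are standard except possibly \<open>w\<close>, which is
    w-standard through the identity on \<open>I\<close>. An index that lies in \<omega> and is also
    a value of \<open>b\<close> imposes both conditions.\<close>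
  let ?\<phi> = "\<lambda>x y. \<exists>z u. y = pr z u \<and> z \<epsilon> M \<and> (x \<epsilon> ?\<omega> \<longrightarrow> x \<epsilon> u) \<and>
    (\<forall>d n. d \<epsilon> \<Delta> \<and> ap b d = x \<and> n \<epsilon> ?\<omega> \<and> n \<epsilon> u \<longrightarrow> ap2 d z (ap (ap2 k d n) w) \<prec> ap q n)"
  have "\<exists>y. w_standard (\<epsilon>) st I w y \<and> (\<forall>x. st x \<and> x \<epsilon> \<kappa>\<^sub>0 \<longrightarrow> ?\<phi> x y)"
  proof (rule w_idealization_definable[OF ideal st_I w_mem _ \<kappa>\<^sub>0(1,2), where Q = ?\<phi>])
    show "definable (w_standard (\<epsilon>) st I w) False (\<lambda>e. ?\<phi> (e 0) (e 1))"
      by (intro definable_real_intros)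
        (use q k b in \<open>auto simp: st_omega self_w_standard w_mem\<close>)
    fix a assume a: "st a" "is_finite (\<epsilon>) a" "subset_of (\<epsilon>) a \<kappa>\<^sub>0"
    note a_st = st_finite_mem_st[OF a(1,2)]
    \<comment> \<open>\<open>?T x n C\<close> says that \<open>C\<close> lies within the ball
      selected by the indices x and n. Refining over n for fixed x, and then over x, yields one
      member of \<open>F\<close> for all pairs of indices from \<open>a\<close>.\<close>
    let ?T = "\<lambda>x n C. \<forall>d. d \<epsilon> \<Delta> \<and> ap b d = x \<and> n \<epsilon> ?\<omega> \<longrightarrow>
        (\<forall>Y. Y \<epsilon> C \<longrightarrow> ap2 (ap H d) (cls (ap2 k d n)) Y \<prec> ap q n)"
    have T: "\<exists>C. C \<epsilon> F \<and> ?T x n C" for x n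
    proof (cases "n \<epsilon> ?\<omega> \<and> (\<exists>d. d \<epsilon> \<Delta> \<and> ap b d = x)")
      case True
      then obtain d where d: "d \<epsilon> \<Delta>" "ap b d = x" "n \<epsilon> ?\<omega>" by blast
      with is_bij_inj[OF b(2)] have "d' = d" if "d' \<epsilon> \<Delta>" "ap b d' = x" for d' using that by blast
      with k_ball[OF d(1,3)] show ?thesis by metis
    next
      case False
      with F_ex show ?thesis by blast
    qed
    have T2: "\<exists>C. C \<epsilon> F \<and> (\<forall>n. n \<epsilon> a \<longrightarrow> ?T x n C)" for x
      by (rule finite_common_refinement[OF a(2) _ F_ex F_inter _ T])
        (intro definable_hull_intros, auto dest: subset_ofD)
    have "\<exists>C. C \<epsilon> F \<and> (\<forall>x. x \<epsilon> a \<longrightarrow> (\<forall>n. n \<epsilon> a \<longrightarrow> ?T x n C))"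
      by (rule finite_common_refinement[OF a(2) _ F_ex F_inter _ T2])
        (intro definable_hull_intros, auto dest: subset_ofD)
    then obtain C where C: "C \<epsilon> F" "\<forall>x. x \<epsilon> a \<longrightarrow> (\<forall>n. n \<epsilon> a \<longrightarrow> ?T x n C)" by blast
    obtain Y0 where Y0: "Y0 \<epsilon> C" using F_ne[OF C(1)] by blast
    \<comment> \<open>The common point is made standard by Transfer, since shadows connect distances
      in the hull with values at \<open>w\<close> only for standard functions.\<close>
    let ?P = "\<lambda>Y. Y \<epsilon> hull \<and> (\<forall>d n. d \<epsilon> \<Delta> \<and> ap b d \<epsilon> a \<and> n \<epsilon> ?\<omega> \<and> n \<epsilon> a \<longrightarrow>
        ap2 (ap H d) (cls (ap2 k d n)) Y \<prec> ap q n)"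
    have "?P Y0" using C(2) Y0 F_sub[OF C(1) Y0] by blast
    then have "\<exists>Y. st Y \<and> ?P Y"
      by (rule transfer_ex[where P = ?P, rotated])
        (intro definable_hull_intros, use a b k q in \<open>auto simp: st_omega\<close>)
    then obtain Y where Y: "st Y" "?P Y" by blast
    then obtain g where g: "st g" "g \<epsilon> B" "Y = cls g" using st_hullE by metis
    have near: "ap2 d (ap g w) (ap (ap2 k d n) w) \<prec> ap q n"
      if dn: "d \<epsilon> \<Delta>" "ap b d \<epsilon> a" "n \<epsilon> ?\<omega>" "n \<epsilon> a" for d n
    proof -
      have n: "st n" using a_st dn by blast
      \<comment> \<open>The index b(d) belongs to the standard finite set \<open>a\<close>, so it is
        standard, and d is recovered from it by injectivity of \<open>b\<close>.\<close>
      have d: "st d"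
      proof (rule standard_unique[where P = "\<lambda>d'. d' \<epsilon> \<Delta> \<and> ap b d' = ap b d"])
        show "standard_definable (\<lambda>e. e 0 \<epsilon> \<Delta> \<and> ap b (e 0) = ap b d)"
          by (intro definable_set_intros) (use b a_st dn in auto)
      qed (use dn is_bij_inj[OF b(2)] in blast)+
      let ?g = "ap2 k d n"
      have g': "st ?g" "?g \<epsilon> B" using k(1) d n k_mem dn by (simp_all add: st_ap st_ord_pair)
      have qn: "st (ap q n)" "ap q n \<epsilon> Re"
        using q(1) n ap_mem[OF q(2)] dn by (simp_all add: st_ap)
      have "ap2 (D d) ?g g \<prec> ap q n"
        using Y(2) dn hdist_cls[OF d dn(1) g'(2) g(2)] ap_map[OF d dn(1)] g(3) by metis
      then have "dist_w d ?g g \<prec> ap q n"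
        using is_shadow_less[OF D_shadow[OF d dn(1) g'(1) g(1) g'(2) g(2)]] qn by blast
      then show ?thesis using pm_sym[OF pm[OF dn(1)]] B_ap_w g g' by simp
    qed
    \<comment> \<open>The set of precisions is taken to be \<open>a\<close> itself: it contains
      every index from \<open>a\<close> and asks for no precision outside \<open>a\<close>.\<close>
    show "\<exists>y. \<forall>x. x \<epsilon> a \<longrightarrow> ?\<phi> x y"
      using near B_ap_w[OF g(2)] by (intro exI[of _ "pr (ap g w) a"]) auto
  qed
  then obtain y where y: "w_standard (\<epsilon>) st I w y" "\<And>x. st x \<Longrightarrow> x \<epsilon> \<kappa>\<^sub>0 \<Longrightarrow> ?\<phi> x y" by blast
  \<comment> \<open>The index 0 serves to exhibit \<open>y\<close> as a pair whose first component
    lies in M.\<close>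
  have "?\<phi> (empty_set (\<epsilon>)) y"
    by (rule y(2)) (use \<kappa>\<^sub>0(3) st_empty empty_mem_omega subset_ofD in auto)
  then obtain z u where zu: "y = pr z u" "z \<epsilon> M" by blast
  have near: "ap2 d z (ap (ap2 k d n) w) \<prec> ap q n" if dn: "st d" "d \<epsilon> \<Delta>" "st n" "n \<epsilon> ?\<omega>" for d n
  proof -
    \<comment> \<open>The condition at index n puts n into \<open>u\<close>; the condition at index
      b(d) then asks for precision q(n) with respect to d.\<close>
    have "n \<epsilon> u" using y(2)[OF dn(3) subset_ofD[OF \<kappa>\<^sub>0(3) dn(4)]] dn(4) zu(1) by auto
    moreover have "ap b d \<epsilon> \<kappa>\<^sub>0" using ap_mem[OF is_bij_is_fun[OF b(2)] dn(2)] subset_ofD[OF \<kappa>\<^sub>0(4)] by blast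
    ultimately show ?thesis using y(2)[OF st_ap[OF b(1) dn(1)]] dn zu(1) by auto
  qed

  have "\<exists>f. st f \<and> is_fun (\<epsilon>) f I M \<and> ap f w = z"
    by (rule w_standard_fun[where Q = "\<lambda>y z. \<exists>u. y = pr z u", OF _ st_I st_M w_mem y(1) zu(2)])
      (intro definable_set_intros, use zu in auto)
  then obtain f where f: "st f" "is_fun (\<epsilon>) f I M" "ap f w = z" by blast
  \<comment> \<open>The point z = f(w) is within q(0) of k(d, 0)(w), which is a finite point; so z
    is finite and f belongs to B.\<close>
  have "\<exists>p a. st p \<and> p \<epsilon> M \<and> st a \<and> a \<epsilon> Re \<and> ap2 d z p \<prec> a" if d: "st d" "d \<epsilon> \<Delta>" for d
  proof -
    let ?g = "ap2 k d (empty_set (\<epsilon>))"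
    have g: "st ?g" "?g \<epsilon> B"
      using k(1) d k_mem empty_mem_omega by (simp_all add: st_ap st_ord_pair st_empty)
    obtain p a where p: "st p" "p \<epsilon> M" "st a" "a \<epsilon> Re" "ap2 d (ap ?g w) p \<prec> a"
      using mem_B_st[OF g(1)] g(2) d unfolding finite_point_iff by meson
    have q0: "ap q (empty_set (\<epsilon>)) \<epsilon> Re" "st (ap q (empty_set (\<epsilon>)))"
      using ap_mem[OF q(2)] empty_mem_omega q(1) st_empty st_ap by auto
    have "ap2 d z p \<prec> ap q (empty_set (\<epsilon>)) \<oplus> a"
      using pm_triangle_less[OF pm[OF d(2)] zu(2) B_ap_w[OF g(2)] p(2) q0(1) p(4)
          near[OF d st_empty empty_mem_omega] p(5)] .
    then show ?thesis using p q0 st_add add_real by blast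
  qed
  then have fB: "f \<epsilon> B" using mem_B_st[OF f(1)] f zu(2) by (simp add: finite_point_iff)
  \<comment> \<open>Strictness is lost in passing to the shadow; it is regained below by choosing n
    with q(n) < t.\<close>
  have close: "ap2 (D d) f (ap2 k d n) \<preceq> ap q n" if dn: "st d" "d \<epsilon> \<Delta>" "st n" "n \<epsilon> ?\<omega>" for d n
  proof -
    have g: "st (ap2 k d n)" "ap2 k d n \<epsilon> B"
      using k(1) dn k_mem by (simp_all add: st_ap st_ord_pair)
    show ?thesis
      using is_shadow_le[OF D_shadow[OF dn(1,2) f(1) g(1) fB g(2)]] near[OF dn] f(3) fB g dn
        ap_mem[OF q(2) dn(4)] st_ap[OF q(1) dn(3)] dist_w_real[OF dn(2) fB g(2)] by simp
  qed
  let ?P = "\<lambda>h r. h \<epsilon> family \<and> r \<epsilon> Re \<and> \<zero> \<prec> r \<longrightarrow>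
      (\<exists>A. A \<epsilon> F \<and> (\<forall>Y. Y \<epsilon> A \<longrightarrow> ap2 h (cls f) Y \<prec> r))"
  have "?P h r" for h r
  proof (rule transfer2[where P = ?P])
    show "standard_definable (\<lambda>e. ?P (e 0) (e 1))"
      by (intro definable_hull_intros) (use F f in auto)
    fix h r assume st: "st h" "st r"
    show "?P h r"
    proof
      assume hr: "h \<epsilon> family \<and> r \<epsilon> Re \<and> \<zero> \<prec> r"
      then obtain d where d: "st d" "d \<epsilon> \<Delta>" "h = hdist d" using mem_family_st st by blast
      \<comment> \<open>One half of r covers the distance from the limit to the centre, the other
        half the ball about the centre. Both t and n are taken standard, because
        \<open>close\<close> holds for standard n.\<close>
      obtain t0 where "t0 \<epsilon> Re \<and> \<zero> \<prec> t0 \<and> t0 \<oplus> t0 = r" using ex_half hr by blast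
      then have "\<exists>t. st t \<and> t \<epsilon> Re \<and> \<zero> \<prec> t \<and> t \<oplus> t = r"
        by (rule transfer_ex[where P = "\<lambda>t. t \<epsilon> Re \<and> \<zero> \<prec> t \<and> t \<oplus> t = r", rotated])
          (intro definable_real_intros, use st in auto)
      then obtain t where t: "st t" "t \<epsilon> Re" "\<zero> \<prec> t" "t \<oplus> t = r" by blast
      obtain n0 where "n0 \<epsilon> ?\<omega> \<and> ap q n0 \<prec> t" using q(4)[OF t(2,3)] by blast
      then have "\<exists>n. st n \<and> n \<epsilon> ?\<omega> \<and> ap q n \<prec> t"
        by (rule transfer_ex[where P = "\<lambda>n. n \<epsilon> ?\<omega> \<and> ap q n \<prec> t", rotated])
          (intro definable_real_intros, use t q(1) st_omega in auto)
      then obtain n where n: "st n" "n \<epsilon> ?\<omega>" "ap q n \<prec> t" by blast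
      obtain A where A: "A \<epsilon> F" "\<And>Y. Y \<epsilon> A \<Longrightarrow> ap2 h (cls (ap2 k d n)) Y \<prec> ap q n"
        using k_ball[OF d(2) n(2)] ap_map[OF d(1,2)] d(3) by auto
      have qn: "ap q n \<epsilon> Re" using ap_mem[OF q(2) n(2)] .
      note g = k_mem[OF d(2) n(2)]
      have Df: "ap2 (D d) f (ap2 k d n) \<epsilon> Re" using pm_real[OF D_pm[OF d(1,2)] fB g] .
      have 1: "ap2 h (cls f) (cls (ap2 k d n)) \<prec> t"
        using le_less_trans[OF Df qn t(2) close[OF d(1,2) n(1,2)] n(3)] hdist_cls[OF d(1,2) fB g] d(3)
        by simp
      have "ap2 h (cls f) Y \<prec> r" if Y: "Y \<epsilon> A" for Y
      proof -
        have h: "h \<epsilon> family" and m: "cls f \<epsilon> hull" "cls (ap2 k d n) \<epsilon> hull" "Y \<epsilon> hull"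
          using hr cls_mem_hull fB g F_sub[OF A(1) Y] by auto
        have "ap2 h (cls (ap2 k d n)) Y \<prec> t"
          using less_trans[OF pm_real[OF hpm[OF h] m(2,3)] qn t(2) A(2)[OF Y] n(3)] .
        from pm_triangle_less[OF hpm[OF h] m t(2,2) 1 this] t(4) show ?thesis by simp
      qed
      with A(1) show "\<exists>A. A \<epsilon> F \<and> (\<forall>Y. Y \<epsilon> A \<longrightarrow> ap2 h (cls f) Y \<prec> r)" by blast
    qed
  qed
  with cls_mem_hull[OF fB] show ?thesis by blast
qed

lemma hull_complete:
  assumes ideal: "w_idealization (\<epsilon>) st I w (ord_max (\<epsilon>) \<delta> (omega (\<epsilon>)))"
    and card: "is_card_of (\<epsilon>) \<Delta> \<delta>"
  shows "is_complete (\<epsilon>) R hull family"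
proof -
  \<comment> \<open>Idealization runs over a standard index set, with the bijection as a parameter,
    so a standard cardinal of \<Delta> and a standard bijection are supplied by Transfer.\<close>
  have "\<exists>\<delta>. st \<delta> \<and> is_card_of (\<epsilon>) \<Delta> \<delta>"
    by (rule transfer_ex[where P = "is_card_of (\<epsilon>) \<Delta>", OF _ card])
      (intro definable_set_intros definable_is_card_of, simp)
  then obtain \<delta>\<^sub>0 where \<delta>\<^sub>0: "st \<delta>\<^sub>0" "is_card_of (\<epsilon>) \<Delta> \<delta>\<^sub>0" by blast
  obtain b0 where b0: "is_bij (\<epsilon>) b0 \<Delta> \<delta>\<^sub>0" using \<delta>\<^sub>0(2) unfolding is_card_of_def by blast
  have "\<exists>b. st b \<and> is_bij (\<epsilon>) b \<Delta> \<delta>\<^sub>0"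
    by (rule transfer_ex[where P = "\<lambda>b. is_bij (\<epsilon>) b \<Delta> \<delta>\<^sub>0", OF _ b0])
      (intro definable_set_intros definable_is_bij, use \<delta>\<^sub>0 in auto)
  then obtain b where b: "st b" "is_bij (\<epsilon>) b \<Delta> \<delta>\<^sub>0" by blast
  obtain q where q: "st q" "is_fun (\<epsilon>) q (omega (\<epsilon>)) Re" "\<And>n. n \<epsilon> omega (\<epsilon>) \<Longrightarrow> \<zero> \<prec> ap q n"
    "\<And>r. r \<epsilon> Re \<Longrightarrow> \<zero> \<prec> r \<Longrightarrow> \<exists>n. n \<epsilon> omega (\<epsilon>) \<and> ap q n \<prec> r"
    using ex_null_sequence by blast
  have ord: "is_ordinal (\<epsilon>) \<delta>\<^sub>0" using \<delta>\<^sub>0(2) by (simp add: is_card_of_def)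
  note converges = standard_cauchy_filter_converges[OF ideal st_ord_max[OF \<delta>\<^sub>0(1) st_omega]
      card_le_ord_max[OF card \<delta>\<^sub>0(2)] ord_max_bounds(2,1)[OF ord] b q(1,2)]
  \<comment> \<open>Expressed by single pseudo-metrics and radii, the implication from
    \<open>?C\<close> to \<open>?L\<close> has only standard parameters, so Transfer extends it from
    standard filters to all filters of the structure.\<close>
  let ?C = "\<lambda>F. is_filter (\<epsilon>) hull F \<and> (\<forall>h r. h \<epsilon> family \<and> r \<epsilon> Re \<and> \<zero> \<prec> r \<longrightarrow>
      (\<exists>A. A \<epsilon> F \<and> (\<forall>X Y. X \<epsilon> A \<and> Y \<epsilon> A \<longrightarrow> ap2 h X Y \<prec> r)))"
  let ?L = "\<lambda>F. \<exists>X. X \<epsilon> hull \<and> (\<forall>h r. h \<epsilon> family \<and> r \<epsilon> Re \<and> \<zero> \<prec> r \<longrightarrow>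
      (\<exists>A. A \<epsilon> F \<and> (\<forall>Y. Y \<epsilon> A \<longrightarrow> ap2 h X Y \<prec> r)))"
  have *: "?C F \<longrightarrow> ?L F" for F
  proof (rule transfer[where P = "\<lambda>F. ?C F \<longrightarrow> ?L F"])
    show "standard_definable (\<lambda>e. ?C (e 0) \<longrightarrow> ?L (e 0))"
      by (intro definable_real_intros definable_is_filter) auto
    show "?C F \<longrightarrow> ?L F" if "st F" for F
      by (intro impI converges) (use q(3,4) that in blast)+
  qed
  show ?thesis
    unfolding is_complete_def
  proof (intro allI impI)
    fix F assume F: "cauchy_filter (\<epsilon>) R hull family F"
    then have filter: "is_filter (\<epsilon>) hull F" by (simp add: cauchy_filter_def)
    with cauchy_filter_small[OF hull_uniform F] have "?C F" by blast
    from mp[OF * this] obtain X where "X \<epsilon> hull" "\<And>h r. h \<epsilon> family \<Longrightarrow> r \<epsilon> Re \<Longrightarrow> \<zero> \<prec> r \<Longrightarrow>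
        \<exists>A. A \<epsilon> F \<and> (\<forall>Y. Y \<epsilon> A \<longrightarrow> ap2 h X Y \<prec> r)" by blast
    then show "\<exists>X. converges_to (\<epsilon>) R hull family F X"
      using converges_toI[OF hull_uniform filter] by blast
  qed
qed

end

theorem theorem4p8:
  fixes mem :: "'u \<Rightarrow> 'u \<Rightarrow> bool" and st :: "'u \<Rightarrow> bool"
    and R :: "'u field_str"
    and M \<Delta> \<delta> \<kappa> I w :: 'u
  assumes "BST mem st"
    and "complete_ordered_field mem R" and "standard_field_str st R"
    and "st M" and "st \<Delta>"
    and "is_uniform_space mem R M \<Delta>" and "is_hausdorff mem R M \<Delta>"
    and "is_card_of mem \<Delta> \<delta>" and "\<kappa> = ord_max mem \<delta> (omega mem)"
    and "st I" and "\<not> is_finite mem I" and "mem w I"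
    and "w_idealization mem st I w \<kappa>"
  shows "is_uniform_space mem R (hull_M mem st R M \<Delta> I w) (hull_family mem st R M \<Delta> I w) \<and>
         is_hausdorff mem R (hull_M mem st R M \<Delta> I w) (hull_family mem st R M \<Delta> I w) \<and>
         is_complete mem R (hull_M mem st R M \<Delta> I w) (hull_family mem st R M \<Delta> I w) \<and>
         embeds mem (hull_c mem st R M \<Delta> I w) (hull_map mem st R M \<Delta> I w)
           M \<Delta> (hull_M mem st R M \<Delta> I w) (hull_family mem st R M \<Delta> I w)"
proof -
  interpret hull_setup mem st R M \<Delta> I w
    using assms
    by (intro hull_setup.intro BST_reals.intro BST_reals_axioms.intro hull_setup_axioms.intro)
  show ?thesis
    using hull_uniform hull_hausdorff hull_complete hull_embeds assms by blast
qed

end
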